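(* Let $H_2\subset H_1$ be separable Hilbert spaces with a dense inclusion of $H_2$ into $H_1$. Let $O_1$ be an open subset of $\mathbb R\times H_1$ and let $\phi\colon O_1\to H_1$ be asymptotically constant parametrized tame. Let $$\mathcal U:=\{\xi\in W^{1,2}(\mathbb R,H_1)\cap L^2(\mathbb R,H_2)\mid(s,\xi(s))\in O_1\ \forall s\in\mathbb R\}.$$ Then the weak tangent map $$T\Phi\colon\mathcal U\times L^2(\mathbb R,H_1)\to\big(W^{1,2}(\mathbb R,H_1)\cap L^2(\mathbb R,H_2)\big)\times L^2(\mathbb R,H_1),\qquad(\xi,\eta)\mapsto\big(\Phi(\xi),d\Phi|_\xi\eta\big),$$ defined by $$\Phi(\xi)(s):=\phi_s(\xi(s)),\qquad(d\Phi|_\xi\eta)(s):=d\phi_s|_{\xi(s)}\eta(s),$$ where $\phi_s(x):=\phi(s,x)$, is well defined and continuously differentiable.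
   Context: Norms are $|\cdot|_1:=\|\cdot\|_{H_1}$, $|\cdot|_2:=\|\cdot\|_{H_2}$, normalized so that $|\cdot|_1\le|\cdot|_2$ on $H_2$. The inclusion is not assumed compact. **Parametrized tame.** Let $O_1\subset\mathbb R\times H_1$ be open and $O_2:=O_1\cap(\mathbb R\times H_2)$. A $C^2$ map $\phi\colon O_1\to H_1$ is *parametrized tame* if (1) $\phi(O_2)\subset H_2$ and $\phi|_{O_2}\colon O_2\to H_2$ is $C^2$; (2) for every $(s,x)\in O_1$ there are an open neighborhood $W_{s,x}$ of $(s,x)$ in $O_1$ and a constant $\kappa_{s,x}>0$ such that for all $(t,y)\in W_{s,x}\cap(\mathbb R\times H_2)$ and all $\xi,\eta\in H_2$: $|d^2\phi_t|_y(\xi,\eta)|_2\le\kappa_{s,x}\big(|\xi|_1|\eta|_2+|\xi|_2|\eta|_1+|y|_2|\xi|_1|\eta|_1\big)$. Here $\phi_t:=\phi(t,\cdot)$ and $d^2\phi_t$ is its second derivative in the $H_1$-variable. **Asymptotically constant.** Let $U_1^s:=\{x\in H_1\mid(s,x)\in O_1\}$. A parametrized tame map $\phi$ is *asymptotically constant* if there exists $T>0$ such that the map $\phi_s\colon U_1^s\to H_1$ (including its domain) is independent of $s$ for $s\ge T$, and independent of $s$ for $s\le-T$, and moreover $0\in U_1^s$ and $\phi_s(0)=0$ whenever $|s|\ge T$. $W^{1,2}(\mathbb R,H_1)\cap L^2(\mathbb R,H_2)$ is a Hilbert space with inner product $\int_{\mathbb R}\langle\dot\xi,\dot\eta\rangle_{H_1}ds+\int_{\mathbb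 R}\langle\xi,\eta\rangle_{H_2}ds$. Elements of $W^{1,2}(\mathbb R,H_1)$ are identified with their continuous representatives. *)

theory Defs
  imports "HOL-Analysis.Analysis" "HOL-Library.Function_Algebras"
begin

section \<open>Twice continuously differentiable maps\<close>

definition fderiv ::
    "('a::real_normed_vector \<Rightarrow> 'b::real_normed_vector) \<Rightarrow> 'a \<Rightarrow> 'a \<Rightarrow>\<^sub>L 'b" where
  "fderiv f x = Blinfun (frechet_derivative f (at x))"

definition C1_on ::
    "'a set \<Rightarrow> ('a::real_normed_vector \<Rightarrow> 'b::real_normed_vector) \<Rightarrow> bool" where
  "C1_on S f \<longleftrightarrow> (\<forall>x\<in>S. f differentiable (at x)) \<and> continuous_on S (fderiv f)"

definition C2_on ::
    "'a set \<Rightarrow> ('a::real_normed_vector \<Rightarrow> 'b::real_normed_vector) \<Rightarrow> bool" where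
  "C2_on S f \<longleftrightarrow> (\<forall>x\<in>S. f differentiable (at x)) \<and> C1_on S (fderiv f)"

definition fderiv2 ::
    "('a::real_normed_vector \<Rightarrow> 'b::real_normed_vector) \<Rightarrow> 'a \<Rightarrow> 'a \<Rightarrow> 'a \<Rightarrow> 'b" where
  "fderiv2 f x \<xi> \<eta> = blinfun_apply (blinfun_apply (fderiv (fderiv f) x) \<xi>) \<eta>"


section \<open>Parametrized tame maps\<close>

text \<open>
  The inclusion of \<open>H\<^sub>2\<close> into \<open>H\<^sub>1\<close> is an injective linear map \<open>\<iota>\<close> from the type
  \<open>'b\<close> (for \<open>H\<^sub>2\<close>) to the type \<open>'a\<close> (for \<open>H\<^sub>1\<close>). An element \<open>x\<close> of \<open>H\<^sub>1\<close> lies in \<open>H\<^sub>2\<close> iff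
  \<open>x \<in> range \<iota>\<close>, and then it is \<open>inv \<iota> x\<close> as an element of \<open>H\<^sub>2\<close>.
\<close>

definition dense_inclusion :: "('b::real_normed_vector \<Rightarrow> 'a::real_normed_vector) \<Rightarrow> bool" where
  "dense_inclusion \<iota> \<longleftrightarrow>
     linear \<iota> \<and> inj \<iota> \<and> closure (range \<iota>) = UNIV \<and> (\<forall>x. norm (\<iota> x) \<le> norm x)"

definition level2 :: "('b \<Rightarrow> 'a) \<Rightarrow> (real \<times> 'a) set \<Rightarrow> (real \<times> 'b) set" where
  "level2 \<iota> O1 = {(s, x). (s, \<iota> x) \<in> O1}"

text \<open>
  Maps on an open set \<open>O1\<close> are represented by total functions, whose values outside \<open>O1\<close> are
  irrelevant.
\<close>

definition parametrized_tame ::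
    "('b::real_normed_vector \<Rightarrow> 'a::real_normed_vector) \<Rightarrow> (real \<times> 'a) set \<Rightarrow>
     (real \<times> 'a \<Rightarrow> 'a) \<Rightarrow> bool" where
  "parametrized_tame \<iota> O1 \<phi> \<longleftrightarrow>
     open O1 \<and> C2_on O1 \<phi> \<and>
     (\<forall>(s, x) \<in> level2 \<iota> O1. \<phi> (s, \<iota> x) \<in> range \<iota>) \<and>
     C2_on (level2 \<iota> O1) (\<lambda>(s, x). inv \<iota> (\<phi> (s, \<iota> x))) \<and>
     (\<forall>p\<in>O1. \<exists>W \<kappa>. open W \<and> p \<in> W \<and> W \<subseteq> O1 \<and> \<kappa> > 0 \<and>
        (\<forall>(t, y) \<in> level2 \<iota> W. \<forall>\<xi> \<eta>.
           norm (inv \<iota> (fderiv2 (\<lambda>x. \<phi> (t, x)) (\<iota> y) (\<iota> \<xi>) (\<iota> \<eta>)))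
             \<le> \<kappa> * (norm (\<iota> \<xi>) * norm \<eta> + norm \<xi> * norm (\<iota> \<eta>)
                      + norm y * norm (\<iota> \<xi>) * norm (\<iota> \<eta>))))"

definition slice :: "(real \<times> 'a) set \<Rightarrow> real \<Rightarrow> 'a set" where
  "slice O1 s = {x. (s, x) \<in> O1}"

definition same_slice_map ::
    "(real \<times> 'a) set \<Rightarrow> (real \<times> 'a \<Rightarrow> 'a) \<Rightarrow> real \<Rightarrow> real \<Rightarrow> bool" where
  "same_slice_map O1 \<phi> s t \<longleftrightarrow>
     slice O1 s = slice O1 t \<and> (\<forall>x \<in> slice O1 s. \<phi> (s, x) = \<phi> (t, x))"

definition asymptotically_constant ::
    "(real \<times> 'a::real_normed_vector) set \<Rightarrow> (real \<times> 'a \<Rightarrow> 'a) \<Rightarrow> bool" where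
  "asymptotically_constant O1 \<phi> \<longleftrightarrow>
     (\<exists>T>0. (\<forall>s\<ge>T. \<forall>t\<ge>T. same_slice_map O1 \<phi> s t) \<and>
            (\<forall>s\<le>-T. \<forall>t\<le>-T. same_slice_map O1 \<phi> s t) \<and>
            (\<forall>s. \<bar>s\<bar> \<ge> T \<longrightarrow> 0 \<in> slice O1 s \<and> \<phi> (s, 0) = 0))"


section \<open>Function spaces\<close>

text \<open>
  Elements of \<open>L\<^sup>2\<close> are represented by functions, with the \<open>L\<^sup>2\<close> norm as a seminorm vanishing
  exactly on the functions that are zero almost everywhere.
\<close>

definition L2 :: "(real \<Rightarrow> 'a::{real_inner, banach, second_countable_topology}) set" where
  "L2 = {f \<in> borel_measurable lebesgue. integrable lebesgue (\<lambda>s. (norm (f s))\<^sup>2)}"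

definition L2_seminorm ::
    "(real \<Rightarrow> 'a::{real_inner, banach, second_countable_topology}) \<Rightarrow> real" where
  "L2_seminorm f = sqrt (\<integral>s. (norm (f s))\<^sup>2 \<partial>lebesgue)"

text \<open>Weak derivatives on the line, tested against \<open>C\<^sup>1\<close> functions of compact support.\<close>

definition test_function :: "(real \<Rightarrow> real) \<Rightarrow> bool" where
  "test_function \<rho> \<longleftrightarrow> \<rho> C1_differentiable_on UNIV \<and> compact (closure {x. \<rho> x \<noteq> 0})"

definition has_weak_derivative ::
    "(real \<Rightarrow> 'a::{real_inner, banach, second_countable_topology}) \<Rightarrow> (real \<Rightarrow> 'a) \<Rightarrow> bool"
    where
  "has_weak_derivative f g \<longleftrightarrow>
     (\<forall>\<rho>. test_function \<rho> \<longrightarrow>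
        (\<integral>s. deriv \<rho> s *\<^sub>R f s \<partial>lebesgue) = - (\<integral>s. \<rho> s *\<^sub>R g s \<partial>lebesgue))"

text \<open>Continuity selects the continuous representative of each class.\<close>

definition W12 :: "(real \<Rightarrow> 'a::{real_inner, banach, second_countable_topology}) set" where
  "W12 = {f \<in> L2. continuous_on UNIV f \<and> (\<exists>g\<in>L2. has_weak_derivative f g)}"

definition weak_deriv ::
    "(real \<Rightarrow> 'a::{real_inner, banach, second_countable_topology}) \<Rightarrow> real \<Rightarrow> 'a" where
  "weak_deriv f = (SOME g. g \<in> L2 \<and> has_weak_derivative f g)"

text \<open>
  The space \<open>W\<^sup>1\<^sup>,\<^sup>2(\<real>, H\<^sub>1) \<inter> L\<^sup>2(\<real>, H\<^sub>2)\<close>. Membership of a continuous \<open>H\<^sub>1\<close>-valued \<open>f\<close> in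
  \<open>L\<^sup>2(\<real>, H\<^sub>2)\<close> means that \<open>f s \<in> H\<^sub>2\<close> for almost every \<open>s\<close>, with a square integrable
  \<open>H\<^sub>2\<close>-valued function; the values of \<open>inv \<iota>\<close> on the exceptional null set do not matter.
\<close>

definition W12_L2 ::
    "('b::{real_inner, banach, second_countable_topology} \<Rightarrow>
      'a::{real_inner, banach, second_countable_topology}) \<Rightarrow> (real \<Rightarrow> 'a) set" where
  "W12_L2 \<iota> = {f \<in> W12. (AE s in lebesgue. f s \<in> range \<iota>) \<and> (\<lambda>s. inv \<iota> (f s)) \<in> L2}"

definition W12_L2_norm ::
    "('b::{real_inner, banach, second_countable_topology} \<Rightarrow>
      'a::{real_inner, banach, second_countable_topology}) \<Rightarrow> (real \<Rightarrow> 'a) \<Rightarrow> real" where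
  "W12_L2_norm \<iota> f =
     sqrt ((L2_seminorm (weak_deriv f))\<^sup>2 + (L2_seminorm (\<lambda>s. inv \<iota> (f s)))\<^sup>2)"

definition tangent_space ::
    "('b::{real_inner, banach, second_countable_topology} \<Rightarrow>
      'a::{real_inner, banach, second_countable_topology}) \<Rightarrow>
     ((real \<Rightarrow> 'a) \<times> (real \<Rightarrow> 'a)) set" where
  "tangent_space \<iota> = W12_L2 \<iota> \<times> L2"

definition tangent_norm ::
    "('b::{real_inner, banach, second_countable_topology} \<Rightarrow>
      'a::{real_inner, banach, second_countable_topology}) \<Rightarrow>
     (real \<Rightarrow> 'a) \<times> (real \<Rightarrow> 'a) \<Rightarrow> real" where
  "tangent_norm \<iota> = (\<lambda>(\<xi>, \<eta>). sqrt ((W12_L2_norm \<iota> \<xi>)\<^sup>2 + (L2_seminorm \<eta>)\<^sup>2))"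


section \<open>Continuously differentiable maps between seminormed spaces\<close>

text \<open>
  Functions form a real vector space pointwise; the additive structure is the one of
  \<^theory>\<open>HOL-Library.Function_Algebras\<close>.
\<close>

instantiation "fun" :: (type, real_vector) real_vector
begin

definition scaleR_fun :: "real \<Rightarrow> ('a \<Rightarrow> 'b) \<Rightarrow> 'a \<Rightarrow> 'b" where
  "scaleR_fun c f = (\<lambda>x. c *\<^sub>R f x)"

instance
  by standard (auto simp: scaleR_fun_def fun_eq_iff algebra_simps)

end

text \<open>
  For linear subspaces \<open>X\<close>, \<open>Y\<close> with seminorms \<open>p\<close>, \<open>q\<close>, the predicate \<open>C1_map X p Y q U F\<close>
  says that \<open>U\<close> is open in \<open>X\<close> and that \<open>F\<close> is a continuously Frechet differentiable map
  from \<open>U\<close> to \<open>Y\<close>, with derivative continuous in the operator norm. It passes to the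
  normed quotients of \<open>X\<close> and \<open>Y\<close> by the null spaces of \<open>p\<close> and \<open>q\<close>: taking
  increments \<open>h\<close> with \<open>p h = 0\<close> shows that \<open>F\<close> and its derivative respect the classes
  (see \<open>C1_map_respects_null\<close>).
\<close>

definition open_in_seminormed ::
    "'x::real_vector set \<Rightarrow> ('x \<Rightarrow> real) \<Rightarrow> 'x set \<Rightarrow> bool" where
  "open_in_seminormed X p U \<longleftrightarrow>
     U \<subseteq> X \<and> (\<forall>x\<in>U. \<exists>\<delta>>0. \<forall>y\<in>X. p (y - x) < \<delta> \<longrightarrow> y \<in> U)"

definition bounded_linear_between ::
    "'x::real_vector set \<Rightarrow> ('x \<Rightarrow> real) \<Rightarrow> 'y::real_vector set \<Rightarrow> ('y \<Rightarrow> real) \<Rightarrow>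
     ('x \<Rightarrow> 'y) \<Rightarrow> bool" where
  "bounded_linear_between X p Y q A \<longleftrightarrow>
     (\<forall>h\<in>X. A h \<in> Y) \<and>
     (\<forall>h\<in>X. \<forall>k\<in>X. A (h + k) = A h + A k) \<and>
     (\<forall>c. \<forall>h\<in>X. A (c *\<^sub>R h) = c *\<^sub>R A h) \<and>
     (\<exists>C. \<forall>h\<in>X. q (A h) \<le> C * p h)"

definition C1_map ::
    "'x::real_vector set \<Rightarrow> ('x \<Rightarrow> real) \<Rightarrow> 'y::real_vector set \<Rightarrow> ('y \<Rightarrow> real) \<Rightarrow>
     'x set \<Rightarrow> ('x \<Rightarrow> 'y) \<Rightarrow> bool" where
  "C1_map X p Y q U F \<longleftrightarrow>
     open_in_seminormed X p U \<and> (\<forall>x\<in>U. F x \<in> Y) \<and>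
     (\<exists>D. (\<forall>x\<in>U. bounded_linear_between X p Y q (D x)) \<and>
          (\<forall>x\<in>U. \<forall>\<epsilon>>0. \<exists>\<delta>>0. \<forall>y\<in>U. p (y - x) < \<delta> \<longrightarrow>
             q (F y - F x - D x (y - x)) \<le> \<epsilon> * p (y - x)) \<and>
          (\<forall>x\<in>U. \<forall>\<epsilon>>0. \<exists>\<delta>>0. \<forall>y\<in>U. p (y - x) < \<delta> \<longrightarrow>
             (\<forall>h\<in>X. q (D y h - D x h) \<le> \<epsilon> * p h)))"

lemma C1_map_respects_null:
  assumes F: "C1_map X p Y q U F" and X: "subspace X" and Y: "subspace Y"
    and q0: "\<And>y. y \<in> Y \<Longrightarrow> 0 \<le> q y"
    and q_add: "\<And>y z. y \<in> Y \<Longrightarrow> z \<in> Y \<Longrightarrow> q (y + z) \<le> q y + q z"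
    and x: "x \<in> U" and y: "y \<in> X" and null: "p (y - x) = 0"
  shows "y \<in> U" and "q (F y - F x) = 0"
proof -
  have op: "open_in_seminormed X p U" and FY: "\<forall>x\<in>U. F x \<in> Y"
    using F by (auto simp: C1_map_def)
  obtain D where D: "\<forall>x\<in>U. bounded_linear_between X p Y q (D x)"
    and der: "\<forall>x\<in>U. \<forall>\<epsilon>>0. \<exists>\<delta>>0. \<forall>y\<in>U. p (y - x) < \<delta> \<longrightarrow>
             q (F y - F x - D x (y - x)) \<le> \<epsilon> * p (y - x)"
    using F unfolding C1_map_def by blast
  show yU: "y \<in> U"
    using op x y null unfolding open_in_seminormed_def by (metis)
  have xX: "x \<in> X" using op x by (auto simp: open_in_seminormed_def)
  have dX: "y - x \<in> X" by (rule subspace_diff[OF X y xX])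
  have Dx: "bounded_linear_between X p Y q (D x)" using D x by blast
  then have DY: "D x (y - x) \<in> Y" using dX unfolding bounded_linear_between_def by blast
  obtain C where "\<forall>h\<in>X. q (D x h) \<le> C * p h"
    using Dx unfolding bounded_linear_between_def by blast
  then have qD: "q (D x (y - x)) \<le> 0" using dX null by fastforce
  have dF: "q (F y - F x - D x (y - x)) \<le> 0"
    using der[rule_format, OF x, of 1] yU null by auto
  have FF: "F y - F x \<in> Y" using Y FY x yU by (auto intro: subspace_diff)
  have "q (F y - F x) \<le> 0"
    using dF qD q_add[OF subspace_diff[OF Y FF DY] DY] by simp
  then show "q (F y - F x) = 0" using q0[OF FF] by simp
qed

lemma C1_map_UNIV_iff:
  fixes F :: "'a::real_normed_vector \<Rightarrow> 'b::real_normed_vector"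
  shows "C1_map UNIV norm UNIV norm U F \<longleftrightarrow> open U \<and> C1_on U F"
proof
  assume F: "C1_map UNIV norm UNIV norm U F"
  then have op: "open U"
    by (auto simp: C1_map_def open_in_seminormed_def open_dist dist_norm)
  obtain D where D: "\<forall>x\<in>U. bounded_linear_between UNIV norm UNIV norm (D x)"
    and der: "\<forall>x\<in>U. \<forall>\<epsilon>>0. \<exists>\<delta>>0. \<forall>y\<in>U. norm (y - x) < \<delta> \<longrightarrow>
             norm (F y - F x - D x (y - x)) \<le> \<epsilon> * norm (y - x)"
    and cont: "\<forall>x\<in>U. \<forall>\<epsilon>>0. \<exists>\<delta>>0. \<forall>y\<in>U. norm (y - x) < \<delta> \<longrightarrow>
             (\<forall>h. norm (D y h - D x h) \<le> \<epsilon> * norm h)"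
    using F unfolding C1_map_def by auto
  have bl: "bounded_linear (D x)" if "x \<in> U" for x
  proof -
    have B: "bounded_linear_between UNIV norm UNIV norm (D x)" using D that by blast
    then obtain C where "\<forall>h. norm (D x h) \<le> C * norm h"
      unfolding bounded_linear_between_def by blast
    then show ?thesis
      using B unfolding bounded_linear_between_def
      by (intro bounded_linear_intro[of _ C]) (simp_all add: mult.commute)
  qed
  have hd: "(F has_derivative D x) (at x)" if x: "x \<in> U" for x
  proof -
    have "(F has_derivative D x) (at x within U)"
      using der bl[OF x] x unfolding has_derivative_within_alt by blast
    then show ?thesis using at_within_open[OF x op] by simp
  qed
  have fd: "blinfun_apply (fderiv F x) = D x" if "x \<in> U" for x
    unfolding fderiv_def frechet_derivative_at[OF hd[OF that], symmetric]
    by (rule bounded_linear_Blinfun_apply[OF bl[OF that]])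
  have "continuous_on U (fderiv F)"
    unfolding continuous_on_iff
  proof (intro ballI allI impI)
    fix x and e :: real assume x: "x \<in> U" and e: "e > 0"
    obtain d where d: "d > 0" "\<forall>y\<in>U. norm (y - x) < d \<longrightarrow>
        (\<forall>h. norm (D y h - D x h) \<le> e/2 * norm h)"
      using cont x e by (meson half_gt_zero)
    have "dist (fderiv F y) (fderiv F x) < e" if "y \<in> U" "dist y x < d" for y
    proof -
      have "norm (fderiv F y - fderiv F x) \<le> e/2"
        using d that x e by (intro norm_blinfun_bound) (auto simp: blinfun.diff_left fd dist_norm)
      then show ?thesis using e by (simp add: dist_norm)
    qed
    then show "\<exists>d>0. \<forall>y\<in>U. dist y x < d \<longrightarrow> dist (fderiv F y) (fderiv F x) < e"
      using d(1) by blast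
  qed
  then show "open U \<and> C1_on U F"
    using op hd by (auto simp: C1_on_def differentiable_def)
next
  assume A: "open U \<and> C1_on U F"
  have hd: "(F has_derivative fderiv F x) (at x)" if "x \<in> U" for x
  proof -
    have "F differentiable (at x)" using A that by (simp add: C1_on_def)
    then have d: "(F has_derivative frechet_derivative F (at x)) (at x)"
      by (simp add: frechet_derivative_works)
    show ?thesis
      unfolding fderiv_def bounded_linear_Blinfun_apply[OF has_derivative_bounded_linear[OF d]]
      by (rule d)
  qed
  have cont: "\<exists>\<delta>>0. \<forall>y\<in>U. norm (y - x) < \<delta> \<longrightarrow>
      (\<forall>h. norm (fderiv F y h - fderiv F x h) \<le> \<epsilon> * norm h)" if xe: "x \<in> U" "\<epsilon> > 0" for x \<epsilon>
  proof -
    obtain d where d: "d > 0" "\<forall>y\<in>U. dist y x < d \<longrightarrow> dist (fderiv F y) (fderiv F x) < \<epsilon>"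
      using A xe unfolding C1_on_def continuous_on_iff by meson
    have "norm (fderiv F y h - fderiv F x h) \<le> \<epsilon> * norm h" if "y \<in> U" "norm (y - x) < d" for y h
    proof -
      have "norm (fderiv F y - fderiv F x) \<le> \<epsilon>"
        using d that by (auto simp: dist_norm intro: less_imp_le)
      then have "norm (fderiv F y - fderiv F x) * norm h \<le> \<epsilon> * norm h"
        by (rule mult_right_mono) simp
      then show ?thesis
        using norm_blinfun[of "fderiv F y - fderiv F x" h] by (simp add: blinfun.diff_left)
    qed
    then show ?thesis using d(1) by blast
  qed
  have bl: "bounded_linear_between UNIV norm UNIV norm (blinfun_apply (fderiv F x))" for x
    unfolding bounded_linear_between_def
    by (auto simp: blinfun.add_right blinfun.scaleR_right
        intro: norm_blinfun exI[of _ "norm (fderiv F x)"])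
  have der: "\<exists>\<delta>>0. \<forall>y\<in>U. norm (y - x) < \<delta> \<longrightarrow>
      norm (F y - F x - fderiv F x (y - x)) \<le> \<epsilon> * norm (y - x)" if "x \<in> U" "\<epsilon> > 0" for x \<epsilon>
    using hd[OF that(1)] that(2) unfolding has_derivative_at_alt by blast
  have "open_in_seminormed UNIV norm U"
    using A by (auto simp: open_in_seminormed_def open_dist dist_norm)
  then show "C1_map UNIV norm UNIV norm U F"
    unfolding C1_map_def using bl der cont
    by (auto intro!: exI[of _ "\<lambda>x. blinfun_apply (fderiv F x)"])
qed


section \<open>The weak tangent map\<close>

definition path_domain ::
    "('b::{real_inner, banach, second_countable_topology} \<Rightarrow>
      'a::{real_inner, banach, second_countable_topology}) \<Rightarrow> (real \<times> 'a) set \<Rightarrow>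
     (real \<Rightarrow> 'a) set" where
  "path_domain \<iota> O1 = {\<xi> \<in> W12_L2 \<iota>. \<forall>s. (s, \<xi> s) \<in> O1}"

definition superposition :: "(real \<times> 'a \<Rightarrow> 'a) \<Rightarrow> (real \<Rightarrow> 'a) \<Rightarrow> real \<Rightarrow> 'a" where
  "superposition \<phi> \<xi> = (\<lambda>s. \<phi> (s, \<xi> s))"

definition d_superposition ::
    "(real \<times> 'a::real_normed_vector \<Rightarrow> 'a) \<Rightarrow> (real \<Rightarrow> 'a) \<Rightarrow> (real \<Rightarrow> 'a) \<Rightarrow> real \<Rightarrow> 'a" where
  "d_superposition \<phi> \<xi> \<eta> = (\<lambda>s. frechet_derivative (\<lambda>x. \<phi> (s, x)) (at (\<xi> s)) (\<eta> s))"

definition weak_tangent_map ::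
    "(real \<times> 'a::real_normed_vector \<Rightarrow> 'a) \<Rightarrow> (real \<Rightarrow> 'a) \<times> (real \<Rightarrow> 'a) \<Rightarrow>
     (real \<Rightarrow> 'a) \<times> (real \<Rightarrow> 'a)" where
  "weak_tangent_map \<phi> = (\<lambda>(\<xi>, \<eta>). (superposition \<phi> \<xi>, d_superposition \<phi> \<xi> \<eta>))"

end

theory Submission
  imports Defs
begin

text \<open>
  A square integrable path with square integrable weak derivative is a primitive of that derivative,
  and the chain rule for primitives needs only uniform continuity of the outer derivative along the
  path. Hence \<open>\<Phi> \<xi>\<close> has weak derivative \<open>D\<phi>(s, \<xi> s)(1, \<xi>' s)\<close>, so that its first order remainder and
  that of \<open>d\<Phi>\<close> both come from \<open>(\<xi>, \<eta>) \<mapsto> D\<phi>(s, \<xi> s)(c, \<eta> s)\<close>, with \<open>c = 1\<close>, \<open>\<eta> = \<xi>'\<close> and with \<open>c = 0\<close>.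
  Since paths decay at infinity and \<open>\<phi>\<close> is eventually independent of \<open>s\<close>, the relevant part of the
  graph of \<open>\<xi>\<close> lies in a compact subset of \<open>O1\<close>, which makes the \<open>C\<^sup>2\<close> estimates in \<open>H\<^sub>1\<close> and the tame
  estimates in \<open>H\<^sub>2\<close> uniform in \<open>s\<close>. The latter are linear in the \<open>H\<^sub>2\<close>-norms, hence can be integrated
  although \<open>\<xi>\<close> is only bounded in \<open>H\<^sub>1\<close>.
\<close>

section \<open>Differential calculus in normed spaces\<close>

text \<open>Only two derivatives of \<phi> exist, so in H1 every little-o has to come from
  continuity of DD\<phi>. This suffices because the vectors to which D\<phi> is applied, \<xi>' and
  \<eta>, lie merely in L2, while the increment h of the path is small in the sup norm of H1:
  D\<phi>(\<xi> + h) - D\<phi>(\<xi>) - DD\<phi>(\<xi>) h is small in operator norm relative to h,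
  uniformly in s, and its product with an L2 vector is again in L2. In H2 no such modulus of
  continuity is uniform in s, since paths need not be bounded or continuous with values in H2. There
  the tame bound itself makes the remainder quadratic, with all factors but one measured in H1.
  Square integrability at infinity rests on two facts: \<phi>_s(0) = 0 for large |s| removes the
  constant from the growth bound, and D\<phi>(s, x)(1, 0) vanishes there. Finally, differentiating
  d\<Phi>|_\<xi> h along s and differentiating D\<phi>(s, \<xi>)(1, \<xi>') in direction h produce
  DD\<phi> with exchanged arguments, hence the symmetry of second derivatives.\<close>

lemma segment_bound:
  fixes f :: "'a::real_normed_vector \<Rightarrow> 'b::real_normed_vector"
  assumes d: "\<And>t. 0 \<le> t \<Longrightarrow> t \<le> 1 \<Longrightarrow> (f has_derivative f' t) (at (x + t *\<^sub>R v))"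
    and B: "\<And>t. 0 \<le> t \<Longrightarrow> t \<le> 1 \<Longrightarrow> norm (f' t v) \<le> B"
  shows "norm (f (x + v) - f x) \<le> B"
proof -
  have g: "((\<lambda>t. f (x + t *\<^sub>R v)) has_derivative (\<lambda>h. f' t (h *\<^sub>R v))) (at t within {0..1})"
    if "t \<in> {0..1}" for t
  proof -
    have "((\<lambda>t. x + t *\<^sub>R v) has_derivative (\<lambda>h. h *\<^sub>R v)) (at t within {0..1})"
      by (auto intro!: derivative_eq_intros)
    from has_derivative_compose[OF this d] that show ?thesis by auto
  qed
  have on: "onorm (\<lambda>h. f' t (h *\<^sub>R v)) \<le> B" if "t \<in> {0..1}" for t
  proof (rule onorm_le)
    fix h :: real
    have "linear (f' t)" using d[of t] that by (auto intro: has_derivative_linear)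
    then have "f' t (h *\<^sub>R v) = h *\<^sub>R f' t v" by (rule linear_scale)
    then show "norm (f' t (h *\<^sub>R v)) \<le> B * norm h"
      using B[of t] that by (simp add: mult.commute[of B] mult_left_mono)
  qed
  have "norm (f (x + 1 *\<^sub>R v) - f (x + 0 *\<^sub>R v)) \<le> B * norm (1 - 0 :: real)"
    by (rule differentiable_bound[where S="{0..1}", OF _ g on]) auto
  then show ?thesis by simp
qed

text \<open>The mean value bound for \<open>f - L\<close>; with \<open>L\<close> the derivative at
  the base point it estimates a first order remainder by the oscillation of the derivative along the
  segment.\<close>

lemma segment_bound_affine:
  fixes f :: "'a::real_normed_vector \<Rightarrow> 'b::real_normed_vector"
  assumes d: "\<And>t. 0 \<le> t \<Longrightarrow> t \<le> 1 \<Longrightarrow> (f has_derivative f' t) (at (x + t *\<^sub>R v))"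
    and L: "bounded_linear L"
    and B: "\<And>t. 0 \<le> t \<Longrightarrow> t \<le> 1 \<Longrightarrow> norm (f' t v - L v) \<le> B"
  shows "norm (f (x + v) - f x - L v) \<le> B"
proof -
  have "norm ((f (x + v) - L (x + v)) - (f x - L x)) \<le> B"
    by (rule segment_bound[where f="\<lambda>z. f z - L z" and f'="\<lambda>t h. f' t h - L h"])
       (auto intro!: derivative_eq_intros d B bounded_linear.has_derivative[OF L] B)
  then show ?thesis
    by (simp add: linear_add[OF bounded_linear.linear[OF L]] algebra_simps)
qed

text \<open>A Lebesgue number of a finite subcover gives the radius, the largest of finitely many
  constants gives \<open>C\<close>. The conclusion concerns a whole tube around \<open>K\<close>,
  which need not be compact in infinite dimensions.\<close>

lemma compact_uniform_nhd:
  assumes K: "compact K"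
    and loc: "\<And>p. p \<in> K \<Longrightarrow> \<exists>W C. open W \<and> p \<in> W \<and> (\<forall>q\<in>W. P C q)"
    and mono: "\<And>C C' q. P C q \<Longrightarrow> C \<le> C' \<Longrightarrow> P C' q"
  obtains \<delta> and C :: real where "\<delta> > 0" "\<And>k q. k \<in> K \<Longrightarrow> dist k q < \<delta> \<Longrightarrow> P C q"
proof -
  have "\<forall>p\<in>K. \<exists>W C. open W \<and> p \<in> W \<and> (\<forall>q\<in>W. P C q)" using loc by blast
  then obtain W C where W: "\<And>p. p \<in> K \<Longrightarrow> open (W p) \<and> p \<in> W p \<and> (\<forall>q\<in>W p. P (C p) q)"
    by metis
  have "K \<subseteq> (\<Union>p\<in>K. W p)" using W by auto
  then obtain F where F: "F \<subseteq> K" "finite F" "K \<subseteq> (\<Union>p\<in>F. W p)"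
    using compactE_image[OF K, of K W] W by blast
  \<comment> \<open>The inserted 0 keeps the maximum defined when \<open>F\<close> is empty.\<close>
  define M where "M = Max (insert 0 (C ` F))"
  have M: "P M q" if "p \<in> F" "q \<in> W p" for p q
  proof (rule mono)
    show "P (C p) q" using that W F by blast
    show "C p \<le> M" unfolding M_def using F that by (intro Max_ge) auto
  qed
  obtain e where e: "0 < e" "\<And>x. x \<in> K \<Longrightarrow> \<exists>G \<in> W ` F. ball x e \<subseteq> G"
    using Heine_Borel_lemma[OF K, of "W ` F"] F W by blast
  show ?thesis
  proof (rule that[of e M])
    fix k q assume "k \<in> K" "dist k q < e"
    then obtain p where "p \<in> F" "ball k e \<subseteq> W p" using e(2) by blast
    then show "P M q" using \<open>dist k q < e\<close> by (intro M[of p]) auto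
  qed (fact e(1))
qed

text \<open>Heine-Cantor on \<open>K\<close> does not reach the points \<open>q\<close> off
  \<open>K\<close>. Covering \<open>K\<close> by open sets on which \<open>G\<close> oscillates by
  less than \<epsilon> and taking a Lebesgue number controls them as well.\<close>

lemma compact_uniform_continuity:
  fixes G :: "'a::metric_space \<Rightarrow> 'b::metric_space"
  assumes K: "compact K" and S: "open S" "K \<subseteq> S" and G: "continuous_on S G" and e: "\<epsilon> > 0"
  obtains \<delta> where "\<delta> > 0" "\<And>k q. k \<in> K \<Longrightarrow> dist k q < \<delta> \<Longrightarrow> q \<in> S \<and> dist (G q) (G k) < \<epsilon>"
proof -
  define P where "P = (\<lambda>W. open W \<and> W \<subseteq> S \<and> (\<forall>p\<in>W. \<forall>q\<in>W. dist (G p) (G q) < \<epsilon>))"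
  have ex: "\<exists>W. P W \<and> p \<in> W" if p: "p \<in> K" for p
  proof -
    have pS: "p \<in> S" using p S by auto
    obtain d where d: "d > 0" "\<And>q. q \<in> S \<Longrightarrow> dist q p < d \<Longrightarrow> dist (G q) (G p) < \<epsilon>/2"
      using G pS e unfolding continuous_on_iff by (meson half_gt_zero)
    have "dist (G q) (G r) < \<epsilon>" if "q \<in> S \<inter> ball p d" "r \<in> S \<inter> ball p d" for q r
      using d(2)[of q] d(2)[of r] that dist_triangle_half_l[of "G q" "G p" \<epsilon> "G r"]
      by (auto simp: dist_commute)
    then have "P (S \<inter> ball p d)" unfolding P_def using S by auto
    then show ?thesis using pS d by (intro exI[of _ "S \<inter> ball p d"]) auto
  qed
  obtain e' where e': "0 < e'" "\<And>x. x \<in> K \<Longrightarrow> \<exists>W \<in> Collect P. ball x e' \<subseteq> W"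
    by (rule Heine_Borel_lemma[OF K, of "Collect P"]) (use ex in \<open>auto simp: P_def\<close>)
  show ?thesis
  proof (rule that[OF e'(1)])
    fix k q assume "k \<in> K" "dist k q < e'"
    then obtain W where "P W" "ball k e' \<subseteq> W" using e'(2) by blast
    moreover have "k \<in> ball k e'" "q \<in> ball k e'" using e'(1) \<open>dist k q < e'\<close> by auto
    ultimately show "q \<in> S \<and> dist (G q) (G k) < \<epsilon>" unfolding P_def by blast
  qed
qed

section \<open>Frechet derivatives as bounded operators; symmetry of the second derivative\<close>

lemma has_derivative_fderiv:
  assumes "f differentiable (at x)"
  shows "(f has_derivative blinfun_apply (fderiv f x)) (at x)"
proof -
  have d: "(f has_derivative frechet_derivative f (at x)) (at x)"
    using assms by (simp add: frechet_derivative_works)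
  show ?thesis
    unfolding fderiv_def bounded_linear_Blinfun_apply[OF has_derivative_bounded_linear[OF d]]
    by (rule d)
qed

lemma fderiv_eqI:
  assumes "(f has_derivative D) (at x)"
  shows "blinfun_apply (fderiv f x) = D"
  unfolding fderiv_def frechet_derivative_at[OF assms, symmetric]
  by (rule bounded_linear_Blinfun_apply[OF has_derivative_bounded_linear[OF assms]])

lemma C2_onD:
  assumes "C2_on S f"
  shows "x \<in> S \<Longrightarrow> (f has_derivative blinfun_apply (fderiv f x)) (at x)"
    and "x \<in> S \<Longrightarrow> (fderiv f has_derivative blinfun_apply (fderiv (fderiv f) x)) (at x)"
    and "continuous_on S f" "continuous_on S (fderiv f)" "continuous_on S (fderiv (fderiv f))"
proof -
  have a: "\<forall>x\<in>S. f differentiable (at x)" and b: "\<forall>x\<in>S. fderiv f differentiable (at x)"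
    and c: "continuous_on S (fderiv (fderiv f))"
    using assms by (auto simp: C2_on_def C1_on_def)
  show "x \<in> S \<Longrightarrow> (f has_derivative blinfun_apply (fderiv f x)) (at x)"
   and "x \<in> S \<Longrightarrow> (fderiv f has_derivative blinfun_apply (fderiv (fderiv f) x)) (at x)"
    using a b by (auto intro: has_derivative_fderiv)
  show "continuous_on S f" "continuous_on S (fderiv f)"
    using a b by (auto intro!: continuous_at_imp_continuous_on differentiable_imp_continuous_within)
  show "continuous_on S (fderiv (fderiv f))" by fact
qed

lemma norm_blinfun2: "norm (blinfun_apply (blinfun_apply A u) v) \<le> norm A * norm u * norm v"
  by (meson mult_right_mono norm_blinfun norm_ge_zero order_trans)

text \<open>Both mixed second derivatives are the limit of the same second difference quotient.\<close>

lemma second_difference_bound: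
  fixes f :: "'a::real_normed_vector \<Rightarrow> 'b::real_normed_vector"
  assumes f: "\<And>z. z \<in> ball x \<delta> \<Longrightarrow> (f has_derivative blinfun_apply (f' z)) (at z)"
    and f': "\<And>z. z \<in> ball x \<delta> \<Longrightarrow> (f' has_derivative blinfun_apply (f'' z)) (at z)"
    and e: "\<And>z. z \<in> ball x \<delta> \<Longrightarrow> norm (f'' z - A) \<le> \<epsilon>"
    and uv: "norm u + norm v < \<delta>"
  shows "norm (f (x + u + v) - f (x + u) - f (x + v) + f x - A v u) \<le> \<epsilon> * norm u * norm v"
proof -
  have ball: "x + s *\<^sub>R u + t *\<^sub>R v \<in> ball x \<delta>" if "0 \<le> s" "s \<le> 1" "0 \<le> t" "t \<le> 1" for s t :: real
  proof -
    have "norm (s *\<^sub>R u + t *\<^sub>R v) \<le> norm (s *\<^sub>R u) + norm (t *\<^sub>R v)" by (rule norm_triangle_ineq)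
    also have "\<dots> \<le> norm u + norm v"
      using that by (auto intro!: add_mono simp: mult_left_le_one_le)
    finally have "norm (s *\<^sub>R u + t *\<^sub>R v) < \<delta>" using uv by simp
    moreover have "dist x (x + s *\<^sub>R u + t *\<^sub>R v) = norm (s *\<^sub>R u + t *\<^sub>R v)"
      by (metis add.assoc add_diff_cancel_left' dist_commute dist_norm)
    ultimately show ?thesis by simp
  qed
  have inner: "norm (f' (x + s *\<^sub>R u + v) - f' (x + s *\<^sub>R u) - A v) \<le> \<epsilon> * norm v"
    if s: "0 \<le> s" "s \<le> 1" for s
  proof (rule segment_bound_affine)
    fix t :: real assume t: "0 \<le> t" "t \<le> 1"
    show "(f' has_derivative blinfun_apply (f'' (x + s *\<^sub>R u + t *\<^sub>R v))) (at (x + s *\<^sub>R u + t *\<^sub>R v))"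
      by (rule f'[OF ball[OF s t]])
    have "norm (blinfun_apply (f'' (x + s *\<^sub>R u + t *\<^sub>R v) - A) v)
      \<le> norm (f'' (x + s *\<^sub>R u + t *\<^sub>R v) - A) * norm v" by (rule norm_blinfun)
    also have "\<dots> \<le> \<epsilon> * norm v" by (intro mult_right_mono e ball s t) simp
    finally show "norm (blinfun_apply (f'' (x + s *\<^sub>R u + t *\<^sub>R v)) v - A v) \<le> \<epsilon> * norm v"
      by (simp add: blinfun.diff_left)
  qed (rule blinfun.bounded_linear_right)
  \<comment> \<open>The second difference is the increment of \<open>g\<close> in direction
    \<open>u\<close>, and the derivative of \<open>g\<close> is the increment of \<open>f'\<close>
    in direction \<open>v\<close> that was estimated above.\<close>
  define g where "g = (\<lambda>z. f (z + v) - f z)"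
  have "norm (g (x + u) - g x - A v u) \<le> \<epsilon> * norm u * norm v"
  proof (rule segment_bound_affine)
    fix s :: real assume s: "0 \<le> s" "s \<le> 1"
    have b1: "x + s *\<^sub>R u + v \<in> ball x \<delta>" and b0: "x + s *\<^sub>R u \<in> ball x \<delta>"
      using ball[OF s, of 1] ball[OF s, of 0] by auto
    have "((\<lambda>z. f (z + v)) has_derivative blinfun_apply (f' (x + s *\<^sub>R u + v))) (at (x + s *\<^sub>R u))"
      by (rule has_derivative_compose[where f="\<lambda>z. z + v" and f'="\<lambda>h. h", OF _ f[OF b1]])
         (auto intro!: derivative_eq_intros)
    then show "(g has_derivative blinfun_apply (f' (x + s *\<^sub>R u + v) - f' (x + s *\<^sub>R u)))
        (at (x + s *\<^sub>R u))"
      unfolding g_def using f[OF b0] by (auto intro!: derivative_eq_intros simp: blinfun.diff_left)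
    have "norm (blinfun_apply (f' (x + s *\<^sub>R u + v) - f' (x + s *\<^sub>R u) - A v) u)
       \<le> norm (f' (x + s *\<^sub>R u + v) - f' (x + s *\<^sub>R u) - A v) * norm u" by (rule norm_blinfun)
    also have "\<dots> \<le> \<epsilon> * norm v * norm u" by (intro mult_right_mono inner s) simp
    finally show "norm (blinfun_apply (f' (x + s *\<^sub>R u + v) - f' (x + s *\<^sub>R u)) u - A v u)
      \<le> \<epsilon> * norm u * norm v"
      by (simp add: blinfun.diff_left mult_ac)
  qed (rule blinfun.bounded_linear_right)
  then show ?thesis by (simp add: g_def algebra_simps)
qed

text \<open>The second difference is symmetric in \<open>u\<close> and \<open>v\<close>, whereas the
  values of the second derivative approximating it have their arguments exchanged. Scaling both
  vectors by a small \<open>t\<close> brings them into the ball, and the factor \<open>t * t\<close>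
  cancels by bilinearity.\<close>

lemma second_derivative_symmetric:
  fixes f :: "'a::real_normed_vector \<Rightarrow> 'b::real_normed_vector"
  assumes S: "open S" "x \<in> S" and C2: "C2_on S f"
  shows "fderiv (fderiv f) x u v = fderiv (fderiv f) x v u"
proof -
  note D = C2_onD[OF C2]
  let ?A = "fderiv (fderiv f) x"
  have "norm (?A u v - ?A v u) \<le> e" if e: "e > 0" for e
  proof -
    \<comment> \<open>Chosen so that \<open>2 * \<epsilon> * norm u * norm v\<close> does not exceed
      \<open>e\<close>; the added 1 covers vanishing \<open>u\<close> or \<open>v\<close>.\<close>
    define \<epsilon> where "\<epsilon> = e / (2 * (norm u * norm v + 1))"
    have \<epsilon>: "\<epsilon> > 0" using e by (auto simp: \<epsilon>_def add_nonneg_pos)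
    obtain d1 where d1: "d1 > 0" "\<And>z. z \<in> S \<Longrightarrow> dist z x < d1 \<Longrightarrow> dist (fderiv (fderiv f) z) ?A < \<epsilon>"
      using D(5) S(2) \<epsilon> unfolding continuous_on_iff by meson
    obtain d2 where d2: "d2 > 0" "ball x d2 \<subseteq> S" using S openE by blast
    define \<delta> where "\<delta> = min d1 d2"
    have \<delta>: "\<delta> > 0" "ball x \<delta> \<subseteq> S" using d1 d2 by (auto simp: \<delta>_def)
    have near: "norm (fderiv (fderiv f) z - ?A) \<le> \<epsilon>" if "z \<in> ball x \<delta>" for z
      using d1(2)[of z] d2 that by (auto simp: \<delta>_def dist_norm norm_minus_commute less_imp_le subset_eq)
    define t where "t = \<delta> / (2 * (norm u + norm v + 1))"
    have t: "t > 0" using \<delta> by (auto simp: t_def add_nonneg_pos)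
    have tuv: "norm (t *\<^sub>R u) + norm (t *\<^sub>R v) < \<delta>"
    proof -
      have "norm (t *\<^sub>R u) + norm (t *\<^sub>R v) = t * (norm u + norm v)"
        using t by (simp add: algebra_simps)
      also have "\<dots> < t * (2 * (norm u + norm v + 1))"
        using t by (intro mult_strict_left_mono) (simp_all add: add_nonneg_pos)
      also have "\<dots> = \<delta>" unfolding t_def
        using norm_ge_zero[of u] norm_ge_zero[of v] by (simp add: field_simps add_nonneg_eq_0_iff)
      finally show ?thesis .
    qed
    let ?\<Delta> = "f (x + t *\<^sub>R u + t *\<^sub>R v) - f (x + t *\<^sub>R u) - f (x + t *\<^sub>R v) + f x"
    have 1: "norm (?\<Delta> - ?A (t *\<^sub>R v) (t *\<^sub>R u)) \<le> \<epsilon> * norm (t *\<^sub>R u) * norm (t *\<^sub>R v)"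
      using \<delta> D near tuv by (intro second_difference_bound[where \<delta>=\<delta> and f'="fderiv f" and f''="fderiv (fderiv f)"]) auto
    have "norm (f (x + t *\<^sub>R v + t *\<^sub>R u) - f (x + t *\<^sub>R v) - f (x + t *\<^sub>R u) + f x - ?A (t *\<^sub>R u) (t *\<^sub>R v))
      \<le> \<epsilon> * norm (t *\<^sub>R v) * norm (t *\<^sub>R u)"
      using \<delta> D near tuv by (intro second_difference_bound[where \<delta>=\<delta> and f'="fderiv f" and f''="fderiv (fderiv f)"]) auto
    then have 2: "norm (?\<Delta> - ?A (t *\<^sub>R u) (t *\<^sub>R v)) \<le> \<epsilon> * norm (t *\<^sub>R v) * norm (t *\<^sub>R u)"
      by (simp add: add.commute add.left_commute algebra_simps)
    have "norm ((?\<Delta> - ?A (t *\<^sub>R v) (t *\<^sub>R u)) - (?\<Delta> - ?A (t *\<^sub>R u) (t *\<^sub>R v)))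
       \<le> \<epsilon> * norm (t *\<^sub>R u) * norm (t *\<^sub>R v) + \<epsilon> * norm (t *\<^sub>R v) * norm (t *\<^sub>R u)"
      by (rule order_trans[OF norm_triangle_ineq4]) (intro add_mono 1 2)
    then have "norm ((t * t) *\<^sub>R (?A u v - ?A v u)) \<le> (t * t) * (2 * \<epsilon> * norm u * norm v)"
      using t by (simp add: blinfun.scaleR_right blinfun.scaleR_left algebra_simps)
    then have "norm (?A u v - ?A v u) \<le> 2 * \<epsilon> * norm u * norm v"
      using t by simp
    also have "\<dots> = e * (norm u * norm v) / (norm u * norm v + 1)"
    proof -
      have "2 * \<epsilon> = e / (norm u * norm v + 1)" unfolding \<epsilon>_def
        by (simp only: mult_divide_mult_cancel_left times_divide_eq_right)
      then show ?thesis by (simp add: mult.assoc)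
    qed
    also have "\<dots> \<le> e" using e by (simp add: divide_le_eq add_nonneg_pos)
    finally show ?thesis .
  qed
  then have "norm (?A u v - ?A v u) \<le> 0" by (rule field_le_epsilon) simp
  then show ?thesis by simp
qed

section \<open>Measurability\<close>

text \<open>The preimages under \<open>f\<close> and \<open>g\<close> differ within a null set, and
  Lebesgue measure is complete.\<close>

lemma borel_measurable_lebesgue_AE:
  fixes f g :: "real \<Rightarrow> 'a::topological_space"
  assumes f: "f \<in> borel_measurable lebesgue" and ae: "AE x in lebesgue. f x = g x"
  shows "g \<in> borel_measurable lebesgue"
proof (rule measurableI)
  fix A :: "'a set" assume A: "A \<in> sets borel"
  have m: "f -` A \<inter> space lebesgue \<in> sets lebesgue" by (rule measurable_sets[OF f A])
  have e: "AE x in lebesgue. x \<in> f -` A \<inter> space lebesgue \<longleftrightarrow> x \<in> g -` A \<inter> space lebesgue"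
    using ae by eventually_elim auto
  show "g -` A \<inter> space lebesgue \<in> sets lebesgue"
    by (rule complete_measure.in_sets_AE[OF completion.complete_measure_axioms e m]) simp
qed simp

lemma borel_measurable_lebesgue_continuous:
  fixes f :: "real \<Rightarrow> 'a::topological_space"
  shows "continuous_on UNIV f \<Longrightarrow> f \<in> borel_measurable lebesgue"
  by (intro measurable_completion) (auto intro: borel_measurable_continuous_onI)

text \<open>Operator spaces are in general not separable, so measurability of \<open>A\<close> as an
  operator valued function is avoided: joint evaluation on pairs \<open>(s, v)\<close> is continuous
  on a second countable product.\<close>

lemma borel_measurable_blinfun_apply:
  fixes A :: "real \<Rightarrow> 'p::{real_normed_vector, second_countable_topology} \<Rightarrow>\<^sub>L 'q::real_normed_vector"
  assumes A: "continuous_on UNIV A" and v: "v \<in> borel_measurable lebesgue"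
  shows "(\<lambda>s. A s (v s)) \<in> borel_measurable lebesgue"
proof -
  have "continuous_on UNIV (\<lambda>z. blinfun_apply (A (fst z)) (snd z))"
    by (intro continuous_intros continuous_on_compose2[OF A]) auto
  then have m: "(\<lambda>z. A (fst z) (snd z)) \<in> borel_measurable borel"
    by (rule borel_measurable_continuous_onI)
  have "(\<lambda>s. (s, v s)) \<in> borel_measurable lebesgue"
    by (intro borel_measurable_Pair v borel_measurable_lebesgue_continuous continuous_on_id)
  from measurable_compose[OF this m] show ?thesis by simp
qed

section \<open>Square integrable functions\<close>

lemma L2_D:
  assumes "f \<in> L2"
  shows "f \<in> borel_measurable lebesgue" "integrable lebesgue (\<lambda>s. (norm (f s))\<^sup>2)"
  using assms by (auto simp: L2_def)

lemma L2_seminorm_nonneg [simp]: "0 \<le> L2_seminorm f"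
  by (simp add: L2_seminorm_def)

lemma L2_seminorm_sq: "(L2_seminorm f)\<^sup>2 = (\<integral>s. (norm (f s))\<^sup>2 \<partial>lebesgue)"
  by (simp add: L2_seminorm_def)

lemma L2_dominated:
  assumes f: "f \<in> borel_measurable lebesgue" and u: "u \<in> L2"
    and le: "AE s in lebesgue. norm (f s) \<le> norm (u s)"
  shows "f \<in> L2" "L2_seminorm f \<le> L2_seminorm u"
proof -
  note [measurable] = f
  have le2: "AE s in lebesgue. (norm (f s))\<^sup>2 \<le> (norm (u s))\<^sup>2"
    using le by eventually_elim (simp add: power_mono)
  have "integrable lebesgue (\<lambda>s. (norm (f s))\<^sup>2)"
    by (rule Bochner_Integration.integrable_bound[OF L2_D(2)[OF u]])
       (use le2 in \<open>auto elim: eventually_mono\<close>)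
  then show "f \<in> L2" using f by (simp add: L2_def)
  show "L2_seminorm f \<le> L2_seminorm u"
    unfolding L2_seminorm_def
    by (intro real_sqrt_le_mono integral_mono_AE L2_D(2) u le2 \<open>f \<in> L2\<close>)
qed

lemma L2_AE_cong:
  assumes f: "f \<in> L2" and ae: "AE s in lebesgue. f s = g s"
  shows "g \<in> L2" "L2_seminorm g = L2_seminorm f"
proof -
  have g: "g \<in> borel_measurable lebesgue"
    by (rule borel_measurable_lebesgue_AE[OF L2_D(1)[OF f] ae])
  have 1: "g \<in> L2 \<and> L2_seminorm g \<le> L2_seminorm f"
    using L2_dominated[OF g f eventually_mono[OF ae]] by auto
  moreover have "L2_seminorm f \<le> L2_seminorm g"
    using 1 by (intro L2_dominated(2)[OF L2_D(1)[OF f] _ eventually_mono[OF ae]]) auto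
  ultimately show "g \<in> L2" "L2_seminorm g = L2_seminorm f" by auto
qed

lemma L2_norm:
  assumes "f \<in> L2"
  shows "(\<lambda>s. norm (f s)) \<in> L2" "L2_seminorm (\<lambda>s. norm (f s)) = L2_seminorm f"
  using assms by (auto simp: L2_def L2_seminorm_def)

lemma L2_scaleR:
  assumes "f \<in> L2"
  shows "(\<lambda>s. c *\<^sub>R f s) \<in> L2" "L2_seminorm (\<lambda>s. c *\<^sub>R f s) = \<bar>c\<bar> * L2_seminorm f"
  using assms by (auto simp: L2_def L2_seminorm_def power_mult_distrib real_sqrt_mult)

lemma L2_mult:
  fixes f :: "real \<Rightarrow> real"
  assumes "f \<in> L2"
  shows "(\<lambda>s. c * f s) \<in> L2" "L2_seminorm (\<lambda>s. c * f s) = \<bar>c\<bar> * L2_seminorm f"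
  using L2_scaleR[OF assms, of c] by auto

text \<open>Young's inequality with a free weight. For positive \<open>a\<close> and
  \<open>b\<close> the minimum of the right side over \<open>t\<close> is the square of
  \<open>a + b\<close>, attained at \<open>t = b/a\<close>; this is how Minkowski's inequality is
  obtained from it.\<close>

lemma square_sum_weighted:
  fixes a b t :: real
  assumes "t > 0"
  shows "(a + b)\<^sup>2 \<le> (1 + t) * a\<^sup>2 + (1 + 1/t) * b\<^sup>2"
proof -
  have "0 \<le> (t * a - b)\<^sup>2 / t" using assms by simp
  also have "\<dots> = t * a\<^sup>2 + b\<^sup>2 / t - 2 * a * b"
    using assms by (simp add: field_simps power2_eq_square)
  finally show ?thesis by (simp add: power2_eq_square algebra_simps)
qed

lemma L2_add:
  assumes f: "f \<in> L2" and g: "g \<in> L2"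
  shows "(\<lambda>s. f s + g s) \<in> L2" "L2_seminorm (\<lambda>s. f s + g s) \<le> L2_seminorm f + L2_seminorm g"
proof -
  note [measurable] = L2_D(1)[OF f] L2_D(1)[OF g]
  have wt: "(norm (f s + g s))\<^sup>2 \<le> (1 + t) * (norm (f s))\<^sup>2 + (1 + 1/t) * (norm (g s))\<^sup>2"
    if "t > 0" for t s
    by (rule order_trans[OF power_mono[OF norm_triangle_ineq norm_ge_zero] square_sum_weighted[OF that]])
  have int: "integrable lebesgue (\<lambda>s. (1 + t) * (norm (f s))\<^sup>2 + (1 + 1/t) * (norm (g s))\<^sup>2)" for t
    using L2_D(2)[OF f] L2_D(2)[OF g] by simp
  have "integrable lebesgue (\<lambda>s. (norm (f s + g s))\<^sup>2)"
    by (rule Bochner_Integration.integrable_bound[OF int[of 1]]) (use wt[of 1] in \<open>auto\<close>)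
  then show mem: "(\<lambda>s. f s + g s) \<in> L2" by (simp add: L2_def)
  let ?a = "L2_seminorm f" and ?b = "L2_seminorm g" and ?c = "L2_seminorm (\<lambda>s. f s + g s)"
  have t: "?c\<^sup>2 \<le> (1 + t) * ?a\<^sup>2 + (1 + 1/t) * ?b\<^sup>2" if "t > 0" for t
  proof -
    have "(\<integral>s. (norm (f s + g s))\<^sup>2 \<partial>lebesgue)
      \<le> (\<integral>s. (1 + t) * (norm (f s))\<^sup>2 + (1 + 1/t) * (norm (g s))\<^sup>2 \<partial>lebesgue)"
      by (intro integral_mono L2_D(2)[OF mem] int wt that)
    then show ?thesis using L2_D(2)[OF f] L2_D(2)[OF g] by (simp add: L2_seminorm_sq)
  qed
  have "?c \<le> ?a + ?b + e" if e: "e > 0" for e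
  proof -
    \<comment> \<open>The seminorms may vanish; the shift by \<open>e/2\<close> keeps the optimal
      weight \<open>b/a\<close> defined and positive.\<close>
    define a b where "a = ?a + e/2" and "b = ?b + e/2"
    have ab: "a > 0" "b > 0" "?a \<le> a" "?b \<le> b" "0 \<le> ?a" "0 \<le> ?b"
      using e L2_seminorm_nonneg[of f] L2_seminorm_nonneg[of g] by (auto simp: a_def b_def simp del: L2_seminorm_nonneg)
    have "?c\<^sup>2 \<le> (1 + b/a) * ?a\<^sup>2 + (1 + 1/(b/a)) * ?b\<^sup>2" using ab by (intro t) simp
    also have "\<dots> \<le> (1 + b/a) * a\<^sup>2 + (1 + 1/(b/a)) * b\<^sup>2"
      using ab by (intro add_mono mult_left_mono power_mono) auto
    also have "\<dots> = (a + b)\<^sup>2" using ab by (simp add: field_simps power2_eq_square)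
    finally have "?c \<le> a + b" using ab by (simp add: power2_le_iff_abs_le)
    then show ?thesis by (simp add: a_def b_def)
  qed
  then show "?c \<le> ?a + ?b" by (rule field_le_epsilon)
qed

lemma L2_diff:
  assumes f: "f \<in> L2" and g: "g \<in> L2"
  shows "(\<lambda>s. f s - g s) \<in> L2" "L2_seminorm (\<lambda>s. f s - g s) \<le> L2_seminorm f + L2_seminorm g"
  using L2_add[OF f L2_scaleR(1)[OF g, of "-1"]] L2_scaleR(2)[OF g, of "-1"] by auto

lemma L2_locally_integrable:
  assumes "f \<in> L2"
  shows "set_integrable lebesgue {a..b} f"
  unfolding set_integrable_def
proof (rule Bochner_Integration.integrable_bound)
  have "integrable lebesgue (\<lambda>s. indicator {a..b} s :: real)"
    by (rule integrable_real_indicator) (auto simp: emeasure_lborel_Icc_eq)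
  then show "integrable lebesgue (\<lambda>s. indicator {a..b} s + (norm (f s))\<^sup>2)"
    using L2_D(2)[OF assms] by simp
  show "(\<lambda>s. indicat_real {a..b} s *\<^sub>R f s) \<in> borel_measurable lebesgue"
    by (intro borel_measurable_scaleR borel_measurable_indicator L2_D(1) assms) auto
  have "x \<le> 1 + x\<^sup>2" for x :: real
    using zero_le_power2[of "x - 1/2"] by (simp add: power2_eq_square algebra_simps)
  then show "AE s in lebesgue. norm (indicat_real {a..b} s *\<^sub>R f s)
      \<le> norm (indicat_real {a..b} s + (norm (f s))\<^sup>2)"
    by (auto simp: indicator_def)
qed

section \<open>Functions with a locally integrable derivative\<close>

lemma set_integrable_continuous:
  fixes f :: "real \<Rightarrow> 'a::{banach, second_countable_topology}"
  assumes "continuous_on {a..b} f"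
  shows "set_integrable lebesgue {a..b} f"
  unfolding set_integrable_def
  using borel_integrable_compact[OF compact_Icc assms]
  by (subst integrable_completion) (auto intro: borel_measurable_integrable)

lemma set_integrable_sub_Icc:
  fixes f :: "real \<Rightarrow> 'a::{banach, second_countable_topology}"
  shows "set_integrable lebesgue {a..b} f \<Longrightarrow> a \<le> c \<Longrightarrow> d \<le> b \<Longrightarrow> set_integrable lebesgue {c..d} f"
  by (erule set_integrable_subset) auto

lemma set_integral_split:
  fixes f :: "real \<Rightarrow> 'a::{banach, second_countable_topology}"
  assumes "set_integrable lebesgue {a..c} f" "a \<le> b" "b \<le> c"
  shows "(LINT s:{a..c}|lebesgue. f s) = (LINT s:{a..b}|lebesgue. f s) + (LINT s:{b..c}|lebesgue. f s)"
proof -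
  have "AE s in lebesgue. s \<noteq> b"
    by (intro AE_completion) (rule AE_lborel_singleton)
  then have "AE s in lebesgue. \<not> (s \<in> {a..b} \<and> s \<in> {b..c})" by eventually_elim auto
  moreover have "{a..c} = {a..b} \<union> {b..c}" using assms by auto
  ultimately show ?thesis
    using assms by (auto intro!: set_integral_Un_AE set_integrable_sub_Icc[OF assms(1)])
qed

lemma norm_set_integral_le:
  fixes f :: "real \<Rightarrow> 'a::{banach, second_countable_topology}"
  shows "norm (LINT s:A|lebesgue. f s) \<le> (LINT s:A|lebesgue. norm (f s))"
  using integral_norm_bound[of lebesgue "\<lambda>s. indicator A s *\<^sub>R f s"]
  by (simp add: set_lebesgue_integral_def)

lemma set_integrable_norm:
  fixes f :: "real \<Rightarrow> 'a::{banach, second_countable_topology}"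
  shows "set_integrable lebesgue A f \<Longrightarrow> set_integrable lebesgue A (\<lambda>s. norm (f s))"
  unfolding set_integrable_def by (drule integrable_norm) simp

lemma set_integral_bounded_linear:
  fixes f :: "real \<Rightarrow> 'a::{banach, second_countable_topology}"
    and T :: "'a \<Rightarrow> 'b::{banach, second_countable_topology}"
  assumes T: "bounded_linear T" and f: "set_integrable lebesgue A f"
  shows "set_integrable lebesgue A (\<lambda>s. T (f s))"
    "(LINT s:A|lebesgue. T (f s)) = T (LINT s:A|lebesgue. f s)"
proof -
  interpret bounded_linear T by (rule T)
  have "integrable lebesgue (\<lambda>s. T (indicator A s *\<^sub>R f s))"
    by (intro integrable_bounded_linear[OF T] f[unfolded set_integrable_def])
  then show "set_integrable lebesgue A (\<lambda>s. T (f s))" unfolding set_integrable_def by (simp add: scaleR)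
  show "(LINT s:A|lebesgue. T (f s)) = T (LINT s:A|lebesgue. f s)"
    unfolding set_lebesgue_integral_def
    using integral_bounded_linear[OF T f[unfolded set_integrable_def]] by (simp add: scaleR)
qed

text \<open>Local absolute continuity in integral form, which avoids pointwise differentiability of
  vector valued functions. Integrability is demanded explicitly because the integral of a
  nonintegrable function is 0 by convention.\<close>

definition primitive_of ::
    "(real \<Rightarrow> 'a::{banach, second_countable_topology}) \<Rightarrow> (real \<Rightarrow> 'a) \<Rightarrow> bool" where
  "primitive_of f g \<longleftrightarrow> continuous_on UNIV f \<and>
     (\<forall>a b. a \<le> b \<longrightarrow> set_integrable lebesgue {a..b} g \<and>
        f b - f a = (LINT s:{a..b}|lebesgue. g s))"

lemma primitive_ofD:
  assumes "primitive_of f g"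
  shows "continuous_on UNIV f" "set_integrable lebesgue {a..b} g"
    "a \<le> b \<Longrightarrow> f b - f a = (LINT s:{a..b}|lebesgue. g s)"
  using assms by (cases "a \<le> b"; auto simp: primitive_of_def)+

lemma primitive_of_add:
  assumes "primitive_of f g" "primitive_of f' g'"
  shows "primitive_of (\<lambda>s. f s + f' s) (\<lambda>s. g s + g' s)"
  unfolding primitive_of_def
proof (intro conjI allI impI)
  note p = assms[THEN primitive_ofD(1)] and i = assms[THEN primitive_ofD(2)]
    and e = assms[THEN primitive_ofD(3)]
  show "continuous_on UNIV (\<lambda>s. f s + f' s)" by (intro continuous_intros p)
  fix a b :: real assume ab: "a \<le> b"
  show "set_integrable lebesgue {a..b} (\<lambda>s. g s + g' s)" by (rule set_integral_add(1)[OF i])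
  show "f b + f' b - (f a + f' a) = (LINT s:{a..b}|lebesgue. g s + g' s)"
    unfolding set_integral_add(2)[OF i] e[OF ab, symmetric] by simp
qed

lemma primitive_of_diff:
  assumes "primitive_of f g" "primitive_of f' g'"
  shows "primitive_of (\<lambda>s. f s - f' s) (\<lambda>s. g s - g' s)"
  unfolding primitive_of_def
proof (intro conjI allI impI)
  note p = assms[THEN primitive_ofD(1)] and i = assms[THEN primitive_ofD(2)]
    and e = assms[THEN primitive_ofD(3)]
  show "continuous_on UNIV (\<lambda>s. f s - f' s)" by (intro continuous_intros p)
  fix a b :: real assume ab: "a \<le> b"
  show "set_integrable lebesgue {a..b} (\<lambda>s. g s - g' s)" by (rule set_integral_diff(1)[OF i])
  show "f b - f' b - (f a - f' a) = (LINT s:{a..b}|lebesgue. g s - g' s)"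
    unfolding set_integral_diff(2)[OF i] e[OF ab, symmetric] by simp
qed

lemma primitive_of_Pair:
  assumes "primitive_of f g" "primitive_of f' g'"
  shows "primitive_of (\<lambda>s. (f s, f' s)) (\<lambda>s. (g s, g' s))"
  unfolding primitive_of_def
proof (intro conjI allI impI)
  show "continuous_on UNIV (\<lambda>s. (f s, f' s))"
    using assms[THEN primitive_ofD(1)] by (auto intro: continuous_intros)
  fix a b :: real assume ab: "a \<le> b"
  have b1: "bounded_linear (\<lambda>x. (x, 0))" and b2: "bounded_linear (\<lambda>x. (0, x))"
    by (auto intro!: bounded_linear_Pair bounded_linear_ident bounded_linear_zero)
  note i1 = set_integral_bounded_linear[OF b1 primitive_ofD(2)[OF assms(1), of a b]]
  note i2 = set_integral_bounded_linear[OF b2 primitive_ofD(2)[OF assms(2), of a b]]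
  have e: "(g s, g' s) = (g s, 0) + (0, g' s)" for s by simp
  show "set_integrable lebesgue {a..b} (\<lambda>s. (g s, g' s))"
    unfolding e by (rule set_integral_add(1)[OF i1(1) i2(1)])
  show "(f b, f' b) - (f a, f' a) = (LINT s:{a..b}|lebesgue. (g s, g' s))"
    unfolding e set_integral_add(2)[OF i1(1) i2(1)] i1(2) i2(2)
    using primitive_ofD(3)[OF assms(1) ab] primitive_ofD(3)[OF assms(2) ab] by simp
qed

lemma primitive_of_ident: "primitive_of (\<lambda>s. s) (\<lambda>s. 1)"
  unfolding primitive_of_def
  by (auto intro!: set_integrable_continuous continuous_intros
      simp: set_lebesgue_integral_def)

text \<open>The interval is cut into pieces of length at most \<open>\<mu>/2\<close>, strictly below
  the admissible \<mu>, and the local bounds telescope because \<open>m\<close> enters only through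
  its increments.\<close>

lemma locally_bounded_increment:
  fixes e :: "real \<Rightarrow> 'a::real_normed_vector" and m :: "real \<Rightarrow> real"
  assumes loc: "\<And>u v. a \<le> u \<Longrightarrow> u \<le> v \<Longrightarrow> v \<le> b \<Longrightarrow> v - u < \<mu> \<Longrightarrow> norm (e v - e u) \<le> m v - m u"
    and \<mu>: "\<mu> > 0" and ab: "a \<le> b"
  shows "norm (e b - e a) \<le> m b - m a"
proof -
  have *: "norm (e c - e a) \<le> m c - m a" if "a \<le> c" "c \<le> b" "c - a \<le> real n * (\<mu>/2)" for n c
    using that
  proof (induction n arbitrary: c)
    case 0
    then have "c = a" by simp
    then show ?case by simp
  next
    case (Suc n)
    define d where "d = max a (c - \<mu>/2)"
    have d: "a \<le> d" "d \<le> c" "c - d < \<mu>" "d - a \<le> real n * (\<mu>/2)"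
      using Suc.prems \<mu> by (auto simp: d_def max_def field_simps)
    have "norm (e d - e a) \<le> m d - m a" using d Suc by auto
    moreover have "norm (e c - e d) \<le> m c - m d" using d Suc.prems by (intro loc) auto
    moreover have "norm (e c - e a) \<le> norm (e c - e d) + norm (e d - e a)"
      by (metis norm_triangle_ineq diff_add_cancel add_diff_eq)
    ultimately show ?case by simp
  qed
  obtain n where "(b - a) / (\<mu>/2) \<le> real n" using real_arch_simple by blast
  then show ?thesis using \<mu> ab by (intro *[of b n]) (auto simp: field_simps)
qed

text \<open>
  On short intervals both the increment of \<open>F \<circ> P\<close> and the integral of \<open>F' (P s) (w s)\<close> are close
  to \<open>F' (P u)\<close> applied to the increment of \<open>P\<close>; no pointwise differentiability of \<open>P\<close> is used.
\<close>

lemma primitive_of_chain: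
  fixes P :: "real \<Rightarrow> 'p::{banach, second_countable_topology}"
    and F :: "'p \<Rightarrow> 'q::{banach, second_countable_topology}"
  assumes P: "primitive_of P w" and S: "open S" "\<And>s. P s \<in> S"
    and F: "\<And>x. x \<in> S \<Longrightarrow> (F has_derivative blinfun_apply (F' x)) (at x)"
    and F': "continuous_on S F'"
  shows "primitive_of (\<lambda>s. F (P s)) (\<lambda>s. F' (P s) (w s))"
  unfolding primitive_of_def
proof (intro conjI allI impI)
  note P' = primitive_ofD[OF P]
  have contF: "continuous_on S F"
    by (intro continuous_at_imp_continuous_on ballI has_derivative_continuous[OF F])
  show "continuous_on UNIV (\<lambda>s. F (P s))"
    using S by (intro continuous_on_compose2[OF contF P'(1)]) auto
  have contA: "continuous_on UNIV (\<lambda>s. F' (P s))"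
    using S by (intro continuous_on_compose2[OF F' P'(1)]) auto
  fix a b :: real assume ab: "a \<le> b"
  let ?z = "\<lambda>s. F' (P s) (w s)"
  have bdd: "bounded ((\<lambda>s. F' (P s)) ` {a..b})"
    by (intro compact_imp_bounded compact_continuous_image continuous_on_subset[OF contA]) auto
  then obtain C where C: "\<And>s. s \<in> {a..b} \<Longrightarrow> norm (F' (P s)) \<le> C"
    unfolding bounded_iff by (metis imageI)
  have wi: "set_integrable lebesgue {u..v} w" for u v by (rule P'(2))
  have z: "set_integrable lebesgue {a..b} ?z"
    unfolding set_integrable_def
  proof (rule Bochner_Integration.integrable_bound)
    have ib: "integrable lebesgue (\<lambda>s. indicator {a..b} s *\<^sub>R w s)"
      using wi[of a b] by (simp add: set_integrable_def)
    then show "integrable lebesgue (\<lambda>s. C *\<^sub>R (indicator {a..b} s *\<^sub>R w s))" by (rule integrable_scaleR_right)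
    have "(\<lambda>s. F' (P s) (indicator {a..b} s *\<^sub>R w s)) \<in> borel_measurable lebesgue"
      by (rule borel_measurable_blinfun_apply[OF contA borel_measurable_integrable[OF ib]])
    then show "(\<lambda>s. indicat_real {a..b} s *\<^sub>R F' (P s) (w s)) \<in> borel_measurable lebesgue"
      by (simp add: blinfun.scaleR_right)
    show "AE s in lebesgue. norm (indicat_real {a..b} s *\<^sub>R F' (P s) (w s))
        \<le> norm (C *\<^sub>R (indicat_real {a..b} s *\<^sub>R w s))"
    proof (intro always_eventually allI)
      fix s
      show "norm (indicat_real {a..b} s *\<^sub>R F' (P s) (w s)) \<le> norm (C *\<^sub>R (indicat_real {a..b} s *\<^sub>R w s))"
      proof (cases "s \<in> {a..b}")
        case True
        have "norm (F' (P s) (w s)) \<le> norm (F' (P s)) * norm (w s)" by (rule norm_blinfun)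
        also have "\<dots> \<le> \<bar>C\<bar> * norm (w s)" using C[OF True] by (intro mult_right_mono) auto
        finally show ?thesis using True by simp
      qed simp
    qed
  qed
  show "set_integrable lebesgue {a..b} ?z" by (rule z)
  \<comment> \<open>The claimed formula says that \<open>?e\<close> has increment zero;
    \<open>?m\<close> integrates the speed \<open>norm (w s)\<close>. Bounding the increment of
    \<open>?e\<close> by arbitrarily small multiples of that of \<open>?m\<close> forces it to
    vanish.\<close>
  let ?e = "\<lambda>t. F (P t) - (LINT s:{a..t}|lebesgue. ?z s)"
  let ?m = "\<lambda>t. (LINT s:{a..t}|lebesgue. norm (w s))"
  have bound: "norm (?e b - ?e a) \<le> 2 * \<epsilon> * (?m b - ?m a)" if \<epsilon>: "\<epsilon> > 0" for \<epsilon>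
  proof -
    have K: "compact (P ` {a..b})"
      by (intro compact_continuous_image continuous_on_subset[OF P'(1)]) auto
    obtain \<delta> where \<delta>: "\<delta> > 0"
      "\<And>k q. k \<in> P ` {a..b} \<Longrightarrow> dist k q < \<delta> \<Longrightarrow> q \<in> S \<and> dist (F' q) (F' k) < \<epsilon>"
      using compact_uniform_continuity[OF K S(1) _ F' \<epsilon>] S(2) by (metis image_subsetI)
    have "uniformly_continuous_on {a..b} P"
      by (intro compact_uniformly_continuous continuous_on_subset[OF P'(1)]) auto
    then obtain \<mu> where \<mu>: "\<mu> > 0"
      "\<And>s t. s \<in> {a..b} \<Longrightarrow> t \<in> {a..b} \<Longrightarrow> dist t s < \<mu> \<Longrightarrow> dist (P t) (P s) < \<delta>"
      unfolding uniformly_continuous_on_def using \<delta>(1) by meson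
    have "norm (?e b - ?e a) \<le> 2 * \<epsilon> * ?m b - 2 * \<epsilon> * ?m a"
    proof (rule locally_bounded_increment[OF _ \<mu>(1) ab])
      fix u v assume uv: "a \<le> u" "u \<le> v" "v \<le> b" "v - u < \<mu>"
      let ?I = "LINT s:{u..v}|lebesgue. norm (w s)"
      define L where "L = F' (P u)"
      have zuv: "set_integrable lebesgue {u..v} ?z" using uv by (intro set_integrable_sub_Icc[OF z]) auto
      have m: "?m v - ?m u = ?I"
        using set_integral_split[of a v "\<lambda>s. norm (w s)" u] uv
        by (simp add: set_integrable_norm wi)
      have zz: "(LINT s:{a..v}|lebesgue. ?z s) - (LINT s:{a..u}|lebesgue. ?z s) = (LINT s:{u..v}|lebesgue. ?z s)"
        using set_integral_split[of a v ?z u] uv set_integrable_sub_Icc[OF z, of a v] by simp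
      have inc: "P v - P u = (LINT s:{u..v}|lebesgue. w s)" by (rule P'(3)[OF uv(2)])
      have incn: "norm (P v - P u) \<le> ?I" unfolding inc by (rule norm_set_integral_le)
      have close: "dist (P s) (P u) < \<delta>" if "s \<in> {u..v}" for s
        using that uv by (intro \<mu>(2)) (auto simp: dist_real_def)
      have "norm (F (P u + (P v - P u)) - F (P u) - L (P v - P u)) \<le> \<epsilon> * norm (P v - P u)"
      proof (rule segment_bound_affine)
        fix t :: real assume t: "0 \<le> t" "t \<le> 1"
        have "dist (P u) (P u + t *\<^sub>R (P v - P u)) = t * norm (P v - P u)"
          using t by (simp add: dist_norm)
        also have "\<dots> \<le> norm (P v - P u)" using t by (simp add: mult_left_le_one_le)
        also have "\<dots> < \<delta>" using close[of v] uv by (simp add: dist_norm)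
        finally have q: "P u + t *\<^sub>R (P v - P u) \<in> S \<and> dist (F' (P u + t *\<^sub>R (P v - P u))) (F' (P u)) < \<epsilon>"
          using uv by (intro \<delta>(2)) auto
        then show "(F has_derivative blinfun_apply (F' (P u + t *\<^sub>R (P v - P u)))) (at (P u + t *\<^sub>R (P v - P u)))"
          by (intro F) simp
        have "norm (blinfun_apply (F' (P u + t *\<^sub>R (P v - P u)) - L) (P v - P u))
           \<le> norm (F' (P u + t *\<^sub>R (P v - P u)) - L) * norm (P v - P u)" by (rule norm_blinfun)
        also have "\<dots> \<le> \<epsilon> * norm (P v - P u)"
          using q by (intro mult_right_mono) (auto simp: dist_norm L_def)
        finally show "norm (F' (P u + t *\<^sub>R (P v - P u)) (P v - P u) - L (P v - P u)) \<le> \<epsilon> * norm (P v - P u)"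
          by (simp add: blinfun.diff_left)
      qed (rule blinfun.bounded_linear_right)
      also have "\<dots> \<le> \<epsilon> * ?I" using incn \<epsilon> by simp
      finally have 1: "norm (F (P v) - F (P u) - L (P v - P u)) \<le> \<epsilon> * ?I" by simp
      note Lw = set_integral_bounded_linear[OF blinfun.bounded_linear_right[of L] wi[of u v]]
      have "L (P v - P u) - (LINT s:{u..v}|lebesgue. ?z s) = (LINT s:{u..v}|lebesgue. L (w s) - ?z s)"
        unfolding inc Lw(2)[symmetric] by (rule set_integral_diff(2)[symmetric, OF Lw(1) zuv])
      also have "norm \<dots> \<le> (LINT s:{u..v}|lebesgue. norm (L (w s) - ?z s))" by (rule norm_set_integral_le)
      also have "\<dots> \<le> (LINT s:{u..v}|lebesgue. \<epsilon> * norm (w s))"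
      proof (rule set_integral_mono)
        show "set_integrable lebesgue {u..v} (\<lambda>s. norm (L (w s) - ?z s))"
          by (intro set_integrable_norm set_integral_diff(1) Lw(1) zuv)
        show "set_integrable lebesgue {u..v} (\<lambda>s. \<epsilon> * norm (w s))"
          by (intro set_integrable_mult_right set_integrable_norm wi)
        fix s assume s: "s \<in> {u..v}"
        have "norm (blinfun_apply (L - F' (P s)) (w s)) \<le> norm (L - F' (P s)) * norm (w s)"
          by (rule norm_blinfun)
        also have "\<dots> \<le> \<epsilon> * norm (w s)"
        proof (intro mult_right_mono)
          have "dist (F' (P s)) (F' (P u)) < \<epsilon>" using close[OF s] uv
            by (intro \<delta>(2)[THEN conjunct2]) (auto simp: dist_commute)
          then show "norm (L - F' (P s)) \<le> \<epsilon>" by (simp add: L_def dist_norm norm_minus_commute)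
        qed simp
        finally show "norm (L (w s) - ?z s) \<le> \<epsilon> * norm (w s)" by (simp add: blinfun.diff_left)
      qed
      also have "\<dots> = \<epsilon> * ?I" by simp
      finally have 2: "norm (L (P v - P u) - (LINT s:{u..v}|lebesgue. ?z s)) \<le> \<epsilon> * ?I" .
      have "?e v - ?e u = (F (P v) - F (P u) - L (P v - P u)) + (L (P v - P u) - (LINT s:{u..v}|lebesgue. ?z s))"
        unfolding zz[symmetric] by (simp add: algebra_simps)
      then have "norm (?e v - ?e u) \<le> \<epsilon> * ?I + \<epsilon> * ?I"
        using norm_triangle_le[OF add_mono[OF 1 2]] by metis
      then show "norm (?e v - ?e u) \<le> 2 * \<epsilon> * ?m v - 2 * \<epsilon> * ?m u"
        unfolding m[symmetric] by (simp add: algebra_simps)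
    qed
    then show ?thesis by (simp add: algebra_simps)
  qed
  define M where "M = ?m b - ?m a"
  have "norm (?e b - ?e a) \<le> 0"
  proof (rule field_le_epsilon)
    fix e :: real assume e: "e > 0"
    have "norm (?e b - ?e a) \<le> 2 * (e / (2 * (\<bar>M\<bar> + 1))) * M"
      unfolding M_def[symmetric] using bound[of "e / (2 * (\<bar>M\<bar> + 1))", folded M_def] e by simp
    also have "\<dots> = e * (M / (\<bar>M\<bar> + 1))"
      by (simp only: mult_divide_mult_cancel_left times_divide_eq_right times_divide_eq_left mult.assoc)
    also have "\<dots> \<le> e * 1" using e by (intro mult_left_mono) (auto simp: divide_le_eq)
    finally show "norm (?e b - ?e a) \<le> 0 + e" by simp
  qed
  \<comment> \<open>Splitting the degenerate interval at \<open>a\<close> shows that the value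
    equals twice itself.\<close>
  moreover have "(LINT s:{a..a}|lebesgue. ?z s) = 0"
    using set_integral_split[of a a ?z a] set_integrable_sub_Icc[OF z, of a a] ab by simp
  ultimately show "F (P b) - F (P a) = (LINT s:{a..b}|lebesgue. ?z s)"
    by (simp add: algebra_simps)
qed

section \<open>Weak derivatives\<close>

lemma set_integrable_continuous_UNIV:
  fixes f :: "real \<Rightarrow> 'a::{banach, second_countable_topology}"
  shows "continuous_on UNIV f \<Longrightarrow> set_integrable lebesgue {a..b} f"
  by (rule set_integrable_continuous) (erule continuous_on_subset, simp)

lemma test_functionD:
  assumes "test_function \<rho>"
  shows "\<exists>N>0. \<forall>s. \<bar>s\<bar> \<ge> N \<longrightarrow> \<rho> s = 0 \<and> deriv \<rho> s = 0"
    "\<And>s. (\<rho> has_real_derivative deriv \<rho> s) (at s)" "continuous_on UNIV \<rho>" "continuous_on UNIV (deriv \<rho>)"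
proof -
  obtain D where D: "\<And>x. (\<rho> has_vector_derivative D x) (at x)" "continuous_on UNIV D"
    using assms by (auto simp: test_function_def C1_differentiable_on_def)
  have D': "(\<rho> has_real_derivative D x) (at x)" for x
    using D(1) by (simp add: has_real_derivative_iff_has_vector_derivative)
  then have dD: "deriv \<rho> = D" by (auto intro: DERIV_imp_deriv)
  have "bounded (closure {x. \<rho> x \<noteq> 0})" using assms by (auto simp: test_function_def compact_imp_bounded)
  then have "bounded {x. \<rho> x \<noteq> 0}" by (rule bounded_subset[OF _ closure_subset])
  then obtain M where M: "\<And>x. \<rho> x \<noteq> 0 \<Longrightarrow> \<bar>x\<bar> \<le> M" unfolding bounded_iff by auto
  \<comment> \<open>The extra 1 leaves a whole neighbourhood of every \<open>s\<close> with
    \<open>\<bar>s\<bar> \<ge> N\<close> outside the support, so that the derivative vanishes there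
    too.\<close>
  define N where "N = \<bar>M\<bar> + 1"
  have z: "\<rho> s = 0" if "\<bar>s\<bar> > \<bar>M\<bar>" for s using M[of s] that by force
  have dz: "D s = 0" if "\<bar>s\<bar> \<ge> N" for s
  proof -
    have "open {x::real. \<bar>x\<bar> > \<bar>M\<bar>}" by (intro open_Collect_less continuous_intros)
    then have "(\<rho> has_real_derivative 0) (at s)"
    proof (rule has_field_derivative_transform_within_open[OF DERIV_const[of 0]])
      show "s \<in> {x. \<bar>x\<bar> > \<bar>M\<bar>}" using that by (simp add: N_def)
    qed (simp add: z)
    then show ?thesis using D'[of s] DERIV_unique by blast
  qed
  show "\<exists>N>0. \<forall>s. \<bar>s\<bar> \<ge> N \<longrightarrow> \<rho> s = 0 \<and> deriv \<rho> s = 0"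
    using z dz dD by (intro exI[of _ N]) (auto simp: N_def)
  show d: "(\<rho> has_real_derivative deriv \<rho> s) (at s)" for s using D' dD by simp
  show "continuous_on UNIV \<rho>"
    by (rule DERIV_continuous_on[where D="deriv \<rho>"]) (rule has_field_derivative_at_within[OF d])
  show "continuous_on UNIV (deriv \<rho>)" using D(2) dD by simp
qed

lemma integral_supported_Icc:
  fixes f :: "real \<Rightarrow> 'a::{banach, second_countable_topology}"
  assumes "\<And>s. s \<notin> {a..b} \<Longrightarrow> f s = 0"
  shows "(\<integral>s. f s \<partial>lebesgue) = (LINT s:{a..b}|lebesgue. f s)"
    "integrable lebesgue f \<longleftrightarrow> set_integrable lebesgue {a..b} f"
proof -
  have "(\<lambda>s. indicator {a..b} s *\<^sub>R f s) = f" using assms by (auto simp: indicator_def fun_eq_iff)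
  then show "(\<integral>s. f s \<partial>lebesgue) = (LINT s:{a..b}|lebesgue. f s)"
    "integrable lebesgue f \<longleftrightarrow> set_integrable lebesgue {a..b} f"
    by (simp_all add: set_lebesgue_integral_def set_integrable_def)
qed

text \<open>This is the chain rule for \<open>(t, v) \<mapsto> \<rho> t *\<^sub>R v\<close> along
  the path \<open>s \<mapsto> (s, f s)\<close>.\<close>

lemma primitive_of_scaleR:
  fixes f :: "real \<Rightarrow> 'a::{banach, second_countable_topology}"
  assumes f: "primitive_of f g"
    and \<rho>: "\<And>s. (\<rho> has_real_derivative D s) (at s)" and D: "continuous_on UNIV D"
  shows "primitive_of (\<lambda>s. \<rho> s *\<^sub>R f s) (\<lambda>s. D s *\<^sub>R f s + \<rho> s *\<^sub>R g s)"
proof -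
  have c: "continuous_on UNIV \<rho>"
    using \<rho> by (auto intro: DERIV_continuous_on has_field_derivative_at_within)
  define F' where "F' = (\<lambda>z. D (fst z) *\<^sub>R (blinfun_scaleR_left (snd z) o\<^sub>L fst_blinfun)
     + \<rho> (fst z) *\<^sub>R (snd_blinfun :: (real \<times> 'a) \<Rightarrow>\<^sub>L 'a))"
  have "primitive_of (\<lambda>s. (\<lambda>z. \<rho> (fst z) *\<^sub>R snd z) (s, f s)) (\<lambda>s. F' (s, f s) (1, g s))"
  proof (rule primitive_of_chain[OF primitive_of_Pair[OF primitive_of_ident f] open_UNIV])
    fix z :: "real \<times> 'a"
    have "((\<lambda>z. \<rho> (fst z)) has_derivative (\<lambda>h. fst h * D (fst z))) (at z)"
      using has_derivative_compose[where g=\<rho> and f=fst, OF bounded_linear_imp_has_derivative[OF bounded_linear_fst]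
          \<rho>[of "fst z", unfolded has_field_derivative_def]]
      by (simp add: mult.commute[of "D _"])
    then show "((\<lambda>z. \<rho> (fst z) *\<^sub>R snd z) has_derivative blinfun_apply (F' z)) (at z)"
      unfolding F'_def
      by (auto intro!: derivative_eq_intros simp: blinfun.add_left blinfun.scaleR_left algebra_simps)
  next
    show "continuous_on UNIV F'"
      unfolding F'_def
      by (intro continuous_intros continuous_on_compose2[OF D] continuous_on_compose2[OF c]
          bounded_linear.continuous_on[OF bounded_linear_blinfun_scaleR_left]) auto
  qed auto
  then show ?thesis by (simp add: F'_def blinfun.add_left blinfun.scaleR_left)
qed

text \<open>Integration by parts: the product of \<rho> and \<open>f\<close> satisfies a primitive
  formula and vanishes at both ends of an interval outside of which \<rho> is zero.\<close>

lemma primitive_imp_weak_derivative: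
  assumes f: "primitive_of f g"
  shows "has_weak_derivative f g"
  unfolding has_weak_derivative_def
proof (intro allI impI)
  fix \<rho> :: "real \<Rightarrow> real" assume test: "test_function \<rho>"
  obtain N where N: "N > 0" "\<forall>s. \<bar>s\<bar> \<ge> N \<longrightarrow> \<rho> s = 0 \<and> deriv \<rho> s = 0"
      using test_functionD(1)[OF test] by blast
  note d = test_functionD(2)[OF test] and c = test_functionD(3,4)[OF test]
  note P = primitive_of_scaleR[OF f d c(2)]
  have i1: "set_integrable lebesgue {-N..N} (\<lambda>s. deriv \<rho> s *\<^sub>R f s)"
    by (intro set_integrable_continuous_UNIV continuous_intros c primitive_ofD(1)[OF f])
  have "set_integrable lebesgue {-N..N} (\<lambda>s. (deriv \<rho> s *\<^sub>R f s + \<rho> s *\<^sub>R g s) - deriv \<rho> s *\<^sub>R f s)"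
    by (rule set_integral_diff(1)[OF primitive_ofD(2)[OF P] i1])
  then have i2: "set_integrable lebesgue {-N..N} (\<lambda>s. \<rho> s *\<^sub>R g s)" by simp
  have "0 = \<rho> N *\<^sub>R f N - \<rho> (-N) *\<^sub>R f (-N)" using N by simp
  also have "\<dots> = (LINT s:{-N..N}|lebesgue. deriv \<rho> s *\<^sub>R f s + \<rho> s *\<^sub>R g s)"
    using N(1) by (intro primitive_ofD(3)[OF P]) simp
  also have "\<dots> = (LINT s:{-N..N}|lebesgue. deriv \<rho> s *\<^sub>R f s) + (LINT s:{-N..N}|lebesgue. \<rho> s *\<^sub>R g s)"
    by (rule set_integral_add(2)[OF i1 i2])
  also have "(LINT s:{-N..N}|lebesgue. deriv \<rho> s *\<^sub>R f s) = (\<integral>s. deriv \<rho> s *\<^sub>R f s \<partial>lebesgue)"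
    using N by (intro integral_supported_Icc(1)[symmetric]) auto
  also have "(LINT s:{-N..N}|lebesgue. \<rho> s *\<^sub>R g s) = (\<integral>s. \<rho> s *\<^sub>R g s \<partial>lebesgue)"
    using N by (intro integral_supported_Icc(1)[symmetric]) auto
  finally show "(\<integral>s. deriv \<rho> s *\<^sub>R f s \<partial>lebesgue) = - (\<integral>s. \<rho> s *\<^sub>R g s \<partial>lebesgue)"
    by (simp add: eq_neg_iff_add_eq_0)
qed

lemma primitive_of_exists:
  fixes g :: "real \<Rightarrow> 'a::{real_inner, banach, second_countable_topology}"
  assumes g: "g \<in> L2"
  obtains G where "primitive_of G g"
proof -
  note i = L2_locally_integrable[OF g]
  define G where "G = (\<lambda>t. if 0 \<le> t then LINT s:{0..t}|lebesgue. g s else - (LINT s:{t..0}|lebesgue. g s))"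
  have z: "(LINT s:{a..a}|lebesgue. g s) = 0" for a
    using set_integral_split[OF i, of a a a] by simp
  have inc: "G b - G a = (LINT s:{a..b}|lebesgue. g s)" if "a \<le> b" for a b
  proof -
    consider "0 \<le> a" | "a < 0" "0 \<le> b" | "a < 0" "b < 0" by linarith
    then show ?thesis
    proof cases
      case 1
      then show ?thesis unfolding set_integral_split[OF i 1 that]
        diff_conv_add_uminus using that by (simp add: G_def algebra_simps set_integral_split[OF i 1 that])
    next
      case 2
      then show ?thesis unfolding set_integral_split[OF i less_imp_le[OF 2(1)] 2(2)]
        by (simp add: G_def)
    next
      case 3
      then show ?thesis using that set_integral_split[OF i that, of 0] by (simp add: G_def)
    qed
  qed
  \<comment> \<open>Young's inequality \<open>norm (g s) \<le> l + (norm (g s))\<^sup>2 / l\<close>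
    takes the place of Cauchy-Schwarz; \<open>l\<close> will be taken large and the interval
    short.\<close>
  have small: "norm (G b - G a) \<le> l * (b - a) + (L2_seminorm g)\<^sup>2 / l" if "a \<le> b" "l > 0" for a b l
  proof -
    have ic: "set_integrable lebesgue {a..b} (\<lambda>s. l)" by (intro set_integrable_continuous continuous_intros)
    have i2: "integrable lebesgue (\<lambda>s. (norm (g s))\<^sup>2 / l)" using L2_D(2)[OF g] by simp
    then have is2: "set_integrable lebesgue {a..b} (\<lambda>s. (norm (g s))\<^sup>2 / l)"
      unfolding set_integrable_def by (intro integrable_mult_indicator) auto
    have "norm (G b - G a) \<le> (LINT s:{a..b}|lebesgue. norm (g s))"
      unfolding inc[OF that(1)] by (rule norm_set_integral_le)
    also have "\<dots> \<le> (LINT s:{a..b}|lebesgue. l + (norm (g s))\<^sup>2 / l)"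
    proof (rule set_integral_mono)
      fix s
      have "0 \<le> (norm (g s) - l)\<^sup>2 / l" using that by simp
      also have "\<dots> = (norm (g s))\<^sup>2 / l + l - 2 * norm (g s)"
        using that by (simp add: field_simps power2_eq_square)
      finally show "norm (g s) \<le> l + (norm (g s))\<^sup>2 / l"
        using norm_ge_zero[of "g s"] by linarith
    qed (auto intro!: set_integrable_norm i set_integral_add(1) ic is2)
    also have "\<dots> = (LINT s:{a..b}|lebesgue. l) + (LINT s:{a..b}|lebesgue. (norm (g s))\<^sup>2 / l)"
      by (rule set_integral_add(2)[OF ic is2])
    also have "(LINT s:{a..b}|lebesgue. l) = l * (b - a)"
      using that by (simp add: set_lebesgue_integral_def)
    also have "(LINT s:{a..b}|lebesgue. (norm (g s))\<^sup>2 / l) \<le> (\<integral>s. (norm (g s))\<^sup>2 / l \<partial>lebesgue)"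
      unfolding set_lebesgue_integral_def
      using is2 i2 that by (intro integral_mono) (auto simp: set_integrable_def indicator_def)
    finally show ?thesis by (simp add: L2_seminorm_sq)
  qed
  have small': "norm (G b - G a) \<le> l * \<bar>b - a\<bar> + (L2_seminorm g)\<^sup>2 / l" if "l > 0" for a b l
    using small[of a b l] small[of b a l] that by (cases "a \<le> b") (auto simp: norm_minus_commute)
  have "continuous_on UNIV G"
    unfolding continuous_on_iff
  proof (intro ballI allI impI)
    fix a e :: real assume e: "e > 0"
    define N where "N = (L2_seminorm g)\<^sup>2"
    have N: "N \<ge> 0" by (simp add: N_def)
    \<comment> \<open>Makes the energy term less than \<open>e/2\<close>; the radius
      \<open>e / (2 * l)\<close> below takes care of the other half.\<close>
    define l where "l = 2 * (N + 1) / e"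
    have l: "l > 0" using N e by (simp add: l_def)
    have "N / l = e * (N / (N + 1)) / 2" using N e by (simp add: l_def field_simps)
    also have "\<dots> < e / 2" using N e by (simp add: divide_less_eq)
    finally have Nl: "N / l < e / 2" .
    show "\<exists>d>0. \<forall>b\<in>UNIV. dist b a < d \<longrightarrow> dist (G b) (G a) < e"
    proof (intro exI[of _ "e / (2 * l)"] conjI ballI impI)
      show "e / (2 * l) > 0" using e l by simp
      fix b assume "dist b a < e / (2 * l)"
      then have "l * \<bar>b - a\<bar> < e / 2" using l by (simp add: dist_real_def field_simps)
      then show "dist (G b) (G a) < e"
        using small'[OF l, of b a] Nl unfolding dist_norm N_def by linarith
    qed
  qed
  then have "primitive_of G g"
    unfolding primitive_of_def by (intro conjI allI impI i inc)
  then show ?thesis by (rule that)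
qed

text \<open>The antiderivative normalised at \<open>a\<close> is constant to the right of
  \<open>b\<close>, and the vanishing mean of \<psi> makes that constant 0.\<close>

lemma test_function_antiderivative:
  assumes c: "continuous_on UNIV \<psi>" and ab: "a < b" and z: "\<And>s. s \<notin> {a<..<b} \<Longrightarrow> \<psi> s = 0"
    and i: "integral {a..b} \<psi> = 0"
  obtains \<rho> where "test_function \<rho>" "deriv \<rho> = \<psi>"
proof -
  have "isCont \<psi> x" for x using c by (simp add: continuous_on_eq_continuous_at)
  then obtain F where F: "\<And>x. (F has_vector_derivative \<psi> x) (at x)"
    using einterval_antiderivative[of "-\<infinity>" "\<infinity>" \<psi>] by auto
  have FTC: "F t - F s = integral {s..t} \<psi>" if "s \<le> t" for s t
    by (intro integral_unique[symmetric] fundamental_theorem_of_calculus that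
        has_vector_derivative_at_within[OF F])
  define \<rho> where "\<rho> = (\<lambda>s. F s - F a)"
  have D: "(\<rho> has_vector_derivative \<psi> x) (at x)" for x
    unfolding \<rho>_def by (auto intro!: derivative_eq_intros F)
  have zero: "\<rho> s = 0" if "s \<notin> {a<..<b}" for s
  proof (cases "s \<le> a")
    case True
    have "integral {s..a} \<psi> = integral {s..a} (\<lambda>_. 0)" using z by (intro integral_cong) auto
    then show ?thesis using FTC[OF True] by (simp add: \<rho>_def)
  next
    case False
    then have "b \<le> s" using that by auto
    have "integral {b..s} \<psi> = integral {b..s} (\<lambda>_. 0)" using z by (intro integral_cong) auto
    then show ?thesis using FTC[OF \<open>b \<le> s\<close>] FTC[of a b] ab i by (simp add: \<rho>_def)
  qed
  have "closure {x. \<rho> x \<noteq> 0} \<subseteq> {a..b}"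
  proof (rule closure_minimal)
    show "{x. \<rho> x \<noteq> 0} \<subseteq> {a..b}"
    proof
      fix x assume "x \<in> {x. \<rho> x \<noteq> 0}"
      then have "x \<in> {a<..<b}" using zero[of x] by blast
      then show "x \<in> {a..b}" by simp
    qed
  qed simp
  then have "compact (closure {x. \<rho> x \<noteq> 0})"
    by (metis closed_closure compact_Icc compact_Int_closed inf.absorb_iff2)
  then have "test_function \<rho>"
    unfolding test_function_def C1_differentiable_on_def using D c by auto
  moreover have "deriv \<rho> = \<psi>"
    using D by (auto intro!: DERIV_imp_deriv simp: has_real_derivative_iff_has_vector_derivative)
  ultimately show ?thesis by (rule that)
qed

lemma set_integral_eq_integral_continuous:
  fixes f :: "real \<Rightarrow> real"
  assumes "continuous_on UNIV f"
  shows "(LINT s:{a..b}|lebesgue. f s) = integral {a..b} f"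
  using assms by (intro set_lebesgue_integral_eq_integral(2) set_integrable_continuous continuous_on_subset[OF assms]) auto

text \<open>
  A test function whose derivative is \<open>w * (u \<bullet> z - c)\<close>, with a nonnegative weight \<open>w\<close> and the
  \<open>w\<close>-mean \<open>c\<close> of \<open>u \<bullet> z\<close>, gives a vanishing weighted variance.
\<close>

lemma weak_derivative_zero_inner_const:
  fixes u :: "real \<Rightarrow> 'a::{real_inner, banach, second_countable_topology}"
  assumes c: "continuous_on UNIV u"
    and weak: "\<And>\<rho>. test_function \<rho> \<Longrightarrow> (\<integral>s. deriv \<rho> s *\<^sub>R u s \<partial>lebesgue) = 0"
    and st: "a < s" "s < b" "a < t" "t < b"
  shows "u s \<bullet> z = u t \<bullet> z"
proof -
  have ab: "a < b" using st by simp
  \<comment> \<open>A bump that is positive exactly on the open interval. Continuity is enough, as a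
    test function only has to be C1 and \<open>w\<close> enters its derivative.\<close>
  define w where "w = (\<lambda>s. max 0 ((s - a) * (b - s)))"
  have cw: "continuous_on S w" for S unfolding w_def by (intro continuous_intros)
  have cu: "continuous_on S (\<lambda>s. u s \<bullet> z)" for S
    by (intro continuous_intros continuous_on_subset[OF c]) auto
  have wz: "w s = 0" if "s \<notin> {a<..<b}" for s
  proof -
    have "(s - a) * (b - s) \<le> 0" using that ab by (cases "s \<le> a") (auto simp: mult_le_0_iff)
    then show ?thesis by (simp add: w_def)
  qed
  have wpos: "w s > 0" if "a < s" "s < b" for s using that by (simp add: w_def less_max_iff_disj)
  have w0: "w s \<ge> 0" for s by (simp add: w_def)
  have iw: "w integrable_on {a..b}" and iwu: "(\<lambda>s. w s * (u s \<bullet> z)) integrable_on {a..b}"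
    by (intro integrable_continuous_interval continuous_intros cw cu)+
  have "integral {a..b} w \<noteq> 0"
    using integral_eq_0_iff[OF cw ab, of] w0 wpos[of "(a+b)/2"] ab by force
  define m where "m = integral {a..b} (\<lambda>s. w s * (u s \<bullet> z)) / integral {a..b} w"
  define \<psi> where "\<psi> = (\<lambda>s. w s * (u s \<bullet> z - m))"
  have c\<psi>: "continuous_on S \<psi>" for S unfolding \<psi>_def by (intro continuous_intros cw cu)
  have "integral {a..b} \<psi> = integral {a..b} (\<lambda>s. w s * (u s \<bullet> z) - m * w s)"
    by (simp add: \<psi>_def algebra_simps)
  also have "\<dots> = 0"
    using \<open>integral {a..b} w \<noteq> 0\<close> integral_diff[OF iwu integrable_on_cmult_left[OF iw, of m]]
    by (simp add: m_def)
  finally have i0: "integral {a..b} \<psi> = 0" .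
  obtain \<rho> where \<rho>: "test_function \<rho>" "deriv \<rho> = \<psi>"
    using test_function_antiderivative[OF c\<psi> ab _ i0] wz by (auto simp: \<psi>_def)
  have "0 = (\<integral>s. \<psi> s *\<^sub>R u s \<partial>lebesgue)" using weak[OF \<rho>(1)] \<rho>(2) by simp
  also have "\<dots> = (LINT s:{a..b}|lebesgue. \<psi> s *\<^sub>R u s)"
    by (rule integral_supported_Icc(1)) (auto simp: \<psi>_def wz)
  finally have "0 = (LINT s:{a..b}|lebesgue. \<psi> s *\<^sub>R u s) \<bullet> z" by simp
  also have "\<dots> = (LINT s:{a..b}|lebesgue. (\<psi> s *\<^sub>R u s) \<bullet> z)"
    by (intro set_integral_bounded_linear(2)[symmetric] bounded_linear_inner_left
        set_integrable_continuous_UNIV continuous_intros c\<psi> c)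
  also have "\<dots> = integral {a..b} (\<lambda>s. \<psi> s * (u s \<bullet> z))"
    by (subst set_integral_eq_integral_continuous) (auto intro!: continuous_intros c\<psi> cu)
  \<comment> \<open>Subtracting \<open>m\<close> times the mean zero function \<psi> completes the
    square: the integrand becomes \<open>w s * (u s \<bullet> z - m)\<^sup>2\<close>, which is
    nonnegative.\<close>
  finally have "integral {a..b} (\<lambda>s. \<psi> s * (u s \<bullet> z) - m * \<psi> s) = 0"
    using i0 by (subst integral_diff)
      (auto intro!: integrable_continuous_interval continuous_intros c\<psi> cu)
  moreover have "\<psi> s * (u s \<bullet> z) - m * \<psi> s = w s * (u s \<bullet> z - m)\<^sup>2" for s
    by (simp add: \<psi>_def power2_eq_square algebra_simps)
  ultimately have "integral {a..b} (\<lambda>s. w s * (u s \<bullet> z - m)\<^sup>2) = 0" by simp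
  then have "\<forall>s\<in>{a..b}. w s * (u s \<bullet> z - m)\<^sup>2 = 0"
    using w0 by (subst (asm) integral_eq_0_iff) (auto intro!: continuous_intros cw cu ab)
  then have "u r \<bullet> z = m" if "a < r" "r < b" for r
    using wpos[OF that] that by (auto dest!: bspec[of _ _ r])
  then show ?thesis using st by simp
qed

text \<open>The difference of \<open>f\<close> and a primitive of \<open>g\<close> has weak
  derivative zero and is therefore constant; inner products with fixed vectors reduce this to a
  scalar statement.\<close>

lemma weak_derivative_imp_primitive:
  fixes f :: "real \<Rightarrow> 'a::{real_inner, banach, second_countable_topology}"
  assumes c: "continuous_on UNIV f" and g: "g \<in> L2" and weak: "has_weak_derivative f g"
  shows "primitive_of f g"
proof -
  obtain G where G: "primitive_of G g" using primitive_of_exists[OF g] by blast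
  note cG = primitive_ofD(1)[OF G]
  define u where "u = (\<lambda>s. f s - G s)"
  have cu: "continuous_on UNIV u" unfolding u_def by (intro continuous_intros c cG)
  have "(\<integral>s. deriv \<rho> s *\<^sub>R u s \<partial>lebesgue) = 0" if test: "test_function \<rho>" for \<rho>
  proof -
    obtain N where N: "N > 0" "\<forall>s. \<bar>s\<bar> \<ge> N \<longrightarrow> \<rho> s = 0 \<and> deriv \<rho> s = 0"
      using test_functionD(1)[OF test] by blast
    note cr = test_functionD(4)[OF test]
    have i: "integrable lebesgue (\<lambda>s. deriv \<rho> s *\<^sub>R h s)"
      if "continuous_on UNIV h" for h :: "real \<Rightarrow> 'a"
      using N by (subst integral_supported_Icc(2)[where a="-N" and b=N])
        (auto intro!: set_integrable_continuous_UNIV continuous_intros cr that)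
    show ?thesis
      using test weak primitive_imp_weak_derivative[OF G] i[OF c] i[OF cG]
      by (simp add: u_def has_weak_derivative_def scaleR_diff_right)
  qed
  note const = weak_derivative_zero_inner_const[OF cu this]
  have "u s = u t" for s t
  proof -
    have "u s \<bullet> z = u t \<bullet> z" for z
      by (rule const[of "min s t - 1" _ "max s t + 1"]) auto
    from this[of "u s - u t"] have "(u s - u t) \<bullet> (u s - u t) = 0" by (simp add: inner_diff_left)
    then show ?thesis by simp
  qed
  then have "f b - f a = G b - G a" for a b by (simp add: u_def) (metis diff_eq_eq add_diff_eq add.commute)
  then show ?thesis using G c by (simp add: primitive_of_def)
qed

section \<open>Almost everywhere uniqueness of the weak derivative\<close>

lemma sigma_finite_lebesgue: "sigma_finite_measure (lebesgue :: real measure)"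
proof (rule sigma_finite_measure.intro, intro exI[of _ "range (\<lambda>n. {-real n..real n})"] conjI ballI)
  show "\<Union> (range (\<lambda>n. {-real n..real n})) = space lebesgue"
  proof (intro set_eqI iffI)
    fix x :: real
    obtain n where "\<bar>x\<bar> \<le> real n" using real_arch_simple by blast
    then show "x \<in> \<Union> (range (\<lambda>n. {-real n..real n}))" by (auto simp: abs_le_iff intro!: exI[of _ n])
  qed simp
qed (auto simp: emeasure_lborel_Icc_eq)

text \<open>On each \<open>[-n, n]\<close> the vanishing of integrals passes from intervals to Borel
  sets by complements and disjoint unions, and to Lebesgue sets up to null sets. An integrable
  function all of whose set integrals are zero vanishes almost everywhere.\<close>

lemma AE_zero_if_interval_integrals_zero:
  fixes g :: "real \<Rightarrow> 'a::{banach, second_countable_topology}"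
  assumes g: "\<And>a b. set_integrable lebesgue {a..b} g"
    and z: "\<And>a b. a \<le> b \<Longrightarrow> (LINT s:{a..b}|lebesgue. g s) = 0"
  shows "AE s in lebesgue. g s = 0"
proof -
  have "AE s in lebesgue. indicator {-real n..real n} s *\<^sub>R g s = 0" for n
  proof -
    let ?h = "\<lambda>s. indicator {-real n..real n} s *\<^sub>R g s"
    have h: "integrable lebesgue ?h" using g by (simp add: set_integrable_def)
    note hm = borel_measurable_integrable[OF h]
    have sub: "set_integrable lebesgue A ?h" if "A \<in> sets lebesgue" for A
      unfolding set_integrable_def by (rule integrable_mult_indicator[OF that h])
    have tot: "(LINT s:UNIV|lebesgue. ?h s) = 0"
      using z[of "-real n" "real n"] by (simp add: set_lebesgue_integral_def)
    have borel: "(LINT s:A|lebesgue. ?h s) = 0" if "A \<in> sets borel" for A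
      using that
    proof (induction rule: borel_set_induct)
      case empty
      then show ?case by (simp add: set_lebesgue_integral_def)
    next
      case (interval a b)
      have "(LINT s:{a..b}|lebesgue. ?h s) = (LINT s:{max a (- real n)..min b (real n)}|lebesgue. g s)"
        unfolding set_lebesgue_integral_def
        by (intro Bochner_Integration.integral_cong) (auto simp: indicator_def)
      also have "\<dots> = 0"
      proof (cases "max a (- real n) \<le> min b (real n)")
        case True
        then show ?thesis by (rule z)
      next
        case False
        then have "{max a (- real n)..min b (real n)} = {}" by simp
        then show ?thesis by (simp only: set_lebesgue_integral_def) simp
      qed
      finally show ?case .
    next
      case (compl A)
      have "(LINT s:A \<union> -A|lebesgue. ?h s) = (LINT s:A|lebesgue. ?h s) + (LINT s:-A|lebesgue. ?h s)"
        using compl by (intro set_integral_Un sub) auto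
      then show ?case using compl tot by simp
    next
      case (union A)
      have "(LINT s:(\<Union>i. A i)|lebesgue. ?h s) = (\<Sum>i. (LINT s:A i|lebesgue. ?h s))"
        using union by (intro lebesgue_integral_countable_add sub) (auto simp: disjoint_family_on_def)
      then show ?case using union by simp
    qed
    have "(LINT s:A|lebesgue. ?h s) = 0" if A: "A \<in> sets lebesgue" for A
    proof -
      obtain S N N' where S: "A = S \<union> N" "N \<subseteq> N'" "N' \<in> null_sets lborel" "S \<in> sets lborel"
        using A by (rule sets_completionE)
      have "AE s in lebesgue. s \<notin> N'" using S(3) by (intro AE_completion AE_not_in)
      then have "AE s in lebesgue. indicator A s *\<^sub>R ?h s = indicator S s *\<^sub>R ?h s"
        by eventually_elim (use S in \<open>auto simp: indicator_def\<close>)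
      then have "(LINT s:A|lebesgue. ?h s) = (LINT s:S|lebesgue. ?h s)"
        unfolding set_lebesgue_integral_def
        using A S(4) by (intro integral_cong_AE borel_measurable_scaleR[OF borel_measurable_indicator hm]) auto
      also have "\<dots> = 0" using S by (intro borel) simp
      finally show ?thesis .
    qed
    then show "AE s in lebesgue. ?h s = 0"
      by (intro sigma_finite_measure.density_zero[OF sigma_finite_lebesgue h]) auto
  qed
  then have "AE s in lebesgue. \<forall>n. indicator {-real n..real n} s *\<^sub>R g s = 0"
    unfolding AE_all_countable by blast
  then show ?thesis
  proof eventually_elim
    case (elim s)
    obtain n where "\<bar>s\<bar> \<le> real n" using real_arch_simple by blast
    then have "s \<in> {-real n..real n}" by auto
    with elim[rule_format, of n] show ?case by simp
  qed
qed

text \<open>Makes the choice in \<open>weak_deriv\<close> harmless: all candidates agree almost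
  everywhere, since the zero function is a primitive of their difference.\<close>

lemma primitive_of_AE_unique:
  assumes "primitive_of f g" "primitive_of f g'"
  shows "AE s in lebesgue. g s = g' s"
proof -
  have "primitive_of (\<lambda>s. f s - f s) (\<lambda>s. g s - g' s)" using assms by (rule primitive_of_diff)
  from primitive_ofD(2,3)[OF this] have "AE s in lebesgue. g s - g' s = 0"
    by (intro AE_zero_if_interval_integrals_zero) auto
  then show ?thesis by eventually_elim simp
qed

lemma weak_deriv_W12:
  assumes "f \<in> W12"
  shows "weak_deriv f \<in> L2" "primitive_of f (weak_deriv f)" "f \<in> L2" "continuous_on UNIV f"
proof -
  have "\<exists>g. g \<in> L2 \<and> has_weak_derivative f g" using assms by (auto simp: W12_def)
  then have w: "weak_deriv f \<in> L2 \<and> has_weak_derivative f (weak_deriv f)"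
    unfolding weak_deriv_def by (rule someI_ex)
  show f: "f \<in> L2" "continuous_on UNIV f" using assms by (auto simp: W12_def)
  show "weak_deriv f \<in> L2" using w by simp
  show "primitive_of f (weak_deriv f)" using f w by (intro weak_derivative_imp_primitive) auto
qed

lemma W12_I:
  assumes "f \<in> L2" "primitive_of f g" "g \<in> L2"
  shows "f \<in> W12" "L2_seminorm (weak_deriv f) = L2_seminorm g"
proof -
  show W: "f \<in> W12"
    using assms primitive_imp_weak_derivative primitive_ofD(1) unfolding W12_def by blast
  show "L2_seminorm (weak_deriv f) = L2_seminorm g"
    by (rule L2_AE_cong(2)[OF assms(3) primitive_of_AE_unique[OF assms(2) weak_deriv_W12(2)[OF W]]])
qed

section \<open>Sup norm bound and decay\<close>

lemma primitive_of_norm_sq: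
  fixes f :: "real \<Rightarrow> 'a::{real_inner, banach, second_countable_topology}"
  assumes "primitive_of f g"
  shows "primitive_of (\<lambda>s. (norm (f s))\<^sup>2) (\<lambda>s. 2 * (f s \<bullet> g s))"
proof -
  have "primitive_of (\<lambda>s. (\<lambda>x. x \<bullet> x) (f s)) (\<lambda>s. (2 *\<^sub>R blinfun_inner_right (f s)) (g s))"
    by (rule primitive_of_chain[OF assms open_UNIV])
       (auto intro!: derivative_eq_intros continuous_intros
         bounded_linear.continuous_on[OF bounded_linear_blinfun_inner_right]
         simp: blinfun.scaleR_left inner_commute)
  then show ?thesis by (simp add: blinfun.scaleR_left power2_norm_eq_inner)
qed

text \<open>The derivative of \<open>(norm (f s))\<^sup>2\<close> is bounded by the energy density,
  and square integrability makes \<open>(norm (f a))\<^sup>2\<close> arbitrarily small somewhere on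
  the half-line; the estimate runs from there to \<open>s\<close>. The half-line form serves both
  the sup bound and the decay at infinity.\<close>

lemma norm_sq_le_half_line_energy:
  fixes f :: "real \<Rightarrow> 'a::{real_inner, banach, second_countable_topology}"
  assumes P: "primitive_of f g" and f: "f \<in> L2" and g: "g \<in> L2"
    and S: "S = {s..} \<or> S = {..s}"
  shows "(norm (f s))\<^sup>2 \<le> (LINT r:S|lebesgue. (norm (f r))\<^sup>2 + (norm (g r))\<^sup>2)"
proof -
  let ?m = "\<lambda>r. (norm (f r))\<^sup>2 + (norm (g r))\<^sup>2"
  have im: "integrable lebesgue ?m" using L2_D(2)[OF f] L2_D(2)[OF g] by simp
  have iS: "set_integrable lebesgue A ?m" if "A \<in> sets lebesgue" for A
    unfolding set_integrable_def using im that by (intro integrable_mult_indicator) auto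
  have Sm: "S \<in> sets lebesgue" using S by auto
  note Q = primitive_of_norm_sq[OF P]
  have seg: "\<bar>(norm (f b))\<^sup>2 - (norm (f a))\<^sup>2\<bar> \<le> (LINT r:S|lebesgue. ?m r)"
    if ab: "a \<le> b" "{a..b} \<subseteq> S" for a b
  proof -
    have "\<bar>(norm (f b))\<^sup>2 - (norm (f a))\<^sup>2\<bar> \<le> (LINT r:{a..b}|lebesgue. norm (2 * (f r \<bullet> g r)))"
      unfolding primitive_ofD(3)[OF Q ab(1)] using norm_set_integral_le by (metis real_norm_def)
    also have "\<dots> \<le> (LINT r:{a..b}|lebesgue. ?m r)"
    proof (rule set_integral_mono)
      fix r
      have "norm (2 * (f r \<bullet> g r)) \<le> 2 * (norm (f r) * norm (g r))"
        using Cauchy_Schwarz_ineq2[of "f r" "g r"] by simp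
      also have "\<dots> \<le> ?m r" using sum_squares_bound[of "norm (f r)" "norm (g r)"] by simp
      finally show "norm (2 * (f r \<bullet> g r)) \<le> ?m r" .
      show "set_integrable lebesgue {a..b} (\<lambda>r. norm (2 * (f r \<bullet> g r)))"
        by (rule set_integrable_norm[OF primitive_ofD(2)[OF Q]])
    qed (simp add: iS)
    also have "\<dots> \<le> (LINT r:S|lebesgue. ?m r)"
      unfolding set_lebesgue_integral_def
      using iS[OF Sm] iS[of "{a..b}"] ab(2)
      by (intro integral_mono) (auto simp: set_integrable_def indicator_def)
    finally show ?thesis .
  qed
  \<comment> \<open>Otherwise the integral of \<open>(norm (f r))\<^sup>2\<close> over intervals of
    length \<open>n\<close> inside \<open>S\<close> would grow linearly in \<open>n\<close>.\<close>
  have small: "\<exists>a\<in>S. (norm (f a))\<^sup>2 < e" if e: "e > 0" for e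
  proof (rule ccontr)
    assume "\<not> ?thesis"
    then have ge: "\<And>a. a \<in> S \<Longrightarrow> e \<le> (norm (f a))\<^sup>2" by force
    have bd: "e * real n \<le> (L2_seminorm f)\<^sup>2" for n
    proof -
      obtain a b where ab: "a \<le> b" "b - a = real n" "{a..b} \<subseteq> S"
        using S
      proof
        assume "S = {s..}" then show ?thesis using that[of s "s + real n"] by auto
      next
        assume "S = {..s}" then show ?thesis using that[of "s - real n" s] by auto
      qed
      have "e * real n = (\<integral>r. indicator {a..b} r * e \<partial>lebesgue)" using ab by simp
      also have "\<dots> \<le> (\<integral>r. (norm (f r))\<^sup>2 \<partial>lebesgue)"
        using ab ge e
        by (intro integral_mono L2_D(2) f integrable_mult_left integrable_real_indicator)
           (auto simp: indicator_def subset_eq emeasure_lborel_Icc_eq)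
      finally show ?thesis by (simp add: L2_seminorm_sq)
    qed
    obtain n where "(L2_seminorm f)\<^sup>2 / e < real n" using reals_Archimedean2 by blast
    then have "(L2_seminorm f)\<^sup>2 < e * real n" using e by (simp add: field_simps)
    then show False using bd[of n] by simp
  qed
  show ?thesis
  proof (rule field_le_epsilon)
    fix e :: real assume "e > 0"
    then obtain a where a: "a \<in> S" "(norm (f a))\<^sup>2 < e" using small by blast
    have "\<bar>(norm (f s))\<^sup>2 - (norm (f a))\<^sup>2\<bar> \<le> (LINT r:S|lebesgue. ?m r)"
      using S
    proof
      assume "S = {s..}" then show ?thesis
        using seg[of s a] a by (auto simp: abs_minus_commute)
    next
      assume "S = {..s}" then show ?thesis using seg[of a s] a by auto
    qed
    then show "(norm (f s))\<^sup>2 \<le> (LINT r:S|lebesgue. ?m r) + e" using a by linarith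
  qed
qed

lemma primitive_of_sup_bound:
  fixes f :: "real \<Rightarrow> 'a::{real_inner, banach, second_countable_topology}"
  assumes P: "primitive_of f g" and f: "f \<in> L2" and g: "g \<in> L2"
  shows "norm (f s) \<le> sqrt ((L2_seminorm f)\<^sup>2 + (L2_seminorm g)\<^sup>2)"
proof (rule real_le_rsqrt)
  let ?m = "\<lambda>r. (norm (f r))\<^sup>2 + (norm (g r))\<^sup>2"
  have im: "integrable lebesgue ?m" using L2_D(2)[OF f] L2_D(2)[OF g] by simp
  have "(norm (f s))\<^sup>2 \<le> (LINT r:{s..}|lebesgue. ?m r)"
    by (rule norm_sq_le_half_line_energy[OF P f g]) simp
  also have "\<dots> \<le> (\<integral>r. ?m r \<partial>lebesgue)"
    unfolding set_lebesgue_integral_def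
    using integrable_mult_indicator[OF _ im, of "{s..}"] im
    by (intro integral_mono) (auto simp: indicator_def)
  also have "\<dots> = (L2_seminorm f)\<^sup>2 + (L2_seminorm g)\<^sup>2"
    unfolding L2_seminorm_sq by (rule Bochner_Integration.integral_add[OF L2_D(2)[OF f] L2_D(2)[OF g]])
  finally show "(norm (f s))\<^sup>2 \<le> (L2_seminorm f)\<^sup>2 + (L2_seminorm g)\<^sup>2" .
qed

text \<open>The energy over half-lines decreasing to the empty set tends to zero, and it bounds
  \<open>(norm (f s))\<^sup>2\<close> at every \<open>s\<close> inside them.\<close>

lemma primitive_of_decay:
  fixes f :: "real \<Rightarrow> 'a::{real_inner, banach, second_countable_topology}"
  assumes P: "primitive_of f g" and f: "f \<in> L2" and g: "g \<in> L2" and e: "\<epsilon> > 0"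
  obtains R where "\<And>s. \<bar>s\<bar> \<ge> R \<Longrightarrow> norm (f s) < \<epsilon>"
proof -
  let ?m = "\<lambda>r. (norm (f r))\<^sup>2 + (norm (g r))\<^sup>2"
  have im: "integrable lebesgue ?m" using L2_D(2)[OF f] L2_D(2)[OF g] by simp
  have iS: "set_integrable lebesgue A ?m" if "A \<in> sets lebesgue" for A
    unfolding set_integrable_def using im that by (intro integrable_mult_indicator) auto
  have tail: "\<exists>n::nat. (LINT r:A n|lebesgue. ?m r) < \<epsilon>\<^sup>2"
    if A: "decseq A" "(\<Inter>n. A n) = {}" "\<And>n. A n \<in> sets lebesgue" for A
  proof -
    have "(\<lambda>n. LINT r:A n|lebesgue. ?m r) \<longlonglongrightarrow> (LINT r:(\<Inter>n. A n)|lebesgue. ?m r)"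
      by (intro set_integral_cont_down A iS)
    then have "(\<lambda>n. LINT r:A n|lebesgue. ?m r) \<longlonglongrightarrow> 0"
      using A by (simp add: set_lebesgue_integral_def)
    then have "eventually (\<lambda>n. (LINT r:A n|lebesgue. ?m r) < \<epsilon>\<^sup>2) sequentially"
      using e by (intro order_tendstoD(2)) auto
    then show ?thesis by (auto simp: eventually_sequentially)
  qed
  have "(\<Inter>n. {real n..}) = {}"
  proof -
    have "\<exists>n. \<not> real n \<le> x" for x :: real
      using reals_Archimedean2[of x] by (meson not_le)
    then show ?thesis by auto
  qed
  then obtain n where n: "(LINT r:{real n..}|lebesgue. ?m r) < \<epsilon>\<^sup>2"
    using tail[of "\<lambda>n. {real n..}"] by (auto simp: decseq_def)
  have "(\<Inter>n. {..- real n}) = {}"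
  proof -
    have "\<exists>n. \<not> x \<le> - real n" for x
    proof -
      obtain n where "- x < real n" using reals_Archimedean2 by blast
      then show ?thesis by (intro exI[of _ n]) simp
    qed
    then show ?thesis by auto
  qed
  then obtain k where k: "(LINT r:{..- real k}|lebesgue. ?m r) < \<epsilon>\<^sup>2"
    using tail[of "\<lambda>n. {..- real n}"] by (auto simp: decseq_def)
  have "norm (f s) < \<epsilon>" if s: "\<bar>s\<bar> \<ge> real n + real k" for s
  proof -
    have "\<exists>S\<in>sets lebesgue. (norm (f s))\<^sup>2 \<le> (LINT r:S|lebesgue. ?m r) \<and> (S \<subseteq> {real n..} \<or> S \<subseteq> {..-real k})"
    proof (cases "s \<ge> 0")
      case True
      then show ?thesis using s norm_sq_le_half_line_energy[OF P f g, of "{s..}" s]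
        by (intro bexI[of _ "{s..}"]) auto
    next
      case False
      then show ?thesis using s norm_sq_le_half_line_energy[OF P f g, of "{..s}" s]
        by (intro bexI[of _ "{..s}"]) auto
    qed
    then obtain S where S: "S \<in> sets lebesgue" "(norm (f s))\<^sup>2 \<le> (LINT r:S|lebesgue. ?m r)"
      "S \<subseteq> {real n..} \<or> S \<subseteq> {..-real k}" by blast
    have mono: "(LINT r:S|lebesgue. ?m r) \<le> (LINT r:B|lebesgue. ?m r)"
      if "S \<subseteq> B" "B \<in> sets lebesgue" for B
      unfolding set_lebesgue_integral_def
      using iS[OF S(1)] iS[OF that(2)] that
      by (intro integral_mono) (auto simp: set_integrable_def indicator_def)
    have "(norm (f s))\<^sup>2 < \<epsilon>\<^sup>2"
      using S(2,3) mono[of "{real n..}"] mono[of "{..-real k}"] n k by auto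
    then show ?thesis using e by (simp add: power2_less_imp_less)
  qed
  then show ?thesis by (rule that)
qed

section \<open>Translation invariance at infinity\<close>

text \<open>The value type is left free so that the predicate applies to \<phi>, to its lift to H2
  and to the operator valued derivatives of both. Invariance of the domain is part of the
  condition.\<close>

definition const_at_ends :: "real \<Rightarrow> (real \<times> 'a) set \<Rightarrow> (real \<times> 'a \<Rightarrow> 'c) \<Rightarrow> bool" where
  "const_at_ends T S f \<longleftrightarrow> (\<forall>s t x. (T \<le> s \<and> T \<le> t \<or> s \<le> -T \<and> t \<le> -T) \<longrightarrow> (s, x) \<in> S \<longrightarrow>
     (t, x) \<in> S \<and> f (s, x) = f (t, x))"

lemma const_at_ends_mono: "const_at_ends T S f \<Longrightarrow> T \<le> T' \<Longrightarrow> const_at_ends T' S f"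
  unfolding const_at_ends_def by (smt (verit))

text \<open>A time shift carries the derivative at \<open>(s, x)\<close> to the one at
  \<open>(t, x)\<close>. The strict increase from \<open>T\<close> to \<open>T'\<close> provides an
  open set around \<open>(t, x)\<close> on which \<open>f\<close> and its shift coincide.\<close>

lemma const_at_ends_fderiv:
  fixes f :: "real \<times> 'a::real_normed_vector \<Rightarrow> 'c::real_normed_vector"
  assumes f: "const_at_ends T S f" and S: "open S" and TT: "T < T'"
  shows "const_at_ends T' S (fderiv f)"
proof -
  have tr: "(f has_derivative D) (at (t, x))"
    if st: "T' \<le> s \<and> T' \<le> t \<or> s \<le> -T' \<and> t \<le> -T'" and sx: "(s, x) \<in> S"
      and D: "(f has_derivative D) (at (s, x))" for s t x D
  proof -
    define r where "r = t - s"
    have tx: "(t, x) \<in> S" using f st sx TT unfolding const_at_ends_def by (smt (verit))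
    define W where "W = S \<inter> (if T' \<le> s \<and> T' \<le> t then {p. T < fst p \<and> T < fst p - r} else {p. fst p < -T \<and> fst p - r < -T})"
    have W: "open W"
      unfolding W_def by (auto intro!: open_Int S open_Collect_conj open_Collect_less continuous_intros)
    have txW: "(t, x) \<in> W" using st tx TT by (auto simp: W_def r_def)
    have sh: "((\<lambda>p. p - (r, 0)) has_derivative (\<lambda>h. h)) (at (t, x))"
      by (auto intro!: derivative_eq_intros)
    have "((\<lambda>p. f (p - (r, 0))) has_derivative D) (at (t, x))"
      by (rule has_derivative_compose[OF sh]) (use D in \<open>simp add: r_def\<close>)
    then show ?thesis
    proof (rule has_derivative_transform_within_open[OF _ W txW])
      fix p assume "p \<in> W"
      then have c: "T \<le> fst p \<and> T \<le> fst p - r \<or> fst p \<le> -T \<and> fst p - r \<le> -T"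
        and pS: "(fst p, snd p) \<in> S" by (auto simp: W_def split: if_splits)
      show "f (p - (r, 0)) = f p"
        using f[unfolded const_at_ends_def, rule_format, OF c pS] by (cases p) simp
    qed
  qed
  show ?thesis
    unfolding const_at_ends_def
  proof (intro allI impI conjI)
    fix s t x assume st: "T' \<le> s \<and> T' \<le> t \<or> s \<le> -T' \<and> t \<le> -T'" and sx: "(s, x) \<in> S"
    then show tx: "(t, x) \<in> S" using f TT unfolding const_at_ends_def by (smt (verit))
    have "(f has_derivative D) (at (s, x)) \<longleftrightarrow> (f has_derivative D) (at (t, x))" for D
      using tr[OF st sx] tr[OF _ tx, of s] st by blast
    then show "fderiv f (s, x) = fderiv f (t, x)"
      by (simp add: fderiv_def frechet_derivative_def)
  qed
qed

text \<open>For \<open>S \<ge> 0\<close> the retraction of the time axis onto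
  \<open>[-S, S]\<close>: for maps constant at the ends, estimates over all times reduce to this
  compact interval.\<close>

definition clamp_to :: "real \<Rightarrow> real \<Rightarrow> real" where
  "clamp_to S s = max (- S) (min S s)"

lemma const_at_ends_clamp:
  assumes f: "const_at_ends T S f" and T: "0 \<le> T"
  shows "(clamp_to T s, x) \<in> S \<longleftrightarrow> (s, x) \<in> S" "(s, x) \<in> S \<Longrightarrow> f (clamp_to T s, x) = f (s, x)"
proof -
  have c: "clamp_to T s = s \<or> (T \<le> s \<and> T \<le> clamp_to T s) \<or> (s \<le> -T \<and> clamp_to T s \<le> -T)"
    using T by (auto simp: clamp_to_def)
  then show "(clamp_to T s, x) \<in> S \<longleftrightarrow> (s, x) \<in> S"
    using f unfolding const_at_ends_def by metis
  show "(s, x) \<in> S \<Longrightarrow> f (clamp_to T s, x) = f (s, x)"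
    using c f unfolding const_at_ends_def by metis
qed

text \<open>Since \<xi> decays, the clamped graph converges to \<open>(T, 0)\<close> and
  \<open>(-T, 0)\<close> at its two ends; adjoining these limits compactifies it.\<close>

lemma compact_clamped_graph:
  fixes \<xi> :: "real \<Rightarrow> 'a::real_normed_vector"
  assumes c: "continuous_on UNIV \<xi>" and T: "0 \<le> T"
    and decay: "\<And>\<epsilon>. \<epsilon> > 0 \<Longrightarrow> \<exists>R. \<forall>s. \<bar>s\<bar> \<ge> R \<longrightarrow> norm (\<xi> s) < \<epsilon>"
  shows "compact (insert (T, 0) (insert (-T, 0) (range (\<lambda>s. (clamp_to T s, \<xi> s)))))"
    (is "compact (insert ?p (insert ?q (range ?g)))")
proof (rule compactI)
  fix \<C> assume op: "\<forall>U\<in>\<C>. open U" and cov: "insert ?p (insert ?q (range ?g)) \<subseteq> \<Union>\<C>"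
  obtain U V where U: "U \<in> \<C>" "?p \<in> U" and V: "V \<in> \<C>" "?q \<in> V" using cov by auto
  obtain d1 where d1: "d1 > 0" "ball ?p d1 \<subseteq> U" using op U openE by blast
  obtain d2 where d2: "d2 > 0" "ball ?q d2 \<subseteq> V" using op V openE by blast
  obtain R where R: "\<And>s. \<bar>s\<bar> \<ge> R \<Longrightarrow> norm (\<xi> s) < min d1 d2" using decay[of "min d1 d2"] d1 d2 by auto
  define R' where "R' = max R T"
  have far: "?g s \<in> U \<union> V" if "\<bar>s\<bar> \<ge> R'" for s
  proof (cases "0 \<le> s")
    case True
    then have "clamp_to T s = T" using that T by (auto simp: clamp_to_def R'_def)
    then have "?g s \<in> ball ?p d1" using R[of s] that by (simp add: dist_Pair_Pair R'_def)
    then show ?thesis using d1 by auto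
  next
    case False
    then have "clamp_to T s = - T" using that T by (auto simp: clamp_to_def R'_def)
    then have "?g s \<in> ball ?q d2" using R[of s] that by (simp add: dist_Pair_Pair R'_def)
    then show ?thesis using d2 by auto
  qed
  have "continuous_on {-R'..R'} ?g"
    unfolding clamp_to_def by (intro continuous_intros continuous_on_subset[OF c]) auto
  then have "compact (?g ` {-R'..R'})" by (intro compact_continuous_image) auto
  then obtain F where F: "F \<subseteq> \<C>" "finite F" "?g ` {-R'..R'} \<subseteq> \<Union>F"
    using op cov by (elim compactE[where \<T>=\<C>]) auto
  have "insert ?p (insert ?q (range ?g)) \<subseteq> \<Union>(insert U (insert V F))"
  proof -
    have "?g s \<in> \<Union>(insert U (insert V F))" for s
    proof (cases "\<bar>s\<bar> \<ge> R'")
      case True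
      then show ?thesis using far[of s] by auto
    next
      case False
      then have "s \<in> {-R'..R'}" by auto
      then show ?thesis using F(3) by blast
    qed
    then show ?thesis using U V by auto
  qed
  then show "\<exists>F\<subseteq>\<C>. finite F \<and> insert ?p (insert ?q (range ?g)) \<subseteq> \<Union>F"
    using F U V by (intro exI[of _ "insert U (insert V F)"]) auto
qed

section \<open>Pointwise estimates for tame maps\<close>

locale tame_map =
  fixes \<iota> :: "'b::{real_inner, banach, second_countable_topology} \<Rightarrow>
              'a::{real_inner, banach, second_countable_topology}"
    and O1 :: "(real \<times> 'a) set" and \<phi> :: "real \<times> 'a \<Rightarrow> 'a" and T :: real
  assumes incl: "dense_inclusion \<iota>" and tame: "parametrized_tame \<iota> O1 \<phi>" and T: "T > 0"
    and asy: "const_at_ends T O1 \<phi>"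
    and zero: "\<And>s. \<bar>s\<bar> \<ge> T \<Longrightarrow> (s, 0) \<in> O1 \<and> \<phi> (s, 0) = 0"
begin

abbreviation "O2 \<equiv> level2 \<iota> O1"
definition \<phi>2 where "\<phi>2 = (\<lambda>(s, x). inv \<iota> (\<phi> (s, \<iota> x)))"
abbreviation "D1 \<equiv> fderiv \<phi>"
abbreviation "DD1 \<equiv> fderiv (fderiv \<phi>)"
abbreviation "D2 \<equiv> fderiv \<phi>2"
abbreviation "DD2 \<equiv> fderiv (fderiv \<phi>2)"
text \<open>Each differentiation costs a strict increase of the threshold beyond which time does not
  matter; one unit is spent on each of the two derivatives.\<close>

definition "T2 = T + 2"

lemma T2: "T2 > T" "0 \<le> T2" using T by (auto simp: T2_def)

lemma \<iota>: "linear \<iota>" "inj \<iota>" "closure (range \<iota>) = UNIV" "norm (\<iota> x) \<le> norm x"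
  using incl by (auto simp: dense_inclusion_def)

lemma \<iota>_simps: "\<iota> (x + y) = \<iota> x + \<iota> y" "\<iota> (x - y) = \<iota> x - \<iota> y" "\<iota> (c *\<^sub>R x) = c *\<^sub>R \<iota> x" "\<iota> 0 = 0"
  using \<iota>(1) by (auto simp: linear_add linear_diff linear_scale linear_0)

lemma bl_\<iota>: "bounded_linear \<iota>"
  by (rule bounded_linear_intro[of _ 1]) (simp_all add: \<iota>_simps \<iota>(4))

lemma inv_\<iota> [simp]: "inv \<iota> (\<iota> x) = x" using \<iota>(2) by simp

definition "j = (\<lambda>p. (fst p, \<iota> (snd p)))"

lemma bl_j: "bounded_linear j"
  unfolding j_def
  by (intro bounded_linear_Pair bounded_linear_fst bounded_linear_compose[OF bl_\<iota> bounded_linear_snd])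

lemma j_Pair [simp]: "j (s, x) = (s, \<iota> x)" by (simp add: j_def)

lemma in_O2_iff: "p \<in> O2 \<longleftrightarrow> j p \<in> O1" by (cases p) (simp add: level2_def)

lemma open_O1: "open O1" and C2_\<phi>: "C2_on O1 \<phi>"
  and range_\<phi>: "(s, x) \<in> O2 \<Longrightarrow> \<phi> (s, \<iota> x) \<in> range \<iota>"
  and C2_\<phi>2: "C2_on O2 \<phi>2"
  using tame by (auto simp: parametrized_tame_def \<phi>2_def)

lemma open_O2: "open O2"
proof -
  have "O2 = j -` O1" using in_O2_iff by auto
  then show ?thesis
    using open_O1 bl_j by (simp only: open_vimage[OF _ linear_continuous_on[OF bl_j]])
qed

lemmas D\<phi> = C2_onD[OF C2_\<phi>] and D\<phi>2 = C2_onD[OF C2_\<phi>2]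

section \<open>Compatibility of the derivatives on H1 and H2\<close>

lemma \<iota>_\<phi>2: "p \<in> O2 \<Longrightarrow> \<iota> (\<phi>2 p) = \<phi> (j p)"
  using range_\<phi>[of "fst p" "snd p"] by (cases p) (auto simp: \<phi>2_def f_inv_into_f)

text \<open>On the open set \<open>O2\<close> the compositions of \<iota> with \<phi>2 and of \<phi>
  with \<open>j\<close> are the same map; the formula compares their two derivatives.\<close>

lemma \<iota>_D2: assumes p: "p \<in> O2" shows "\<iota> (D2 p v) = D1 (j p) (j v)"
proof -
  have jp: "j p \<in> O1" using p in_O2_iff by simp
  have 1: "((\<lambda>q. \<iota> (\<phi>2 q)) has_derivative (\<lambda>v. \<iota> (D2 p v))) (at p)"
    by (rule bounded_linear.has_derivative[OF bl_\<iota> D\<phi>2(1)[OF p]])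
  have "((\<lambda>q. \<phi> (j q)) has_derivative (\<lambda>v. D1 (j p) (j v))) (at p)"
    by (rule has_derivative_compose[OF bounded_linear_imp_has_derivative[OF bl_j] D\<phi>(1)[OF jp]])
  then have "((\<lambda>q. \<iota> (\<phi>2 q)) has_derivative (\<lambda>v. D1 (j p) (j v))) (at p)"
    by (rule has_derivative_transform_within_open[OF _ open_O2 p]) (simp add: \<iota>_\<phi>2)
  from has_derivative_unique[OF 1 this] show ?thesis by meson
qed

lemma \<iota>_DD2: assumes p: "p \<in> O2" shows "\<iota> (DD2 p u v) = DD1 (j p) (j u) (j v)"
proof -
  have jp: "j p \<in> O1" using p in_O2_iff by simp
  have "((\<lambda>q. D2 q v) has_derivative (\<lambda>u. DD2 p u v)) (at p)"
    by (rule bounded_linear.has_derivative[OF blinfun.bounded_linear_left D\<phi>2(2)[OF p]])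
  then have 1: "((\<lambda>q. \<iota> (D2 q v)) has_derivative (\<lambda>u. \<iota> (DD2 p u v))) (at p)"
    by (rule bounded_linear.has_derivative[OF bl_\<iota>])
  have "((\<lambda>q. D1 (j q)) has_derivative (\<lambda>u. DD1 (j p) (j u))) (at p)"
    by (rule has_derivative_compose[OF bounded_linear_imp_has_derivative[OF bl_j] D\<phi>(2)[OF jp]])
  then have "((\<lambda>q. D1 (j q) (j v)) has_derivative (\<lambda>u. DD1 (j p) (j u) (j v))) (at p)"
    by (rule bounded_linear.has_derivative[OF blinfun.bounded_linear_left])
  then have "((\<lambda>q. \<iota> (D2 q v)) has_derivative (\<lambda>u. DD1 (j p) (j u) (j v))) (at p)"
    by (rule has_derivative_transform_within_open[OF _ open_O2 p]) (simp add: \<iota>_D2)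
  from has_derivative_unique[OF 1 this] show ?thesis by meson
qed

lemma DD1_sym: "p \<in> O1 \<Longrightarrow> DD1 p u v = DD1 p v u"
  by (rule second_derivative_symmetric[OF open_O1 _ C2_\<phi>])

lemma D_slice:
  fixes F :: "real \<times> 'c::real_normed_vector \<Rightarrow> 'd::real_normed_vector"
  assumes "(F has_derivative F') (at (t, x))"
  shows "((\<lambda>y. F (t, y)) has_derivative (\<lambda>h. F' (0, h))) (at x)"
proof -
  have "((\<lambda>y. (t, y)) has_derivative (\<lambda>h. (0, h))) (at x)" by (auto intro!: derivative_eq_intros)
  from has_derivative_compose[OF this assms] show ?thesis .
qed

lemma frechet_slice: "(s, x) \<in> O1 \<Longrightarrow> frechet_derivative (\<lambda>x. \<phi> (s, x)) (at x) v = D1 (s, x) (0, v)"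
  using frechet_derivative_at[OF D_slice[OF D\<phi>(1)], of s x] by metis

text \<open>The tame condition speaks of second derivatives of slices, the estimates below of the
  total second derivative on vectors without time component; this is the translation.\<close>

lemma fderiv2_slice:
  assumes p: "(t, x) \<in> O1"
  shows "fderiv2 (\<lambda>x. \<phi> (t, x)) x u v = DD1 (t, x) (0, u) (0, v)"
proof -
  define inr :: "'a \<Rightarrow>\<^sub>L (real \<times> 'a)" where "inr = Blinfun (\<lambda>h. (0, h))"
  have inr: "blinfun_apply inr = (\<lambda>h. (0, h))"
    unfolding inr_def
    by (intro bounded_linear_Blinfun_apply bounded_linear_Pair bounded_linear_zero bounded_linear_ident)
  have f1: "fderiv (\<lambda>x. \<phi> (t, x)) y = D1 (t, y) o\<^sub>L inr" if "(t, y) \<in> O1" for y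
    by (rule blinfun_eqI) (simp add: fderiv_eqI[OF D_slice[OF D\<phi>(1)[OF that]]] inr)
  have op: "open {y. (t, y) \<in> O1}"
    using open_vimage[OF open_O1, of "\<lambda>y. (t, y)"] by (simp add: continuous_intros vimage_def)
  have "((\<lambda>y. D1 (t, y) o\<^sub>L inr) has_derivative (\<lambda>h. DD1 (t, x) (0, h) o\<^sub>L inr)) (at x)"
    by (rule bounded_linear.has_derivative[OF bounded_bilinear.bounded_linear_left[OF bounded_bilinear_blinfun_compose]
          D_slice[OF D\<phi>(2)[OF p]]])
  then have "(fderiv (\<lambda>x. \<phi> (t, x)) has_derivative (\<lambda>h. DD1 (t, x) (0, h) o\<^sub>L inr)) (at x)"
    by (rule has_derivative_transform_within_open[OF _ op]) (use p f1 in auto)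
  from fderiv_eqI[OF this] show ?thesis by (simp add: fderiv2_def inr)
qed

section \<open>Behaviour at large times\<close>

lemma asy_all: "const_at_ends T2 O1 \<phi>" "const_at_ends T2 O1 D1" "const_at_ends T2 O1 DD1"
  "const_at_ends T2 O2 \<phi>2" "const_at_ends T2 O2 D2" "const_at_ends T2 O2 DD2"
proof -
  have a2: "const_at_ends T O2 \<phi>2"
    unfolding const_at_ends_def
  proof (intro allI impI)
    fix s t x assume c: "T \<le> s \<and> T \<le> t \<or> s \<le> -T \<and> t \<le> -T" and "(s, x) \<in> O2"
    then have "(s, \<iota> x) \<in> O1" by (simp add: level2_def)
    from asy[unfolded const_at_ends_def, rule_format, OF c this]
    show "(t, x) \<in> O2 \<and> \<phi>2 (s, x) = \<phi>2 (t, x)" by (simp add: level2_def \<phi>2_def)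
  qed
  have b: "const_at_ends (T + 1) O1 D1" "const_at_ends (T + 1) O2 D2"
    by (simp_all add: const_at_ends_fderiv[OF asy open_O1] const_at_ends_fderiv[OF a2 open_O2])
  show "const_at_ends T2 O1 DD1" "const_at_ends T2 O2 DD2"
    by (simp_all add: const_at_ends_fderiv[OF b(1) open_O1] const_at_ends_fderiv[OF b(2) open_O2] T2_def)
  show "const_at_ends T2 O1 \<phi>" "const_at_ends T2 O1 D1" "const_at_ends T2 O2 \<phi>2" "const_at_ends T2 O2 D2"
    using const_at_ends_mono[OF asy] const_at_ends_mono[OF a2] const_at_ends_mono[OF b(1)]
      const_at_ends_mono[OF b(2)] by (simp_all add: T2_def)
qed

text \<open>Beyond \<open>T\<close> the map is locally constant in time. Along a path the
  inhomogeneous term \<open>D1 (s, x s) (1, 0)\<close> therefore vanishes outside a bounded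
  interval, which makes it square integrable.\<close>

lemma D1_time_zero: assumes s: "\<bar>s\<bar> > T" and sx: "(s, x) \<in> O1" shows "D1 (s, x) (r, 0) = 0"
proof -
  define W where "W = (if 0 \<le> s then {T<..} else {..<-T})"
  have W: "open W" "s \<in> W" using s T by (auto simp: W_def)
  have "((\<lambda>t. \<phi> (s, x)) has_derivative (\<lambda>h. 0)) (at s)" by simp
  then have 0: "((\<lambda>t. \<phi> (t, x)) has_derivative (\<lambda>h. 0)) (at s)"
  proof (rule has_derivative_transform_within_open[OF _ W])
    fix t assume "t \<in> W"
    then have "T \<le> s \<and> T \<le> t \<or> s \<le> -T \<and> t \<le> -T" using s by (auto simp: W_def split: if_splits)
    then show "\<phi> (s, x) = \<phi> (t, x)" using asy sx unfolding const_at_ends_def by blast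
  qed
  have "((\<lambda>t. (t, x)) has_derivative (\<lambda>h. (h, 0))) (at s)" by (auto intro!: derivative_eq_intros)
  from has_derivative_compose[OF this D\<phi>(1)[OF sx]] have "((\<lambda>t. \<phi> (t, x)) has_derivative (\<lambda>h. D1 (s, x) (h, 0))) (at s)" .
  from fun_cong[OF has_derivative_unique[OF 0 this], of r] show ?thesis by simp
qed

text \<open>The tame condition together with its integrated forms for the first derivative and for
  the map itself. A point has at most one lift \<open>y\<close>, and the condition is void outside
  \<open>range \<iota>\<close>, so that it can be asserted on open sets of H1 points.\<close>

definition tame_bound :: "real \<Rightarrow> real \<times> 'a \<Rightarrow> bool" where
  "tame_bound C p \<longleftrightarrow> (\<forall>y. \<iota> y = snd p \<longrightarrow> (fst p, y) \<in> O2 \<and>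
     norm (\<phi>2 (fst p, y)) \<le> C * (1 + norm y) \<and>
     (\<forall>v. norm (D2 (fst p, y) (0, v)) \<le> C * (norm v + norm y * norm (\<iota> v))) \<and>
     (\<forall>u v. norm (DD2 (fst p, y) (0, u) (0, v))
        \<le> C * (norm (\<iota> u) * norm v + norm u * norm (\<iota> v) + norm y * norm (\<iota> u) * norm (\<iota> v))))"

lemma tame_bound_mono:
  assumes b: "tame_bound C p" and C: "C \<le> C'"
  shows "tame_bound C' p"
  unfolding tame_bound_def
proof (intro allI impI conjI)
  fix y u v assume "\<iota> y = snd p"
  note * = b[unfolded tame_bound_def, rule_format, OF this]
  show "(fst p, y) \<in> O2" using * by blast
  show "norm (\<phi>2 (fst p, y)) \<le> C' * (1 + norm y)"
    by (rule order_trans[OF *[THEN conjunct2, THEN conjunct1] mult_right_mono[OF C]]) simp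
  show "norm (D2 (fst p, y) (0, v)) \<le> C' * (norm v + norm y * norm (\<iota> v))"
    by (rule order_trans[OF *[THEN conjunct2, THEN conjunct2, THEN conjunct1, rule_format] mult_right_mono[OF C]]) simp
  show "norm (DD2 (fst p, y) (0, u) (0, v))
      \<le> C' * (norm (\<iota> u) * norm v + norm u * norm (\<iota> v) + norm y * norm (\<iota> u) * norm (\<iota> v))"
    by (rule order_trans[OF *[THEN conjunct2, THEN conjunct2, THEN conjunct2, rule_format] mult_right_mono[OF C]]) simp
qed

text \<open>
  Integrating the tame bound along segments in \<open>H\<^sub>2\<close> that start at a fixed point of \<open>H\<^sub>2\<close> close to \<open>p\<close>,
  which exists by density of \<open>H\<^sub>2\<close>.
\<close>

lemma tame_bound_local:
  assumes p: "p \<in> O1"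
  shows "\<exists>W C. open W \<and> p \<in> W \<and> (\<forall>q\<in>W. tame_bound C q)"
proof -
  obtain s0 x0 where p0: "p = (s0, x0)" by fastforce
  obtain W \<kappa> where W: "open W" "p \<in> W" "W \<subseteq> O1" and \<kappa>: "\<kappa> > 0"
    and est: "\<And>t y \<xi> \<eta>. (t, y) \<in> level2 \<iota> W \<Longrightarrow>
           norm (inv \<iota> (fderiv2 (\<lambda>x. \<phi> (t, x)) (\<iota> y) (\<iota> \<xi>) (\<iota> \<eta>)))
             \<le> \<kappa> * (norm (\<iota> \<xi>) * norm \<eta> + norm \<xi> * norm (\<iota> \<eta>)
                      + norm y * norm (\<iota> \<xi>) * norm (\<iota> \<eta>))"
    using tame p unfolding parametrized_tame_def by (smt (verit) case_prodD)
  have DD: "norm (DD2 (t, y) (0, u) (0, v))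
      \<le> \<kappa> * (norm (\<iota> u) * norm v + norm u * norm (\<iota> v) + norm y * norm (\<iota> u) * norm (\<iota> v))"
    if ty: "(t, \<iota> y) \<in> W" for t y u v
  proof -
    have O: "(t, y) \<in> O2" "(t, \<iota> y) \<in> O1" using ty W(3) by (auto simp: level2_def)
    have "fderiv2 (\<lambda>x. \<phi> (t, x)) (\<iota> y) (\<iota> u) (\<iota> v) = \<iota> (DD2 (t, y) (0, u) (0, v))"
      using \<iota>_DD2[OF O(1)] fderiv2_slice[OF O(2)] by simp
    then show ?thesis using est[of t y u v] ty by (simp add: level2_def)
  qed
  obtain A B where AB: "open A" "open B" "s0 \<in> A" "x0 \<in> B" "A \<times> B \<subseteq> W"
    using W p0 by (metis open_prod_elim mem_Sigma_iff)
  obtain r where r: "r > 0" "ball x0 r \<subseteq> B" using AB openE by blast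
  obtain xb where xb: "\<iota> xb \<in> ball x0 r"
    using \<iota>(3) r(1) closure_approachable[of x0 "range \<iota>"] by (force simp: dist_commute)
  have "(s0, \<iota> xb) \<in> A \<times> B" using xb r AB by blast
  then have sxb: "(s0, xb) \<in> O2" using AB W by (auto simp: level2_def)
  \<comment> \<open>Continuity at the single point \<open>(s0, xb)\<close> bounds \<phi>2 and its
    derivative at \<open>(t, xb)\<close> for times near \<open>s0\<close>; the allowed oscillation 1
    becomes the last summand of \<open>M\<close>.\<close>
  obtain d1 where d1: "d1 > 0" "\<And>q. q \<in> O2 \<Longrightarrow> dist q (s0, xb) < d1 \<Longrightarrow> dist (\<phi>2 q) (\<phi>2 (s0, xb)) < 1"
    using D\<phi>2(3) sxb unfolding continuous_on_iff by (meson zero_less_one)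
  obtain d2 where d2: "d2 > 0" "\<And>q. q \<in> O2 \<Longrightarrow> dist q (s0, xb) < d2 \<Longrightarrow> dist (D2 q) (D2 (s0, xb)) < 1"
    using D\<phi>2(4) sxb unfolding continuous_on_iff by (meson zero_less_one)
  define M where "M = norm (\<phi>2 (s0, xb)) + norm (D2 (s0, xb)) + 1"
  define A' where "A' = A \<inter> ball s0 (min d1 d2)"
  have M0: "M \<ge> 0" by (simp add: M_def)
  have inO: "(t, y) \<in> O2" and inW: "(t, \<iota> y) \<in> W" if "t \<in> A'" "\<iota> y \<in> ball x0 r" for t y
  proof -
    have "(t, \<iota> y) \<in> A \<times> B" using that r(2) by (auto simp: A'_def)
    then show "(t, \<iota> y) \<in> W" using AB(5) by blast
    then show "(t, y) \<in> O2" using W(3) by (auto simp: level2_def)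
  qed
  have M: "norm (\<phi>2 (t, xb)) \<le> M" "norm (D2 (t, xb)) \<le> M" if t: "t \<in> A'" for t
  proof -
    have d: "dist (t, xb) (s0, xb) < d1" "dist (t, xb) (s0, xb) < d2"
      using t by (auto simp: A'_def dist_Pair_Pair dist_commute)
    have "dist (\<phi>2 (t, xb)) (\<phi>2 (s0, xb)) < 1" by (rule d1(2)[OF inO[OF t xb] d(1)])
    then show "norm (\<phi>2 (t, xb)) \<le> M"
      using norm_triangle_sub[of "\<phi>2 (t, xb)" "\<phi>2 (s0, xb)"] norm_ge_zero[of "D2 (s0, xb)"]
      unfolding M_def dist_norm by linarith
    have "dist (D2 (t, xb)) (D2 (s0, xb)) < 1" by (rule d2(2)[OF inO[OF t xb] d(2)])
    then show "norm (D2 (t, xb)) \<le> M"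
      using norm_triangle_sub[of "D2 (t, xb)" "D2 (s0, xb)"] norm_ge_zero[of "\<phi>2 (s0, xb)"]
      unfolding M_def dist_norm by linarith
  qed
  \<comment> \<open>By convexity the segment from \<open>xb\<close> to \<open>y\<close> stays in the
    H1 ball, where the tame estimate holds, however long it is in H2.\<close>
  have seg: "\<iota> (xb + \<tau> *\<^sub>R (y - xb)) \<in> ball x0 r" "norm (xb + \<tau> *\<^sub>R (y - xb)) \<le> norm xb + norm y"
    if "\<iota> y \<in> ball x0 r" "0 \<le> \<tau>" "\<tau> \<le> 1" for y \<tau>
  proof -
    have e: "xb + \<tau> *\<^sub>R (y - xb) = (1 - \<tau>) *\<^sub>R xb + \<tau> *\<^sub>R y" by (simp add: algebra_simps)
    show "\<iota> (xb + \<tau> *\<^sub>R (y - xb)) \<in> ball x0 r"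
      unfolding e \<iota>_simps using convexD[OF convex_ball xb that(1), of "1 - \<tau>" \<tau>] that by simp
    have "norm (xb + \<tau> *\<^sub>R (y - xb)) \<le> norm ((1 - \<tau>) *\<^sub>R xb) + norm (\<tau> *\<^sub>R y)"
      unfolding e by (rule norm_triangle_ineq)
    also have "\<dots> \<le> norm xb + norm y"
      using that by (intro add_mono) (auto simp: mult_left_le_one_le)
    finally show "norm (xb + \<tau> *\<^sub>R (y - xb)) \<le> norm xb + norm y" .
  qed
  have diam: "norm (\<iota> (y - xb)) \<le> 2 * r" if "\<iota> y \<in> ball x0 r" for y
    using that xb dist_triangle_less_add[of "\<iota> y" x0 r "\<iota> xb" r] unfolding \<iota>_simps
    by (auto simp: dist_norm[symmetric] dist_commute)
  \<comment> \<open>The first two summands collect the coefficients of \<open>norm v\<close>, the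
    last is that of \<open>norm y * norm (\<iota> v)\<close>; \<open>2 * r\<close> bounds the H1
    length of the segment.\<close>
  define C1 where "C1 = M + \<kappa> * (2 * r + norm xb + 2 * r * norm xb) + \<kappa> * (1 + 2 * r)"
  have C1_ge: "M + \<kappa> * (2 * r + norm xb + 2 * r * norm xb) \<le> C1" "\<kappa> * (1 + 2 * r) \<le> C1" "0 \<le> C1"
    using \<kappa> r M0 by (auto simp: C1_def)
  have T1: "norm (D2 (t, y) (0, v)) \<le> C1 * (norm v + norm y * norm (\<iota> v))"
    if t: "t \<in> A'" and y: "\<iota> y \<in> ball x0 r" for t y v
  proof -
    have "norm (D2 (t, xb + (y - xb)) (0, v) - D2 (t, xb) (0, v))
      \<le> \<kappa> * (2 * r * norm v + (norm xb + norm y) * norm (\<iota> v) + (norm xb + norm y) * (2 * r) * norm (\<iota> v))"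
    proof (rule segment_bound[where f="\<lambda>z. D2 (t, z) (0, v)"])
      fix \<tau> :: real assume \<tau>: "0 \<le> \<tau>" "\<tau> \<le> 1"
      let ?z = "xb + \<tau> *\<^sub>R (y - xb)"
      note z = seg[OF y \<tau>]
      have "((\<lambda>q. D2 q (0, v)) has_derivative (\<lambda>u. DD2 (t, ?z) u (0, v))) (at (t, ?z))"
        by (rule bounded_linear.has_derivative[OF blinfun.bounded_linear_left D\<phi>2(2)[OF inO[OF t z(1)]]])
      from D_slice[OF this]
      show "((\<lambda>z. D2 (t, z) (0, v)) has_derivative (\<lambda>h. DD2 (t, ?z) (0, h) (0, v))) (at ?z)" .
      have yx: "norm (y - xb) \<le> norm xb + norm y" using norm_triangle_ineq4[of y xb] by simp
      have "norm (DD2 (t, ?z) (0, y - xb) (0, v)) \<le> \<kappa> * (norm (\<iota> (y - xb)) * norm v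
          + norm (y - xb) * norm (\<iota> v) + norm ?z * norm (\<iota> (y - xb)) * norm (\<iota> v))"
        by (rule DD[OF inW[OF t z(1)]])
      also have "\<dots> \<le> \<kappa> * (2 * r * norm v + (norm xb + norm y) * norm (\<iota> v) + (norm xb + norm y) * (2 * r) * norm (\<iota> v))"
        using \<kappa> r(1) diam[OF y] z(2) yx by (intro mult_left_mono add_mono mult_mono) auto
      finally show "norm (DD2 (t, ?z) (0, y - xb) (0, v)) \<le> \<dots>" .
    qed
    moreover have "norm (D2 (t, xb) (0, v)) \<le> M * norm v"
      using norm_blinfun[of "D2 (t, xb)" "(0, v)"] mult_right_mono[OF M(2)[OF t], of "norm v"]
      by (simp add: norm_Pair)
    ultimately have "norm (D2 (t, y) (0, v)) \<le> M * norm v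
        + \<kappa> * (2 * r * norm v + (norm xb + norm y) * norm (\<iota> v) + (norm xb + norm y) * (2 * r) * norm (\<iota> v))"
      using norm_triangle_sub[of "D2 (t, y) (0, v)" "D2 (t, xb) (0, v)"] by simp
    also have "\<dots> = M * norm v + \<kappa> * (2 * r) * norm v + \<kappa> * (norm xb + 2 * r * norm xb) * norm (\<iota> v)
        + \<kappa> * (1 + 2 * r) * (norm y * norm (\<iota> v))" by (simp add: algebra_simps)
    \<comment> \<open>The terms with \<open>norm xb\<close> carry \<open>norm (\<iota> v)\<close>
      but no factor \<open>norm y\<close>; they are absorbed into multiples of
      \<open>norm v\<close>.\<close>
    also have "\<dots> \<le> M * norm v + \<kappa> * (2 * r) * norm v + \<kappa> * (norm xb + 2 * r * norm xb) * norm v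
        + \<kappa> * (1 + 2 * r) * (norm y * norm (\<iota> v))"
      using \<kappa> r M0 \<iota>(4)[of v] by (intro add_mono mult_left_mono order_refl) auto
    also have "\<dots> = (M + \<kappa> * (2 * r + norm xb + 2 * r * norm xb)) * norm v
        + \<kappa> * (1 + 2 * r) * (norm y * norm (\<iota> v))" by (simp add: algebra_simps)
    also have "\<dots> \<le> C1 * norm v + C1 * (norm y * norm (\<iota> v))"
      using C1_ge by (intro add_mono mult_right_mono) auto
    finally show ?thesis by (simp add: algebra_simps)
  qed
  \<comment> \<open>From a second integration along the same segment, now of the bound just proved;
    \<open>1 + norm xb\<close> turns \<open>norm xb + norm y\<close> into a multiple of
    \<open>1 + norm y\<close>.\<close>
  define C0 where "C0 = M + C1 * (1 + 2 * r) * (1 + norm xb)"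
  have T0: "norm (\<phi>2 (t, y)) \<le> C0 * (1 + norm y)"
    if t: "t \<in> A'" and y: "\<iota> y \<in> ball x0 r" for t y
  proof -
    have "norm (\<phi>2 (t, xb + (y - xb)) - \<phi>2 (t, xb)) \<le> C1 * ((norm xb + norm y) + (norm xb + norm y) * (2 * r))"
    proof (rule segment_bound[where f="\<lambda>z. \<phi>2 (t, z)"])
      fix \<tau> :: real assume \<tau>: "0 \<le> \<tau>" "\<tau> \<le> 1"
      let ?z = "xb + \<tau> *\<^sub>R (y - xb)"
      note z = seg[OF y \<tau>]
      show "((\<lambda>z. \<phi>2 (t, z)) has_derivative (\<lambda>h. D2 (t, ?z) (0, h))) (at ?z)"
        by (rule D_slice[OF D\<phi>2(1)[OF inO[OF t z(1)]]])
      have yx: "norm (y - xb) \<le> norm xb + norm y" using norm_triangle_ineq4[of y xb] by simp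
      have "norm (D2 (t, ?z) (0, y - xb)) \<le> C1 * (norm (y - xb) + norm ?z * norm (\<iota> (y - xb)))"
        by (rule T1[OF t z(1)])
      also have "\<dots> \<le> C1 * ((norm xb + norm y) + (norm xb + norm y) * (2 * r))"
        using C1_ge r(1) diam[OF y] z(2) yx by (intro mult_left_mono add_mono mult_mono) auto
      finally show "norm (D2 (t, ?z) (0, y - xb)) \<le> \<dots>" .
    qed
    then have "norm (\<phi>2 (t, y)) \<le> M + C1 * (1 + 2 * r) * (norm xb + norm y)"
      using norm_triangle_sub[of "\<phi>2 (t, y)" "\<phi>2 (t, xb)"] M(1)[OF t] by (simp add: algebra_simps)
    also have "\<dots> \<le> M * (1 + norm y) + C1 * (1 + 2 * r) * ((1 + norm xb) * (1 + norm y))"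
      using M0 C1_ge r by (intro add_mono mult_left_mono) (auto simp: algebra_simps mult_nonneg_nonneg)
    finally show ?thesis by (simp add: C0_def algebra_simps)
  qed
  have C0: "C0 \<ge> 0" using M0 C1_ge r by (auto simp: C0_def)
  define C where "C = \<kappa> + C1 + C0"
  have "tame_bound C q" if q: "q \<in> A' \<times> ball x0 r" for q
    unfolding tame_bound_def
  proof (intro allI impI conjI)
    fix y assume y: "\<iota> y = snd q"
    note t = mem_Times_iff[THEN iffD1, OF q, THEN conjunct1]
    have yb: "\<iota> y \<in> ball x0 r" using y q by auto
    show "(fst q, y) \<in> O2" by (rule inO[OF t yb])
    show "norm (\<phi>2 (fst q, y)) \<le> C * (1 + norm y)"
      by (rule order_trans[OF T0[OF t yb]], rule mult_right_mono) (use \<kappa> C1_ge in \<open>auto simp: C_def\<close>)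
    show "norm (D2 (fst q, y) (0, v)) \<le> C * (norm v + norm y * norm (\<iota> v))" for v
      by (rule order_trans[OF T1[OF t yb]], rule mult_right_mono) (use \<kappa> C0 in \<open>auto simp: C_def\<close>)
    show "norm (DD2 (fst q, y) (0, u) (0, v))
        \<le> C * (norm (\<iota> u) * norm v + norm u * norm (\<iota> v) + norm y * norm (\<iota> u) * norm (\<iota> v))" for u v
      by (rule order_trans[OF DD[OF inW[OF t yb]]], rule mult_right_mono) (use C1_ge C0 in \<open>auto simp: C_def\<close>)
  qed
  moreover have "open (A' \<times> ball x0 r)" by (intro open_Times) (auto simp: A'_def AB)
  moreover have "p \<in> A' \<times> ball x0 r" using r d1 d2 AB by (auto simp: A'_def p0)
  ultimately show ?thesis by blast
qed

text \<open>Isolates what the compactness argument uses of a path. Only H1 data enter: they make the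
  clamped graph relatively compact in the product with H1, whereas nothing comparable holds in H2 in
  general.\<close>

definition admissible :: "(real \<Rightarrow> 'a) \<Rightarrow> bool" where
  "admissible \<xi> \<longleftrightarrow> continuous_on UNIV \<xi> \<and> (\<forall>s. (s, \<xi> s) \<in> O1) \<and>
     (\<forall>\<epsilon>>0. \<exists>R. \<forall>s. \<bar>s\<bar> \<ge> R \<longrightarrow> norm (\<xi> s) < \<epsilon>)"

definition "path_hull \<xi> = insert (T2, 0) (insert (-T2, 0) (range (\<lambda>s. (clamp_to T2 s, \<xi> s))))"

lemma path_hull:
  assumes "admissible \<xi>"
  shows "compact (path_hull \<xi>)" "path_hull \<xi> \<subseteq> O1" "(clamp_to T2 s, \<xi> s) \<in> path_hull \<xi>"
proof -
  show "compact (path_hull \<xi>)"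
    unfolding path_hull_def
    by (rule compact_clamped_graph) (use assms T2 in \<open>auto simp: admissible_def\<close>)
  show "path_hull \<xi> \<subseteq> O1"
    using assms T2 T zero[of T2] zero[of "-T2"] const_at_ends_clamp(1)[OF asy_all(1) T2(2)]
    by (auto simp: path_hull_def admissible_def)
qed (simp add: path_hull_def)

text \<open>Clamping puts \<open>(s, \<xi> s)\<close> and \<open>(s, z)\<close> at a common time
  without changing their distance; the estimate near the compact hull is then carried back to time
  \<open>s\<close> by constancy at the ends.\<close>

lemma uniform_tube:
  assumes \<xi>: "admissible \<xi>" and e: "\<epsilon> > 0"
  obtains d where "d > 0" "\<And>s z. norm (z - \<xi> s) < d \<Longrightarrow>
    (s, z) \<in> O1 \<and> norm (DD1 (s, z) - DD1 (s, \<xi> s)) < \<epsilon>"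
proof -
  obtain d where d: "d > 0" "\<And>k q. k \<in> path_hull \<xi> \<Longrightarrow> dist k q < d \<Longrightarrow> q \<in> O1 \<and> dist (DD1 q) (DD1 k) < \<epsilon>"
    using compact_uniform_continuity[OF path_hull(1)[OF \<xi>] open_O1 path_hull(2)[OF \<xi>] D\<phi>(5) e] by blast
  note cl = const_at_ends_clamp[OF asy_all(3) T2(2)]
  show ?thesis
  proof (rule that[OF d(1)])
    fix s z assume "norm (z - \<xi> s) < d"
    then have "dist (clamp_to T2 s, \<xi> s) (clamp_to T2 s, z) < d"
      by (simp add: dist_Pair_Pair dist_norm norm_minus_commute)
    from d(2)[OF path_hull(3)[OF \<xi>] this] show "(s, z) \<in> O1 \<and> norm (DD1 (s, z) - DD1 (s, \<xi> s)) < \<epsilon>"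
      using cl(1)[of s z] cl(2)[of s z] cl(2)[of s "\<xi> s"] \<xi> by (simp add: admissible_def dist_norm)
  qed
qed

lemma path_derivs_bounded:
  assumes \<xi>: "admissible \<xi>"
  obtains C where "C \<ge> 0" "\<And>s. norm (D1 (s, \<xi> s)) \<le> C" "\<And>s. norm (DD1 (s, \<xi> s)) \<le> C"
proof -
  note h = path_hull[OF \<xi>]
  have "bounded (D1 ` path_hull \<xi>)" "bounded (DD1 ` path_hull \<xi>)"
    by (intro compact_imp_bounded compact_continuous_image h continuous_on_subset[OF D\<phi>(4)]
        continuous_on_subset[OF D\<phi>(5)])+
  then obtain a b where a: "\<And>k. k \<in> path_hull \<xi> \<Longrightarrow> norm (D1 k) \<le> a" and b: "\<And>k. k \<in> path_hull \<xi> \<Longrightarrow> norm (DD1 k) \<le> b"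
    unfolding bounded_iff by (metis imageI)
  have in1: "(s, \<xi> s) \<in> O1" for s using \<xi> by (simp add: admissible_def)
  show ?thesis
    by (rule that[of "max 0 (max a b)"])
      (use a[OF h(3)] b[OF h(3)] const_at_ends_clamp(2)[OF asy_all(2) T2(2) in1]
        const_at_ends_clamp(2)[OF asy_all(3) T2(2) in1] in \<open>auto simp: le_max_iff_disj\<close>)
qed

text \<open>Local bounds with varying constants are merged over the compact hull by monotonicity of
  \<open>tame_bound\<close>, then moved from clamped to actual times.\<close>

lemma tame_tube:
  assumes \<xi>: "admissible \<xi>"
  obtains d C where "d > 0" "C \<ge> 0" "\<And>s z. norm (z - \<xi> s) < d \<Longrightarrow> tame_bound C (s, z)"
proof -
  have loc: "\<exists>W C. open W \<and> p \<in> W \<and> (\<forall>q\<in>W. tame_bound C q)" if "p \<in> path_hull \<xi>" for p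
    using tame_bound_local path_hull(2)[OF \<xi>] that by blast
  have "\<exists>d>0. \<exists>C. \<forall>k q. k \<in> path_hull \<xi> \<longrightarrow> dist k q < d \<longrightarrow> tame_bound C q"
  proof (rule compact_uniform_nhd[OF path_hull(1)[OF \<xi>], where P=tame_bound])
    show "\<exists>W C. open W \<and> p \<in> W \<and> (\<forall>q\<in>W. tame_bound C q)" if "p \<in> path_hull \<xi>" for p
      by (rule loc[OF that])
    show "tame_bound C' q" if "tame_bound C q" "C \<le> C'" for C C' q
      by (rule tame_bound_mono[OF that])
  qed blast
  then obtain d C where d: "d > 0" "\<And>k q. k \<in> path_hull \<xi> \<Longrightarrow> dist k q < d \<Longrightarrow> tame_bound C q"
    by blast
  show ?thesis
  proof (rule that[OF d(1), of "max 0 C"])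
    fix s z assume "norm (z - \<xi> s) < d"
    then have "dist (clamp_to T2 s, \<xi> s) (clamp_to T2 s, z) < d"
      by (simp add: dist_Pair_Pair dist_norm norm_minus_commute)
    then have "tame_bound C (clamp_to T2 s, z)" by (rule d(2)[OF path_hull(3)[OF \<xi>]])
    then have "tame_bound (max 0 C) (clamp_to T2 s, z)" by (rule tame_bound_mono) simp
    note tb = this[unfolded tame_bound_def fst_conv snd_conv]
    show "tame_bound (max 0 C) (s, z)"
      unfolding tame_bound_def fst_conv snd_conv
    proof (rule allI, rule impI)
      fix y assume y: "\<iota> y = z"
      have sy: "(s, y) \<in> O2"
        using tb[rule_format, OF y] const_at_ends_clamp(1)[OF asy_all(4) T2(2)] by blast
      note eqs = const_at_ends_clamp(2)[OF asy_all(4) T2(2) sy] const_at_ends_clamp(2)[OF asy_all(5) T2(2) sy]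
        const_at_ends_clamp(2)[OF asy_all(6) T2(2) sy]
      show "(s, y) \<in> O2 \<and> norm (\<phi>2 (s, y)) \<le> max 0 C * (1 + norm y) \<and>
         (\<forall>v. norm (D2 (s, y) (0, v)) \<le> max 0 C * (norm v + norm y * norm (\<iota> v))) \<and>
         (\<forall>u v. norm (DD2 (s, y) (0, u) (0, v))
            \<le> max 0 C * (norm (\<iota> u) * norm v + norm u * norm (\<iota> v) + norm y * norm (\<iota> u) * norm (\<iota> v)))"
        using spec[OF tb, of y] y sy unfolding eqs by blast
    qed
  qed simp
qed

lemma tame_boundD:
  assumes "tame_bound C (s, \<iota> y)"
  shows "(s, y) \<in> O2" "norm (\<phi>2 (s, y)) \<le> C * (1 + norm y)"
    "norm (D2 (s, y) (0, v)) \<le> C * (norm v + norm y * norm (\<iota> v))"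
    "norm (DD2 (s, y) (0, u) (0, v))
        \<le> C * (norm (\<iota> u) * norm v + norm u * norm (\<iota> v) + norm y * norm (\<iota> u) * norm (\<iota> v))"
  using assms by (auto simp: tame_bound_def)

text \<open>The bound \<open>C * (1 + norm y)\<close> is not square integrable along a path. For
  large \<open>\<bar>s\<bar>\<close> the segment from 0 to the lift lies in the tube and
  \<open>\<phi>2 (s, 0) = 0\<close>, which removes the constant; on the remaining bounded interval
  the constant is harmless.\<close>

lemma \<phi>2_growth:
  assumes \<xi>: "admissible \<xi>"
  obtains C R where "C \<ge> 0" "\<And>s y. \<iota> y = \<xi> s \<Longrightarrow> norm (\<phi>2 (s, y)) \<le> C * (indicator {-R..R} s + norm y)"
proof -
  obtain d C where d: "d > 0" "C \<ge> 0" and tb: "\<And>s z. norm (z - \<xi> s) < d \<Longrightarrow> tame_bound C (s, z)"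
    using tame_tube[OF \<xi>] by blast
  obtain R0 where R0: "\<And>s. \<bar>s\<bar> \<ge> R0 \<Longrightarrow> norm (\<xi> s) < d"
    using \<xi> d unfolding admissible_def by blast
  define R where "R = max R0 T"
  show ?thesis
  proof (rule that[of "C * (1 + d)" R])
    show "0 \<le> C * (1 + d)" using d by simp
    fix s y assume y: "\<iota> y = \<xi> s"
    show "norm (\<phi>2 (s, y)) \<le> C * (1 + d) * (indicator {-R..R} s + norm y)"
    proof (cases "s \<in> {-R..R}")
      case True
      have "norm (\<phi>2 (s, y)) \<le> C * (1 + norm y)"
        using d y by (intro tame_boundD(2) tb) simp
      also have "\<dots> \<le> C * (1 + d) * (1 + norm y)" using d by (intro mult_right_mono) (auto simp: algebra_simps)
      finally show ?thesis using True by simp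
    next
      case False
      then have s: "\<bar>s\<bar> \<ge> R0" "\<bar>s\<bar> \<ge> T" by (auto simp: R_def)
      have sm: "norm (\<iota> y) < d" using R0[OF s(1)] y by simp
      have "norm (\<phi>2 (s, 0 + y) - \<phi>2 (s, 0)) \<le> C * (1 + d) * norm y"
      proof (rule segment_bound[where f="\<lambda>z. \<phi>2 (s, z)"])
        fix t :: real assume t: "0 \<le> t" "t \<le> 1"
        have "norm (\<iota> (0 + t *\<^sub>R y) - \<xi> s) = norm ((t - 1) *\<^sub>R \<iota> y)"
          unfolding \<iota>_simps y[symmetric] by (simp add: algebra_simps)
        also have "\<dots> = \<bar>t - 1\<bar> * norm (\<iota> y)" by simp
        also have "\<dots> \<le> norm (\<iota> y)" using t by (intro mult_left_le_one_le) auto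
        finally have b: "tame_bound C (s, \<iota> (0 + t *\<^sub>R y))" using sm by (intro tb) simp
        show "((\<lambda>z. \<phi>2 (s, z)) has_derivative (\<lambda>h. D2 (s, 0 + t *\<^sub>R y) (0, h))) (at (0 + t *\<^sub>R y))"
          by (rule D_slice[OF D\<phi>2(1)[OF tame_boundD(1)[OF b]]])
        have "norm (D2 (s, 0 + t *\<^sub>R y) (0, y)) \<le> C * (norm y + norm (0 + t *\<^sub>R y) * norm (\<iota> y))"
          by (rule tame_boundD(3)[OF b])
        \<comment> \<open>Smallness of \<open>\<iota> y\<close> in H1 leaves an expression linear in
          \<open>norm y\<close>, whence the factor \<open>1 + d\<close>.\<close>
        also have "\<dots> \<le> C * (norm y + norm y * d)"
          using t sm d by (intro mult_left_mono add_mono mult_mono) (auto simp: mult_left_le_one_le)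
        finally show "norm (D2 (s, 0 + t *\<^sub>R y) (0, y)) \<le> C * (1 + d) * norm y" by (simp add: algebra_simps)
      qed
      moreover have "\<phi>2 (s, 0) = 0" using zero[OF s(2)] inv_\<iota>[of 0] by (simp add: \<phi>2_def \<iota>_simps)
      ultimately show ?thesis using False by simp
    qed
  qed
qed

end

section \<open>Superposition operators on paths\<close>

text \<open>Four summands are the most that occur, namely in \<open>ddPhi_continuous\<close>;
  shorter bounds are padded with zero coefficients. The functions \<open>u1\<close> to
  \<open>u4\<close> may have different target spaces, so that H1, H2 and real valued bounds can be
  mixed.\<close>

lemma L2_dominated4:
  assumes f: "f \<in> borel_measurable lebesgue"
    and u: "u1 \<in> L2" "u2 \<in> L2" "u3 \<in> L2" "u4 \<in> L2"
    and c: "0 \<le> c1" "0 \<le> c2" "0 \<le> c3" "0 \<le> c4"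
    and le: "AE s in lebesgue. norm (f s)
      \<le> c1 * norm (u1 s) + c2 * norm (u2 s) + c3 * norm (u3 s) + c4 * norm (u4 s)"
  shows "f \<in> L2"
    "L2_seminorm f \<le> c1 * L2_seminorm u1 + c2 * L2_seminorm u2 + c3 * L2_seminorm u3 + c4 * L2_seminorm u4"
proof -
  have m: "(\<lambda>s. c * norm (w s)) \<in> L2" "L2_seminorm (\<lambda>s. c * norm (w s)) = c * L2_seminorm w"
    if "w \<in> L2" "0 \<le> c" for c and w :: "real \<Rightarrow> 'x::{real_inner, banach, second_countable_topology}"
    using L2_mult[OF L2_norm(1)[OF that(1)], of c] L2_norm(2)[OF that(1)] that(2) by auto
  note a12 = L2_add[OF m(1)[OF u(1) c(1)] m(1)[OF u(2) c(2)]]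
  note a123 = L2_add[OF a12(1) m(1)[OF u(3) c(3)]]
  note a1234 = L2_add[OF a123(1) m(1)[OF u(4) c(4)]]
  have le': "AE s in lebesgue. norm (f s)
      \<le> norm (c1 * norm (u1 s) + c2 * norm (u2 s) + c3 * norm (u3 s) + c4 * norm (u4 s))"
    using le by eventually_elim (auto intro: order_trans)
  show "f \<in> L2" by (rule L2_dominated(1)[OF f a1234(1) le'])
  show "L2_seminorm f \<le> c1 * L2_seminorm u1 + c2 * L2_seminorm u2 + c3 * L2_seminorm u3 + c4 * L2_seminorm u4"
    using L2_dominated(2)[OF f a1234(1) le'] a1234(2) a123(2) a12(2)
    by (simp add: m(2)[OF u(1) c(1)] m(2)[OF u(2) c(2)] m(2)[OF u(3) c(3)] m(2)[OF u(4) c(4)])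
qed

lemma L2_indicator: "(\<lambda>s. indicator {a..b} s :: real) \<in> L2"
proof -
  have "integrable lebesgue (\<lambda>s. indicator {a..b} s :: real)"
    by (rule integrable_real_indicator) (auto simp: emeasure_lborel_Icc_eq)
  moreover have "(\<lambda>s. (norm (indicator {a..b} s :: real))\<^sup>2) = indicator {a..b}"
    by (auto simp: indicator_def fun_eq_iff)
  ultimately show ?thesis by (auto simp: L2_def)
qed

text \<open>Lifts of paths are arbitrary on a null set and may leave the domain of \<phi>2 there;
  extending \<open>f\<close> by 0 outside \<open>S\<close> gives a Borel map that agrees with
  \<open>f\<close> along \<open>v\<close> almost everywhere.\<close>

lemma borel_measurable_continuous_on_AE:
  fixes f :: "'p::topological_space \<Rightarrow> 'q::real_normed_vector"
  assumes S: "open S" and f: "continuous_on S f" and v: "v \<in> borel_measurable lebesgue"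
    and ae: "AE s in (lebesgue :: real measure). v s \<in> S"
  shows "(\<lambda>s. f (v s)) \<in> borel_measurable lebesgue"
proof -
  have "(\<lambda>p. if p \<in> S then f p else 0) \<in> borel_measurable borel"
    using S f by (intro borel_measurable_continuous_on_if) auto
  from measurable_compose[OF v this]
  have "(\<lambda>s. if v s \<in> S then f (v s) else 0) \<in> borel_measurable lebesgue" .
  then show ?thesis
    by (rule borel_measurable_lebesgue_AE) (use ae in \<open>auto elim: eventually_mono\<close>)
qed

context tame_map
begin

section \<open>The path space and its norm\<close>

abbreviation "E \<equiv> W12_L2 \<iota>"
abbreviation "N \<equiv> W12_L2_norm \<iota>"
abbreviation lift :: "(real \<Rightarrow> 'a) \<Rightarrow> real \<Rightarrow> 'b" where "lift f \<equiv> (\<lambda>s. inv \<iota> (f s))"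

lemma E_D:
  assumes "f \<in> E"
  shows "primitive_of f (weak_deriv f)" "weak_deriv f \<in> L2" "f \<in> L2" "continuous_on UNIV f"
    "lift f \<in> L2" "AE s in lebesgue. f s = \<iota> (lift f s)"
proof -
  have f: "f \<in> W12" "AE s in lebesgue. f s \<in> range \<iota>" "lift f \<in> L2"
    using assms by (auto simp: W12_L2_def)
  show "primitive_of f (weak_deriv f)" "weak_deriv f \<in> L2" "f \<in> L2" "continuous_on UNIV f"
    using weak_deriv_W12[OF f(1)] by auto
  show "lift f \<in> L2" by (rule f(3))
  show "AE s in lebesgue. f s = \<iota> (lift f s)"
    using f(2) by eventually_elim (simp add: f_inv_into_f)
qed

text \<open>Membership and norm are read off from any primitive representation and any H2
  representative, because both are unique almost everywhere.\<close>

lemma E_I: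
  assumes f: "f \<in> L2" and P: "primitive_of f g" and g: "g \<in> L2"
    and ae: "AE s in lebesgue. f s = \<iota> (f2 s)" and f2: "f2 \<in> L2"
  shows "f \<in> E" "N f = sqrt ((L2_seminorm g)\<^sup>2 + (L2_seminorm f2)\<^sup>2)"
proof -
  have e: "AE s in lebesgue. f2 s = lift f s" using ae by eventually_elim simp
  show "f \<in> E"
    using W12_I(1)[OF f P g] L2_AE_cong(1)[OF f2 e] ae
    by (auto simp: W12_L2_def elim: eventually_mono)
  show "N f = sqrt ((L2_seminorm g)\<^sup>2 + (L2_seminorm f2)\<^sup>2)"
    unfolding W12_L2_norm_def W12_I(2)[OF f P g] L2_AE_cong(2)[OF f2 e] ..
qed

lemma N_nonneg: "0 \<le> N f" by (simp add: W12_L2_norm_def)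

text \<open>\<open>N\<close> contains no L2 norm in H1; it is recovered from the lift by
  \<open>norm (\<iota> x) \<le> norm x\<close>, and the energy estimate then gives a sup bound with
  constant 1.\<close>

lemma N_bounds:
  assumes "f \<in> E"
  shows "L2_seminorm (weak_deriv f) \<le> N f" "L2_seminorm (lift f) \<le> N f" "L2_seminorm f \<le> N f"
    "norm (f s) \<le> N f"
proof -
  note f = E_D[OF assms]
  show "L2_seminorm (weak_deriv f) \<le> N f" "L2_seminorm (lift f) \<le> N f"
    unfolding W12_L2_norm_def by (simp_all add: real_le_rsqrt)
  have le: "L2_seminorm f \<le> L2_seminorm (lift f)"
    by (rule L2_dominated(2)[OF L2_D(1)[OF f(3)] f(5)])
      (use f(6) in \<open>eventually_elim\<close>, metis \<iota>(4))
  then show "L2_seminorm f \<le> N f" using \<open>L2_seminorm (lift f) \<le> N f\<close> by simp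
  have "norm (f s) \<le> sqrt ((L2_seminorm f)\<^sup>2 + (L2_seminorm (weak_deriv f))\<^sup>2)"
    by (rule primitive_of_sup_bound[OF f(1,3,2)])
  also have "\<dots> \<le> N f"
    unfolding W12_L2_norm_def using le by (simp add: power_mono)
  finally show "norm (f s) \<le> N f" .
qed

lemma E_diff:
  assumes f: "f \<in> E" and g: "g \<in> E"
  shows "(\<lambda>s. f s - g s) \<in> E"
proof -
  note f = E_D[OF f] and g = E_D[OF g]
  have ae: "AE s in lebesgue. f s - g s = \<iota> (lift f s - lift g s)"
    using f(6) g(6) by eventually_elim (simp add: \<iota>_simps)
  show "(\<lambda>s. f s - g s) \<in> E"
    by (rule E_I[OF L2_diff(1)[OF f(3) g(3)] primitive_of_diff[OF f(1) g(1)]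
          L2_diff(1)[OF f(2) g(2)] ae L2_diff(1)[OF f(5) g(5)]])
qed

abbreviation "U \<equiv> path_domain \<iota> O1"

lemma U_E: "x \<in> U \<Longrightarrow> x \<in> E" by (simp add: path_domain_def)

lemma U_O1: "x \<in> U \<Longrightarrow> (s, x s) \<in> O1" by (simp add: path_domain_def)

lemma U_admissible:
  assumes "x \<in> U"
  shows "admissible x"
proof -
  note f = E_D[OF U_E[OF assms]]
  have "\<exists>R. \<forall>s. \<bar>s\<bar> \<ge> R \<longrightarrow> norm (x s) < \<epsilon>" if "\<epsilon> > 0" for \<epsilon>
    using primitive_of_decay[OF f(1,3,2) that] by metis
  then show ?thesis using f(4) assms by (auto simp: admissible_def path_domain_def)
qed

lemma U_AE_O2:
  assumes "x \<in> U" shows "AE s in lebesgue. (s, lift x s) \<in> O2 \<and> x s = \<iota> (lift x s)"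
  using E_D(6)[OF U_E[OF assms]]
proof eventually_elim
  case (elim s)
  have "(s, \<iota> (lift x s)) \<in> O1" using U_O1[OF assms, of s] elim by metis
  then have "(s, lift x s) \<in> O2" by (simp add: level2_def)
  then show ?case using elim by blast
qed

section \<open>Continuity and measurability along a path\<close>

lemma graph_continuous: "x \<in> U \<Longrightarrow> continuous_on UNIV (\<lambda>s. (s, x s))"
  by (intro continuous_intros E_D(4) U_E)

lemma D1_path_continuous: "x \<in> U \<Longrightarrow> continuous_on UNIV (\<lambda>s. D1 (s, x s))"
  by (rule continuous_on_compose2[OF D\<phi>(4) graph_continuous]) (auto simp: U_O1)

lemma DD1_path_continuous: "x \<in> U \<Longrightarrow> continuous_on UNIV (\<lambda>s. DD1 (s, x s))"
  by (rule continuous_on_compose2[OF D\<phi>(5) graph_continuous]) (auto simp: U_O1)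

lemma D1_path_measurable:
  assumes "x \<in> U" "\<eta> \<in> borel_measurable lebesgue"
  shows "(\<lambda>s. D1 (s, x s) (c, \<eta> s)) \<in> borel_measurable lebesgue"
  by (rule borel_measurable_blinfun_apply[OF D1_path_continuous[OF assms(1)]])
     (intro borel_measurable_Pair assms borel_measurable_const)

lemma DD1_path_measurable:
  assumes "x \<in> U" "\<eta> \<in> borel_measurable lebesgue" "continuous_on UNIV h"
  shows "(\<lambda>s. DD1 (s, x s) (0, h s) (c, \<eta> s)) \<in> borel_measurable lebesgue"
  by (rule borel_measurable_blinfun_apply[where A="\<lambda>s. DD1 (s, x s) (0, h s)" and v="\<lambda>s. (c, \<eta> s)"])
     (intro continuous_intros DD1_path_continuous borel_measurable_Pair assms borel_measurable_const)+

lemma lift_path_measurable: "x \<in> E \<Longrightarrow> (\<lambda>s. (s, lift x s)) \<in> borel_measurable lebesgue"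
  by (intro borel_measurable_Pair L2_D(1) E_D(5) borel_measurable_lebesgue_continuous continuous_on_id)

lemma \<phi>2_path_measurable:
  assumes "x \<in> U"
  shows "(\<lambda>s. \<phi>2 (s, lift x s)) \<in> borel_measurable lebesgue"
proof (rule borel_measurable_continuous_on_AE[OF open_O2 D\<phi>2(3) lift_path_measurable[OF U_E[OF assms]]])
  show "AE s in lebesgue. (s, lift x s) \<in> O2"
    using U_AE_O2[OF assms] by eventually_elim simp
qed

lemma D2_path_measurable:
  assumes "x \<in> U" "h \<in> E"
  shows "(\<lambda>s. D2 (s, lift x s) (0, lift h s)) \<in> borel_measurable lebesgue"
proof -
  let ?f = "\<lambda>q. D2 (fst q) (0, snd q)" and ?v = "\<lambda>s. ((s, lift x s), lift h s)"
  have "(\<lambda>s. ?f (?v s)) \<in> borel_measurable lebesgue"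
  proof (rule borel_measurable_continuous_on_AE[where S="O2 \<times> UNIV" and f="?f" and v="?v"])
    show "open (O2 \<times> (UNIV :: 'b set))" by (intro open_Times open_O2 open_UNIV)
    show "continuous_on (O2 \<times> UNIV) ?f"
      by (intro continuous_intros continuous_on_compose2[OF D\<phi>2(4)]) auto
    show "?v \<in> borel_measurable lebesgue"
      by (intro borel_measurable_Pair[OF lift_path_measurable[OF U_E[OF assms(1)]]] L2_D(1) E_D(5) assms)
    show "AE s in lebesgue. ?v s \<in> O2 \<times> UNIV"
      using U_AE_O2[OF assms(1)] by eventually_elim simp
  qed
  then show ?thesis by simp
qed

lemma D1_path_L2:
  assumes x: "x \<in> U" and \<eta>: "\<eta> \<in> L2"
  shows "(\<lambda>s. D1 (s, x s) (0, \<eta> s)) \<in> L2"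
proof -
  obtain C where C: "C \<ge> 0" "\<And>s. norm (D1 (s, x s)) \<le> C" "\<And>s. norm (DD1 (s, x s)) \<le> C"
    using path_derivs_bounded[OF U_admissible[OF x]] by blast
  have b: "norm (D1 (s, x s) (0, \<eta> s)) \<le> C * norm (\<eta> s)" for s
    using norm_blinfun[of "D1 (s, x s)" "(0, \<eta> s)"] mult_right_mono[OF C(2), of "norm (\<eta> s)" s]
    by (simp add: norm_Pair)
  show ?thesis
    by (rule L2_dominated(1)[OF D1_path_measurable[OF x L2_D(1)[OF \<eta>]] L2_scaleR(1)[OF \<eta>, of C]])
      (use b C(1) in simp)
qed

text \<open>The chain rule is applied to the graph \<open>s \<mapsto> (s, x s)\<close>. The time
  part of the derivative is bounded and vanishes outside a bounded interval; the space part is a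
  uniformly bounded operator applied to \<open>x'\<close>.\<close>

lemma superposition_deriv:
  assumes x: "x \<in> U" and P: "primitive_of x x'" and x': "x' \<in> L2"
  shows "primitive_of (superposition \<phi> x) (\<lambda>s. D1 (s, x s) (1, x' s))"
    "(\<lambda>s. D1 (s, x s) (1, x' s)) \<in> L2"
proof -
  show "primitive_of (superposition \<phi> x) (\<lambda>s. D1 (s, x s) (1, x' s))"
    unfolding superposition_def
    by (rule primitive_of_chain[OF primitive_of_Pair[OF primitive_of_ident P] open_O1 U_O1[OF x] D\<phi>(1) D\<phi>(4)])
  obtain C where C: "C \<ge> 0" "\<And>s. norm (D1 (s, x s)) \<le> C" "\<And>s. norm (DD1 (s, x s)) \<le> C"
    using path_derivs_bounded[OF U_admissible[OF x]] by blast
  have "norm (D1 (s, x s) (1, 0)) \<le> C * indicator {-T..T} s" for s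
  proof (cases "\<bar>s\<bar> > T")
    case True
    then show ?thesis using D1_time_zero[OF True U_O1[OF x]] C(1) by (simp add: indicator_def)
  next
    case False
    then have "s \<in> {-T..T}" by auto
    then show ?thesis
      using norm_blinfun[of "D1 (s, x s)" "(1, 0)"] C(2)[of s] by (simp add: norm_Pair)
  qed
  then have "(\<lambda>s. D1 (s, x s) (1, 0)) \<in> L2"
    using C(1) by (intro L2_dominated(1)[OF D1_path_measurable[OF x] L2_scaleR(1)[OF L2_indicator[of "-T" T], of C]]) auto
  from L2_add(1)[OF this D1_path_L2[OF x x']]
  show "(\<lambda>s. D1 (s, x s) (1, x' s)) \<in> L2"
    by (simp add: blinfun.add_right[symmetric])
qed

lemma superposition_lift:
  assumes x: "x \<in> U"
  shows "(\<lambda>s. \<phi>2 (s, lift x s)) \<in> L2"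
    "AE s in lebesgue. superposition \<phi> x s = \<iota> (\<phi>2 (s, lift x s))"
proof -
  obtain C R where C: "C \<ge> 0" "\<And>s y. \<iota> y = x s \<Longrightarrow> norm (\<phi>2 (s, y)) \<le> C * (indicator {-R..R} s + norm y)"
    using \<phi>2_growth[OF U_admissible[OF x]] by blast
  note l = E_D(5)[OF U_E[OF x]]
  note L = L2_indicator[of "-R" R]
  show "(\<lambda>s. \<phi>2 (s, lift x s)) \<in> L2"
  proof (rule L2_dominated4(1)[OF \<phi>2_path_measurable[OF x] l L l L, of C C 0 0])
    show "AE s in lebesgue. norm (\<phi>2 (s, lift x s)) \<le> C * norm (lift x s) + C * norm (indicat_real {-R..R} s)
        + 0 * norm (lift x s) + 0 * norm (indicat_real {-R..R} s)"
      using E_D(6)[OF U_E[OF x]]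
    proof eventually_elim
      case (elim s)
      from C(2)[OF elim[symmetric]] show ?case by (simp add: algebra_simps)
    qed
  qed (use C in auto)
  show "AE s in lebesgue. superposition \<phi> x s = \<iota> (\<phi>2 (s, lift x s))"
    using U_AE_O2[OF x] by eventually_elim (simp add: \<iota>_\<phi>2 superposition_def)
qed

lemma superposition_L2:
  assumes x: "x \<in> U"
  shows "superposition \<phi> x \<in> L2"
proof -
  have "continuous_on UNIV (superposition \<phi> x)"
    unfolding superposition_def
    by (rule continuous_on_compose2[OF D\<phi>(3) graph_continuous[OF x]]) (auto simp: U_O1[OF x])
  moreover have "AE s in lebesgue. norm (superposition \<phi> x s) \<le> norm (\<phi>2 (s, lift x s))"
    using superposition_lift(2)[OF x] by eventually_elim (simp add: \<iota>(4))
  ultimately show ?thesis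
    by (intro L2_dominated(1)[OF borel_measurable_lebesgue_continuous superposition_lift(1)[OF x]])
qed

lemma superposition_E:
  assumes x: "x \<in> U"
  shows "superposition \<phi> x \<in> E"
  using E_D[OF U_E[OF x]]
  by (intro E_I(1)[OF superposition_L2[OF x] superposition_deriv[OF x] superposition_lift(2,1)[OF x]])

section \<open>The linearised superposition operator and its derivative\<close>

definition dPhi where "dPhi x \<eta> = (\<lambda>s. D1 (s, x s) (0, \<eta> s))"

text \<open>The formal derivative of \<open>(x, \<eta>) \<mapsto> (\<lambda>s. D1 (s, x s) (c,
  \<eta> s))\<close> in direction \<open>(h, k)\<close>. The time component \<open>c\<close> is a
  parameter so that one set of estimates serves both components of the tangent map.\<close>

definition ddPhi where
  "ddPhi c x \<eta> h k = (\<lambda>s. DD1 (s, x s) (0, h s) (c, \<eta> s) + D1 (s, x s) (0, k s))"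

lemma d_superposition_eq: "x \<in> U \<Longrightarrow> d_superposition \<phi> x \<eta> = dPhi x \<eta>"
  by (simp add: d_superposition_def dPhi_def fun_eq_iff frechet_slice U_O1)

text \<open>The product rule yields \<open>DD1 (s, x s) (1, x' s) (0, h s)\<close>. Symmetry of the
  second derivative turns this into the form in \<open>ddPhi\<close>, which is the derivative in
  direction \<open>h\<close> of the weak derivative of the superposition.\<close>

lemma dPhi_primitive:
  assumes x: "x \<in> U" and P: "primitive_of x x'" and Q: "primitive_of h h'"
  shows "primitive_of (dPhi x h) (ddPhi 1 x x' h h')"
proof -
  define \<pi>1 :: "((real \<times> 'a) \<times> 'a) \<Rightarrow>\<^sub>L (real \<times> 'a)" where "\<pi>1 = fst_blinfun"
  define \<pi>2 :: "((real \<times> 'a) \<times> 'a) \<Rightarrow>\<^sub>L (real \<times> 'a)" where "\<pi>2 = Blinfun (\<lambda>p. (0, snd p))"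
  have \<pi>2: "blinfun_apply \<pi>2 = (\<lambda>p. (0, snd p))"
    unfolding \<pi>2_def
    by (intro bounded_linear_Blinfun_apply bounded_linear_Pair bounded_linear_zero bounded_linear_snd)
  let ?F = "\<lambda>p. D1 (fst p) (0, snd p)"
  \<comment> \<open>The arguments are already exchanged here, so that \<open>F'\<close> is a sum of
    composed operators and inherits continuity from \<open>D1\<close> and
    \<open>DD1\<close>.\<close>
  define F' where "F' = (\<lambda>p. (DD1 (fst p) (0, snd p) o\<^sub>L \<pi>1) + (D1 (fst p) o\<^sub>L \<pi>2))"
  have "primitive_of (\<lambda>s. ?F ((s, x s), h s)) (\<lambda>s. F' ((s, x s), h s) ((1, x' s), h' s))"
  proof (rule primitive_of_chain[OF primitive_of_Pair[OF primitive_of_Pair[OF primitive_of_ident P] Q]])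
    show "open (O1 \<times> (UNIV :: 'a set))" by (intro open_Times open_O1 open_UNIV)
    show "((s, x s), h s) \<in> O1 \<times> UNIV" for s using U_O1[OF x] by simp
    show "continuous_on (O1 \<times> UNIV) F'"
      unfolding F'_def
      by (intro continuous_intros continuous_on_compose2[OF D\<phi>(4)] continuous_on_compose2[OF D\<phi>(5)]) auto
    fix p :: "(real \<times> 'a) \<times> 'a" assume "p \<in> O1 \<times> UNIV"
    then have p: "fst p \<in> O1" by auto
    have a: "((\<lambda>p. D1 (fst p)) has_derivative (\<lambda>v. DD1 (fst p) (fst v))) (at p)"
      by (rule has_derivative_compose[OF bounded_linear_imp_has_derivative[OF bounded_linear_fst] D\<phi>(2)[OF p]])
    have b: "((\<lambda>p. (0, snd p)) has_derivative (\<lambda>v. (0, snd v))) (at p)"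
      by (auto intro!: derivative_eq_intros)
    have "(?F has_derivative (\<lambda>v. D1 (fst p) (0, snd v) + DD1 (fst p) (fst v) (0, snd p))) (at p)"
      by (rule blinfun.FDERIV[OF a b])
    then show "(?F has_derivative blinfun_apply (F' p)) (at p)"
      by (rule has_derivative_eq_rhs)
        (simp add: F'_def blinfun.add_left \<pi>1_def \<pi>2 DD1_sym[OF p] fun_eq_iff add.commute)
  qed
  then show ?thesis
    by (simp add: dPhi_def ddPhi_def F'_def blinfun.add_left \<pi>1_def \<pi>2)
qed

lemma norm_slice [simp]: "norm (0 :: real, x :: 'c::real_normed_vector) = norm x"
  by (simp add: norm_Pair)

lemma norm_scalar_pair_le: "\<bar>c\<bar> \<le> 1 \<Longrightarrow> norm (c :: real, x :: 'c::real_normed_vector) \<le> 1 + norm x"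
  using sqrt_sum_squares_le_sum_abs[of c "norm x"] by (simp add: norm_Pair)

lemma ddPhi_measurable:
  assumes x: "x \<in> U" and \<eta>: "\<eta> \<in> L2" and h: "continuous_on UNIV h" and k: "k \<in> L2"
  shows "ddPhi c x \<eta> h k \<in> borel_measurable lebesgue"
  unfolding ddPhi_def
  by (intro borel_measurable_add DD1_path_measurable D1_path_measurable x h L2_D(1) \<eta> k)

text \<open>In the bilinear term \<open>h\<close> is bounded in sup norm against the L2 function
  \<eta>. Against a nonzero constant \<open>c\<close>, which is not square integrable,
  \<open>h\<close> itself supplies the L2 norm; the summand 1 records this.\<close>

lemma ddPhi_L2:
  assumes x: "x \<in> U"
  obtains C where "C \<ge> 0" "\<And>c \<eta> h k. \<bar>c\<bar> \<le> 1 \<Longrightarrow> \<eta> \<in> L2 \<Longrightarrow> h \<in> E \<Longrightarrow> k \<in> L2 \<Longrightarrow>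
    ddPhi c x \<eta> h k \<in> L2 \<and>
    L2_seminorm (ddPhi c x \<eta> h k) \<le> C * ((1 + L2_seminorm \<eta>) * N h + L2_seminorm k)"
proof -
  obtain C where C: "C \<ge> 0" "\<And>s. norm (D1 (s, x s)) \<le> C" "\<And>s. norm (DD1 (s, x s)) \<le> C"
    using path_derivs_bounded[OF U_admissible[OF x]] by blast
  show ?thesis
  proof (rule that[OF C(1)])
    fix c :: real and \<eta> h k :: "real \<Rightarrow> 'a"
    assume c: "\<bar>c\<bar> \<le> 1" and \<eta>: "\<eta> \<in> L2" and h: "h \<in> E" and k: "k \<in> L2"
    have le: "norm (ddPhi c x \<eta> h k s) \<le> C * norm (h s) + (C * N h) * norm (\<eta> s) + C * norm (k s) + 0 * norm (k s)" for s
    proof -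
      have "norm (DD1 (s, x s) (0, h s) (c, \<eta> s)) \<le> norm (DD1 (s, x s)) * norm (0::real, h s) * norm (c, \<eta> s)"
        by (rule norm_blinfun2)
      also have "\<dots> \<le> C * norm (h s) * (1 + norm (\<eta> s))"
        using C norm_scalar_pair_le[OF c] by (intro mult_mono) auto
      also have "\<dots> = C * norm (h s) + C * norm (h s) * norm (\<eta> s)" by (simp add: algebra_simps)
      also have "\<dots> \<le> C * norm (h s) + (C * N h) * norm (\<eta> s)"
        using C N_bounds(4)[OF h, of s] by (intro add_mono mult_mono mult_nonneg_nonneg N_nonneg) auto
      finally have 1: "norm (DD1 (s, x s) (0, h s) (c, \<eta> s)) \<le> C * norm (h s) + (C * N h) * norm (\<eta> s)" .
      have 2: "norm (D1 (s, x s) (0, k s)) \<le> C * norm (k s)"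
        using norm_blinfun[of "D1 (s, x s)" "(0, k s)"] mult_right_mono[OF C(2), of "norm (k s)" s] by simp
      show ?thesis unfolding ddPhi_def using norm_triangle_le[OF add_mono[OF 1 2]] by simp
    qed
    note hh = E_D[OF h]
    note * = L2_dominated4[OF ddPhi_measurable[OF x \<eta> hh(4) k] hh(3) \<eta> k k C(1) _ C(1) order_refl always_eventually[OF allI[OF le]]]
    have CN: "0 \<le> C * N h" using C(1) N_nonneg by simp
    have "L2_seminorm (ddPhi c x \<eta> h k) \<le> C * L2_seminorm h + (C * N h) * L2_seminorm \<eta> + C * L2_seminorm k"
      using *(2)[OF CN] by simp
    also have "\<dots> \<le> C * N h + (C * N h) * L2_seminorm \<eta> + C * L2_seminorm k"
      using C CN N_bounds(3)[OF h] by (intro add_mono mult_left_mono order_refl) auto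
    finally show "ddPhi c x \<eta> h k \<in> L2 \<and>
      L2_seminorm (ddPhi c x \<eta> h k) \<le> C * ((1 + L2_seminorm \<eta>) * N h + L2_seminorm k)"
      using *(1)[OF CN] by (simp add: algebra_simps)
  qed
qed

text \<open>The H2 norm of \<open>x s\<close> is merely square integrable in \<open>s\<close>, so in
  the product \<open>norm y * norm (\<iota> v)\<close> the increment \<open>h\<close> is the factor
  bounded in the sup norm of H1.\<close>

lemma dPhi_lift:
  assumes x: "x \<in> U"
  obtains C where "C \<ge> 0" "\<And>h. h \<in> E \<Longrightarrow> (\<lambda>s. D2 (s, lift x s) (0, lift h s)) \<in> L2 \<and>
    L2_seminorm (\<lambda>s. D2 (s, lift x s) (0, lift h s)) \<le> C * (1 + L2_seminorm (lift x)) * N h"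
proof -
  obtain d C where C: "d > 0" "C \<ge> 0" "\<And>s z. norm (z - x s) < d \<Longrightarrow> tame_bound C (s, z)"
    using tame_tube[OF U_admissible[OF x]] by blast
  show ?thesis
  proof (rule that[OF C(2)])
    fix h assume h: "h \<in> E"
    note hh = E_D[OF h] and xx = E_D[OF U_E[OF x]]
    let ?f = "\<lambda>s. D2 (s, lift x s) (0, lift h s)"
    have ae: "AE s in lebesgue. norm (?f s) \<le> C * norm (lift h s) + (C * N h) * norm (lift x s)
         + 0 * norm (lift h s) + 0 * norm (lift h s)"
      using xx(6) hh(6)
    proof eventually_elim
      case (elim s)
      have "tame_bound C (s, \<iota> (lift x s))" using C(1) elim(1) by (intro C(3)) simp
      from tame_boundD(3)[OF this]
      have "norm (?f s) \<le> C * (norm (lift h s) + norm (lift x s) * norm (\<iota> (lift h s)))" .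
      also have "\<iota> (lift h s) = h s" using elim by simp
      also have "C * (norm (lift h s) + norm (lift x s) * norm (h s)) \<le> C * (norm (lift h s) + norm (lift x s) * N h)"
        using C N_bounds(4)[OF h, of s] by (intro mult_left_mono add_mono) auto
      finally show ?case by (simp add: algebra_simps)
    qed
    have CN: "0 \<le> C * N h" using C(2) N_nonneg by simp
    note * = L2_dominated4[OF D2_path_measurable[OF x h] hh(5) xx(5) hh(5) hh(5) C(2) CN order_refl order_refl ae]
    have "L2_seminorm ?f \<le> C * L2_seminorm (lift h) + (C * N h) * L2_seminorm (lift x)"
      using *(2) by simp
    also have "\<dots> \<le> C * N h + (C * N h) * L2_seminorm (lift x)"
      using C CN N_bounds(2)[OF h] by (intro add_mono mult_left_mono order_refl) auto
    finally show "?f \<in> L2 \<and> L2_seminorm ?f \<le> C * (1 + L2_seminorm (lift x)) * N h"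
      using *(1) by (simp add: algebra_simps)
  qed
qed

lemma dPhi_lift_AE:
  assumes x: "x \<in> U" and h: "h \<in> E"
  shows "AE s in lebesgue. dPhi x h s = \<iota> (D2 (s, lift x s) (0, lift h s))"
  using U_AE_O2[OF x] E_D(6)[OF h]
  by eventually_elim (simp add: \<iota>_D2 dPhi_def)

lemma dPhi_L2: "x \<in> U \<Longrightarrow> \<eta> \<in> L2 \<Longrightarrow> dPhi x \<eta> \<in> L2"
  unfolding dPhi_def by (rule D1_path_L2)

end

lemma smallness_choice:
  fixes A :: real
  assumes "0 < e" "0 \<le> A"
  obtains e0 where "e0 > 0" "e0 * A \<le> e"
  using assms by (intro that[of "e / (A + 1)"]) (auto simp: divide_simps algebra_simps)

section \<open>Remainder estimates\<close>

context tame_map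
begin

text \<open>\<open>e\<close> measures what is small by continuity of \<open>DD1\<close>, while
  \<open>K\<close> is merely a bound; both are uniform in \<open>s\<close>.\<close>

definition H1_tube_bounds :: "(real \<Rightarrow> 'a) \<Rightarrow> real \<Rightarrow> real \<Rightarrow> real \<Rightarrow> bool" where
  "H1_tube_bounds x e d K \<longleftrightarrow> (\<forall>s z. norm z < d \<longrightarrow>
     norm (D1 (s, x s + z) - D1 (s, x s) - DD1 (s, x s) (0, z)) \<le> e * norm z \<and>
     norm (D1 (s, x s + z) - D1 (s, x s)) \<le> K * norm z \<and>
     norm (DD1 (s, x s + z) - DD1 (s, x s)) \<le> e \<and> norm (DD1 (s, x s + z)) \<le> K)"

text \<open>The parameters are tuned to later use with \<open>A\<close> equal to
  \<open>1 + L2_seminorm \<eta>\<close>: \<open>e0 * A\<close> absorbs what acts on \<eta>, and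
  \<open>d * K\<close> absorbs products of two increments.\<close>

lemma H1_tube:
  assumes x: "x \<in> U" and e: "e > 0" and A: "0 \<le> A"
  obtains e0 d K where "e0 > 0" "e0 * A \<le> e" "d > 0" "K \<ge> 0" "d * K \<le> e"
    "H1_tube_bounds x e0 d K"
proof -
  obtain C where C: "C \<ge> 0" "\<And>s. norm (D1 (s, x s)) \<le> C" "\<And>s. norm (DD1 (s, x s)) \<le> C"
    using path_derivs_bounded[OF U_admissible[OF x]] by blast
  obtain e0 where e0: "e0 > 0" "e0 * A \<le> e" using smallness_choice[OF e A] by blast
  obtain d where d: "d > 0" and tube: "\<And>s z. norm (z - x s) < d \<Longrightarrow>
    (s, z) \<in> O1 \<and> norm (DD1 (s, z) - DD1 (s, x s)) < e0"
    using uniform_tube[OF U_admissible[OF x] e0(1)] by blast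
  \<comment> \<open>The bound along the path plus the oscillation allowed in the tube; it serves
    both as a bound for \<open>DD1\<close> and as a Lipschitz constant for
    \<open>D1\<close>.\<close>
  define K where "K = C + e0"
  have K: "K \<ge> 0" using C e0 by (simp add: K_def)
  obtain d1 where d1: "d1 > 0" "d1 * K \<le> e" using smallness_choice[OF e K] by blast
  have bounds: "H1_tube_bounds x e0 d K"
    unfolding H1_tube_bounds_def
  proof (intro allI impI)
    fix s and z :: 'a assume z: "norm z < d"
    have tb: "(s, x s + t *\<^sub>R z) \<in> O1 \<and> norm (DD1 (s, x s + t *\<^sub>R z) - DD1 (s, x s)) < e0"
      if "0 \<le> t" "t \<le> 1" for t
    proof (rule tube)
      have "norm (t *\<^sub>R z) \<le> norm z" using that by (simp add: mult_left_le_one_le)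
      then show "norm (x s + t *\<^sub>R z - x s) < d" using z by simp
    qed
    have 1: "norm (DD1 (s, x s + z) - DD1 (s, x s)) \<le> e0"
      using tb[of 1] by auto
    have 2: "norm (D1 (s, x s + z) - D1 (s, x s) - DD1 (s, x s) (0, z)) \<le> e0 * norm z"
    proof (rule segment_bound_affine[where f="\<lambda>z. D1 (s, z)" and L="\<lambda>z. DD1 (s, x s) (0, z)"])
      fix t :: real assume t: "0 \<le> t" "t \<le> 1"
      show "((\<lambda>z. D1 (s, z)) has_derivative (\<lambda>h. DD1 (s, x s + t *\<^sub>R z) (0, h))) (at (x s + t *\<^sub>R z))"
        using tb[OF t] by (intro D_slice D\<phi>(2)) simp
      have "norm ((DD1 (s, x s + t *\<^sub>R z) - DD1 (s, x s)) (0, z))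
        \<le> norm (DD1 (s, x s + t *\<^sub>R z) - DD1 (s, x s)) * norm (0 :: real, z)" by (rule norm_blinfun)
      also have "\<dots> \<le> e0 * norm z" using tb[OF t] by (simp add: mult_right_mono)
      finally show "norm (DD1 (s, x s + t *\<^sub>R z) (0, z) - DD1 (s, x s) (0, z)) \<le> e0 * norm z"
        by (simp add: blinfun.diff_left)
    next
      show "bounded_linear (\<lambda>z. DD1 (s, x s) (0, z))"
        by (intro blinfun.bounded_linear_right[THEN bounded_linear_compose] bounded_linear_Pair
            bounded_linear_zero bounded_linear_ident)
    qed
    have "norm (DD1 (s, x s) (0, z)) \<le> C * norm z"
      using norm_blinfun[of "DD1 (s, x s)" "(0, z)"] mult_right_mono[OF C(3), of "norm z" s] by simp
    then have 3: "norm (D1 (s, x s + z) - D1 (s, x s)) \<le> K * norm z"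
      using 2 norm_triangle_sub[of "D1 (s, x s + z) - D1 (s, x s)" "DD1 (s, x s) (0, z)"]
      by (simp add: K_def algebra_simps)
    have 4: "norm (DD1 (s, x s + z)) \<le> K"
      using 1 C(3)[of s] norm_triangle_sub[of "DD1 (s, x s + z)" "DD1 (s, x s)"] unfolding K_def by linarith
    show "norm (D1 (s, x s + z) - D1 (s, x s) - DD1 (s, x s) (0, z)) \<le> e0 * norm z \<and>
     norm (D1 (s, x s + z) - D1 (s, x s)) \<le> K * norm z \<and>
     norm (DD1 (s, x s + z) - DD1 (s, x s)) \<le> e0 \<and> norm (DD1 (s, x s + z)) \<le> K"
      using 1 2 3 4 by blast
  qed
  show ?thesis
  proof (rule that[OF e0, of "min d d1" K])
    show "min d d1 * K \<le> e"
      by (rule order_trans[OF mult_right_mono d1(2)]) (use K in auto)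
  qed (use bounds d d1 K in \<open>auto simp: H1_tube_bounds_def\<close>)
qed

text \<open>Smallness comes from the additional factor of the increment \<open>z\<close>, not from a
  modulus of continuity. Each product contains exactly one H2 norm, all other factors being H1
  norms, which keeps it square integrable along paths.\<close>

definition H2_tube_bounds :: "(real \<Rightarrow> 'a) \<Rightarrow> real \<Rightarrow> real \<Rightarrow> bool" where
  "H2_tube_bounds x d C \<longleftrightarrow> (\<forall>s y z v. \<iota> y = x s \<longrightarrow> norm (\<iota> z) < d \<longrightarrow>
     norm (D2 (s, y + z) (0, v) - D2 (s, y) (0, v))
       \<le> C * (norm (\<iota> z) * norm v + norm z * norm (\<iota> v) + (norm y + norm z) * norm (\<iota> z) * norm (\<iota> v)) \<and>
     norm (\<phi>2 (s, y + z) - \<phi>2 (s, y) - D2 (s, y) (0, z))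
       \<le> C * (2 * (norm (\<iota> z) * norm z) + (norm y + norm z) * norm (\<iota> z) * norm (\<iota> z)))"

text \<open>\<open>d \<le> 1\<close> later lowers the degree of cubic terms; \<open>A\<close> stands
  for the sum of coefficients that remains after the tube bounds are integrated over
  \<open>s\<close>.\<close>

lemma H2_tube:
  assumes x: "x \<in> U" and e: "e > 0" and A: "0 \<le> A"
  obtains d C where "d > 0" "d \<le> 1" "C \<ge> 0" "d * (C * A) \<le> e" "H2_tube_bounds x d C"
proof -
  obtain d C where d: "d > 0" "C \<ge> 0" and tube: "\<And>s z. norm (z - x s) < d \<Longrightarrow> tame_bound C (s, z)"
    using tame_tube[OF U_admissible[OF x]] by blast
  have 1: "norm (D2 (s, y + z) (0, v) - D2 (s, y) (0, v))
       \<le> C * (norm (\<iota> z) * norm v + norm z * norm (\<iota> v) + (norm y + norm z) * norm (\<iota> z) * norm (\<iota> v))"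
    and tb: "\<And>t. 0 \<le> t \<Longrightarrow> t \<le> 1 \<Longrightarrow> tame_bound C (s, \<iota> (y + t *\<^sub>R z))"
    if y: "\<iota> y = x s" and z: "norm (\<iota> z) < d" for s y z v
  proof -
    show tb: "tame_bound C (s, \<iota> (y + t *\<^sub>R z))" if t: "0 \<le> t" "t \<le> 1" for t
    proof (rule tube)
      have "norm (t *\<^sub>R \<iota> z) \<le> norm (\<iota> z)" using t by (simp add: mult_left_le_one_le)
      then show "norm (\<iota> (y + t *\<^sub>R z) - x s) < d" using y z by (simp add: \<iota>_simps)
    qed
    show "norm (D2 (s, y + z) (0, v) - D2 (s, y) (0, v))
       \<le> C * (norm (\<iota> z) * norm v + norm z * norm (\<iota> v) + (norm y + norm z) * norm (\<iota> z) * norm (\<iota> v))"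
    proof (rule segment_bound[where f="\<lambda>z. D2 (s, z) (0, v)"])
      fix t :: real assume t: "0 \<le> t" "t \<le> 1"
      note b = tb[OF t]
      have "((\<lambda>q. D2 q (0, v)) has_derivative (\<lambda>u. DD2 (s, y + t *\<^sub>R z) u (0, v))) (at (s, y + t *\<^sub>R z))"
        by (rule bounded_linear.has_derivative[OF blinfun.bounded_linear_left D\<phi>2(2)[OF tame_boundD(1)[OF b]]])
      from D_slice[OF this]
      show "((\<lambda>z. D2 (s, z) (0, v)) has_derivative (\<lambda>h. DD2 (s, y + t *\<^sub>R z) (0, h) (0, v))) (at (y + t *\<^sub>R z))" .
      have "norm (y + t *\<^sub>R z) \<le> norm y + norm (t *\<^sub>R z)" by (rule norm_triangle_ineq)
      also have "norm (t *\<^sub>R z) \<le> norm z" using t by (simp add: mult_left_le_one_le)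
      finally have n: "norm (y + t *\<^sub>R z) \<le> norm y + norm z" by simp
      have "norm (DD2 (s, y + t *\<^sub>R z) (0, z) (0, v))
        \<le> C * (norm (\<iota> z) * norm v + norm z * norm (\<iota> v) + norm (y + t *\<^sub>R z) * norm (\<iota> z) * norm (\<iota> v))"
        by (rule tame_boundD(4)[OF b])
      also have "\<dots> \<le> C * (norm (\<iota> z) * norm v + norm z * norm (\<iota> v) + (norm y + norm z) * norm (\<iota> z) * norm (\<iota> v))"
        using n d by (intro mult_left_mono add_mono mult_right_mono order_refl) auto
      finally show "norm (DD2 (s, y + t *\<^sub>R z) (0, z) (0, v)) \<le> \<dots>" .
    qed
  qed
  have 2: "norm (\<phi>2 (s, y + z) - \<phi>2 (s, y) - D2 (s, y) (0, z))
       \<le> C * (2 * (norm (\<iota> z) * norm z) + (norm y + norm z) * norm (\<iota> z) * norm (\<iota> z))"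
    if y: "\<iota> y = x s" and z: "norm (\<iota> z) < d" for s y z
  proof (rule segment_bound_affine[where f="\<lambda>z. \<phi>2 (s, z)" and L="\<lambda>z. D2 (s, y) (0, z)"])
    fix t :: real assume t: "0 \<le> t" "t \<le> 1"
    show "((\<lambda>z. \<phi>2 (s, z)) has_derivative (\<lambda>h. D2 (s, y + t *\<^sub>R z) (0, h))) (at (y + t *\<^sub>R z))"
      by (rule D_slice[OF D\<phi>2(1)[OF tame_boundD(1)[OF tb[OF that t]]]])
    have tz: "norm (t *\<^sub>R z) \<le> norm z" "norm (\<iota> (t *\<^sub>R z)) \<le> norm (\<iota> z)"
      using t by (simp_all add: \<iota>_simps mult_left_le_one_le)
    have "norm (D2 (s, y + t *\<^sub>R z) (0, z) - D2 (s, y) (0, z))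
      \<le> C * (norm (\<iota> (t *\<^sub>R z)) * norm z + norm (t *\<^sub>R z) * norm (\<iota> z)
            + (norm y + norm (t *\<^sub>R z)) * norm (\<iota> (t *\<^sub>R z)) * norm (\<iota> z))"
      using tz z by (intro 1 y) simp
    also have "\<dots> \<le> C * (norm (\<iota> z) * norm z + norm z * norm (\<iota> z) + (norm y + norm z) * norm (\<iota> z) * norm (\<iota> z))"
      using tz d by (intro mult_left_mono add_mono mult_mono order_refl) auto
    finally show "norm (D2 (s, y + t *\<^sub>R z) (0, z) - D2 (s, y) (0, z))
      \<le> C * (2 * (norm (\<iota> z) * norm z) + (norm y + norm z) * norm (\<iota> z) * norm (\<iota> z))"
      by (simp add: algebra_simps)
  next
    show "bounded_linear (\<lambda>z. D2 (s, y) (0, z))"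
      by (intro blinfun.bounded_linear_right[THEN bounded_linear_compose] bounded_linear_Pair
          bounded_linear_zero bounded_linear_ident)
  qed
  then have bounds: "H2_tube_bounds x d C"
    unfolding H2_tube_bounds_def using 1(1) by blast
  have CA: "0 \<le> C * A" using d A by simp
  obtain d1 where d1: "d1 > 0" "d1 * (C * A) \<le> e" using smallness_choice[OF e CA] by blast
  show ?thesis
  proof (rule that[of "min 1 (min d d1)" C])
    show "min 1 (min d d1) * (C * A) \<le> e"
      by (rule order_trans[OF mult_right_mono d1(2)]) (use CA in auto)
  qed (use bounds d d1 in \<open>auto simp: H2_tube_bounds_def\<close>)
qed

text \<open>
  The case \<open>c = 1\<close>, with \<open>\<eta>\<close> and \<open>k\<close> the derivatives of \<open>x\<close> and \<open>h\<close>, controls the weak derivative of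
  the first component of the tangent map; the case \<open>c = 0\<close> is its second component.
\<close>

lemma D1_path_remainder:
  assumes x: "x \<in> U" and \<eta>: "\<eta> \<in> L2" and e: "e > 0" and c: "\<bar>c\<bar> \<le> 1"
  obtains d where "d > 0" "\<And>h k. h \<in> E \<Longrightarrow> k \<in> L2 \<Longrightarrow> (\<lambda>s. x s + h s) \<in> U \<Longrightarrow> N h < d \<Longrightarrow> L2_seminorm k < d \<Longrightarrow>
    L2_seminorm (\<lambda>s. D1 (s, x s + h s) (c, \<eta> s + k s) - D1 (s, x s) (c, \<eta> s) - ddPhi c x \<eta> h k s) \<le> e * N h"
proof -
  have A: "0 \<le> 1 + L2_seminorm \<eta>" and e2: "e / 2 > 0" using e by (simp_all add: add_nonneg_nonneg)
  obtain e0 d K where e0: "e0 > 0" "e0 * (1 + L2_seminorm \<eta>) \<le> e / 2" and d: "d > 0"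
    and K: "K \<ge> 0" "d * K \<le> e / 2" and tube: "H1_tube_bounds x e0 d K"
    using H1_tube[OF x e2 A] by blast
  show ?thesis
  proof (rule that[OF d])
    fix h k :: "real \<Rightarrow> 'a" assume h: "h \<in> E" and k: "k \<in> L2" and y: "(\<lambda>s. x s + h s) \<in> U"
      and Nh: "N h < d" and nk: "L2_seminorm k < d"
    note hh = E_D[OF h]
    let ?f = "\<lambda>s. D1 (s, x s + h s) (c, \<eta> s + k s) - D1 (s, x s) (c, \<eta> s) - ddPhi c x \<eta> h k s"
    have m: "?f \<in> borel_measurable lebesgue"
      by (intro borel_measurable_diff D1_path_measurable[OF y] D1_path_measurable[OF x]
          ddPhi_measurable x \<eta> hh k L2_D(1) L2_add(1))
    have le: "norm (?f s) \<le> e0 * norm (h s) + (e0 * N h) * norm (\<eta> s) + (K * N h) * norm (k s) + 0 * norm (k s)" for s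
    proof -
      have hs: "norm (h s) \<le> N h" by (rule N_bounds(4)[OF h])
      then have "norm (h s) < d" using Nh by simp
      note t = tube[unfolded H1_tube_bounds_def, rule_format, OF this, of s]
      let ?A = "D1 (s, x s + h s) - D1 (s, x s) - DD1 (s, x s) (0, h s)"
      let ?B = "D1 (s, x s + h s) - D1 (s, x s)"
      \<comment> \<open>The first order remainder acts on the unperturbed vector, the increment of
        \<open>D1\<close> on \<open>k\<close>. The latter is a product of two increments, so that
        the final bound is a multiple of \<open>N h\<close> alone, \<open>k\<close> being merely
        small.\<close>
      have "?f s = ?A (c, \<eta> s) + ?B (0, k s)"
      proof -
        have "(c, \<eta> s + k s) = (c, \<eta> s) + (0, k s)" by simp
        then have "D1 (s, x s + h s) (c, \<eta> s + k s) = D1 (s, x s + h s) (c, \<eta> s) + D1 (s, x s + h s) (0, k s)"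
          by (metis blinfun.add_right)
        then show ?thesis by (simp add: ddPhi_def blinfun.diff_left)
      qed
      moreover have "norm (?A (c, \<eta> s)) \<le> e0 * norm (h s) * (1 + norm (\<eta> s))"
        by (rule order_trans[OF norm_blinfun mult_mono])
          (use t e0 norm_scalar_pair_le[OF c] in auto)
      moreover have "norm (?B (0, k s)) \<le> K * norm (h s) * norm (k s)"
        by (rule order_trans[OF norm_blinfun mult_mono]) (use t K in auto)
      ultimately have "norm (?f s) \<le> e0 * norm (h s) * (1 + norm (\<eta> s)) + K * norm (h s) * norm (k s)"
        by (metis norm_triangle_le add_mono)
      also have "\<dots> = e0 * norm (h s) + e0 * norm (h s) * norm (\<eta> s) + K * norm (h s) * norm (k s)"
        by (simp add: algebra_simps)
      also have "\<dots> \<le> e0 * norm (h s) + (e0 * N h) * norm (\<eta> s) + (K * N h) * norm (k s)"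
        using hs e0 K by (intro add_mono mult_right_mono mult_left_mono order_refl) auto
      finally show ?thesis by simp
    qed
    have nn: "0 \<le> e0 * N h" "0 \<le> K * N h" using e0 K N_nonneg by auto
    have "L2_seminorm ?f \<le> e0 * L2_seminorm h + (e0 * N h) * L2_seminorm \<eta> + (K * N h) * L2_seminorm k + 0 * L2_seminorm k"
      by (rule L2_dominated4(2)[OF m hh(3) \<eta> k k less_imp_le[OF e0(1)] nn order_refl always_eventually[OF allI[OF le]]])
    also have "\<dots> \<le> e0 * N h + (e0 * N h) * L2_seminorm \<eta> + (K * N h) * d + 0"
      using nn e0 N_bounds(3)[OF h] nk by (intro add_mono mult_left_mono order_refl) auto
    also have "\<dots> = (e0 * (1 + L2_seminorm \<eta>) + d * K) * N h" by (simp add: algebra_simps)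
    also have "\<dots> \<le> (e/2 + e/2) * N h" by (intro mult_right_mono add_mono e0 K(2) N_nonneg)
    finally show "L2_seminorm ?f \<le> e * N h" by simp
  qed
qed

text \<open>The difference consists of the change of \<open>DD1\<close> acting on the unperturbed
  \<open>(c, \<eta>)\<close>, of \<open>DD1\<close> acting on the small \<open>k\<close>, and of the
  change of \<open>D1\<close> acting on \<open>l\<close>. The radius \<open>d\<close> is the same
  for all directions \<open>(g, l)\<close>, which gives continuity in operator norm.\<close>

lemma ddPhi_continuous:
  assumes x: "x \<in> U" and \<eta>: "\<eta> \<in> L2" and e: "e > 0" and c: "\<bar>c\<bar> \<le> 1"
  obtains d where "d > 0" "\<And>h k g l. h \<in> E \<Longrightarrow> k \<in> L2 \<Longrightarrow> (\<lambda>s. x s + h s) \<in> U \<Longrightarrow> N h < d \<Longrightarrow> L2_seminorm k < d \<Longrightarrow>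
    g \<in> E \<Longrightarrow> l \<in> L2 \<Longrightarrow>
    L2_seminorm (\<lambda>s. ddPhi c (\<lambda>s. x s + h s) (\<lambda>s. \<eta> s + k s) g l s - ddPhi c x \<eta> g l s)
      \<le> e * (N g + L2_seminorm l)"
proof -
  have A: "0 \<le> 1 + L2_seminorm \<eta>" and e2: "e / 2 > 0" using e by (simp_all add: add_nonneg_nonneg)
  obtain e0 d K where e0: "e0 > 0" "e0 * (1 + L2_seminorm \<eta>) \<le> e / 2" and d: "d > 0"
    and K: "K \<ge> 0" "d * K \<le> e / 2" and tube: "H1_tube_bounds x e0 d K"
    using H1_tube[OF x e2 A] by blast
  show ?thesis
  proof (rule that[OF d])
    fix h k g l :: "real \<Rightarrow> 'a" assume h: "h \<in> E" and k: "k \<in> L2" and y: "(\<lambda>s. x s + h s) \<in> U"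
      and Nh: "N h < d" and nk: "L2_seminorm k < d" and g: "g \<in> E" and l: "l \<in> L2"
    note hh = E_D[OF h] and z = E_D[OF g]
    let ?f = "\<lambda>s. ddPhi c (\<lambda>s. x s + h s) (\<lambda>s. \<eta> s + k s) g l s - ddPhi c x \<eta> g l s"
    have m: "?f \<in> borel_measurable lebesgue"
      by (intro borel_measurable_diff ddPhi_measurable x y \<eta> z l L2_add(1) k)
    have le: "norm (?f s) \<le> e0 * norm (g s) + (e0 * N g) * norm (\<eta> s) + (K * N g) * norm (k s) + (K * N h) * norm (l s)" for s
    proof -
      have hs: "norm (h s) \<le> N h" by (rule N_bounds(4)[OF h])
      have zs: "norm (g s) \<le> N g" by (rule N_bounds(4)[OF g])
      from hs have "norm (h s) < d" using Nh by simp
      note t = tube[unfolded H1_tube_bounds_def, rule_format, OF this, of s]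
      let ?A = "DD1 (s, x s + h s) - DD1 (s, x s)"
      let ?B = "D1 (s, x s + h s) - D1 (s, x s)"
      have eq: "?f s = ?A (0, g s) (c, \<eta> s) + DD1 (s, x s + h s) (0, g s) (0, k s) + ?B (0, l s)"
      proof -
        have "(c, \<eta> s + k s) = (c, \<eta> s) + (0, k s)" by simp
        then have "DD1 (s, x s + h s) (0, g s) (c, \<eta> s + k s)
            = DD1 (s, x s + h s) (0, g s) (c, \<eta> s) + DD1 (s, x s + h s) (0, g s) (0, k s)"
          by (metis blinfun.add_right)
        then show ?thesis by (simp add: ddPhi_def blinfun.diff_left)
      qed
      have 1: "norm (?A (0, g s) (c, \<eta> s)) \<le> e0 * norm (g s) * (1 + norm (\<eta> s))"
        by (rule order_trans[OF norm_blinfun2 mult_mono[OF mult_mono]])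
          (use t e0 norm_scalar_pair_le[OF c] in auto)
      have 2: "norm (DD1 (s, x s + h s) (0, g s) (0, k s)) \<le> K * norm (g s) * norm (k s)"
        by (rule order_trans[OF norm_blinfun2 mult_mono[OF mult_mono]]) (use t K in auto)
      have 3: "norm (?B (0, l s)) \<le> K * norm (h s) * norm (l s)"
        by (rule order_trans[OF norm_blinfun mult_mono]) (use t K in auto)
      have "norm (?f s) \<le> e0 * norm (g s) * (1 + norm (\<eta> s)) + K * norm (g s) * norm (k s) + K * norm (h s) * norm (l s)"
        unfolding eq by (intro norm_triangle_le add_mono 1 2 3)
      also have "\<dots> = e0 * norm (g s) + e0 * norm (g s) * norm (\<eta> s) + K * norm (g s) * norm (k s) + K * norm (h s) * norm (l s)"
        by (simp add: algebra_simps)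
      also have "\<dots> \<le> e0 * norm (g s) + (e0 * N g) * norm (\<eta> s) + (K * N g) * norm (k s) + (K * N h) * norm (l s)"
        using hs zs e0 K by (intro add_mono mult_right_mono mult_left_mono order_refl) auto
      finally show ?thesis .
    qed
    have nn: "0 \<le> e0 * N g" "0 \<le> K * N g" "0 \<le> K * N h" using e0 K N_nonneg by auto
    have "L2_seminorm ?f \<le> e0 * L2_seminorm g + (e0 * N g) * L2_seminorm \<eta> + (K * N g) * L2_seminorm k + (K * N h) * L2_seminorm l"
      by (rule L2_dominated4(2)[OF m z(3) \<eta> k l less_imp_le[OF e0(1)] nn always_eventually[OF allI[OF le]]])
    also have "\<dots> \<le> e0 * N g + (e0 * N g) * L2_seminorm \<eta> + (K * N g) * d + (K * d) * L2_seminorm l"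
      using nn e0 K N_bounds(3)[OF g] nk Nh by (intro add_mono mult_left_mono mult_right_mono order_refl) auto
    also have "\<dots> = (e0 * (1 + L2_seminorm \<eta>) + d * K) * N g + (d * K) * L2_seminorm l" by (simp add: algebra_simps)
    also have "\<dots> \<le> (e/2 + e/2) * N g + (e/2) * L2_seminorm l"
      by (intro mult_right_mono add_mono e0 K(2) N_nonneg L2_seminorm_nonneg)
    also have "\<dots> \<le> e * (N g + L2_seminorm l)" using e by (simp add: algebra_simps)
    finally show "L2_seminorm ?f \<le> e * (N g + L2_seminorm l)" .
  qed
qed

section \<open>Remainder estimates in H2\<close>

lemma lift_add_AE:
  assumes x: "x \<in> E" and h: "h \<in> E"
  shows "AE s in lebesgue. lift (\<lambda>s. x s + h s) s = lift x s + lift h s"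
  using E_D(6)[OF x] E_D(6)[OF h]
  by eventually_elim (metis \<iota>_simps(1) inv_\<iota>)

text \<open>In \<open>3 + L2_seminorm (lift x)\<close> the 3 counts multiples of
  \<open>norm (lift h s)\<close>: two from the second order terms, one from the cubic term after one
  factor \<open>N h\<close> is bounded by 1. The integrated bound is quadratic in
  \<open>N h\<close>, and one factor is less than \<open>d\<close>.\<close>

lemma lift_remainder:
  assumes x: "x \<in> U" and e: "e > 0"
  obtains d where "d > 0" "\<And>h. h \<in> E \<Longrightarrow> (\<lambda>s. x s + h s) \<in> U \<Longrightarrow> N h < d \<Longrightarrow>
    L2_seminorm (\<lambda>s. \<phi>2 (s, lift (\<lambda>s. x s + h s) s) - \<phi>2 (s, lift x s) - D2 (s, lift x s) (0, lift h s)) \<le> e * N h"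
proof -
  have A: "0 \<le> 3 + L2_seminorm (lift x)" by (simp add: add_nonneg_nonneg)
  obtain d C where d: "d > 0" "d \<le> 1" and C: "C \<ge> 0" "d * (C * (3 + L2_seminorm (lift x))) \<le> e"
    and tube: "H2_tube_bounds x d C"
    using H2_tube[OF x e A] by blast
  show ?thesis
  proof (rule that[OF d(1)])
    fix h assume h: "h \<in> E" and y: "(\<lambda>s. x s + h s) \<in> U" and Nh: "N h < d"
    note hh = E_D[OF h] and xx = E_D[OF U_E[OF x]]
    let ?f = "\<lambda>s. \<phi>2 (s, lift (\<lambda>s. x s + h s) s) - \<phi>2 (s, lift x s) - D2 (s, lift x s) (0, lift h s)"
    have m: "?f \<in> borel_measurable lebesgue"
      by (intro borel_measurable_diff \<phi>2_path_measurable[OF y] \<phi>2_path_measurable[OF x] D2_path_measurable x h)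
    have le: "AE s in lebesgue. norm (?f s) \<le> (3 * C * N h) * norm (lift h s) + (C * N h * N h) * norm (lift x s)
       + 0 * norm (lift h s) + 0 * norm (lift h s)"
      using xx(6) hh(6) lift_add_AE[OF U_E[OF x] h]
    proof eventually_elim
      case (elim s)
      have hs: "norm (\<iota> (lift h s)) \<le> N h" using N_bounds(4)[OF h, of s] unfolding elim(2)[symmetric] .
      then have sm: "norm (\<iota> (lift h s)) < d" using Nh by simp
      have "norm (?f s) \<le> C * (2 * (norm (\<iota> (lift h s)) * norm (lift h s))
          + (norm (lift x s) + norm (lift h s)) * norm (\<iota> (lift h s)) * norm (\<iota> (lift h s)))"
        using tube[unfolded H2_tube_bounds_def, rule_format, OF elim(1)[symmetric] sm] unfolding elim(3) by blast
      also have "\<dots> \<le> C * (2 * (N h * norm (lift h s)) + (norm (lift x s) + norm (lift h s)) * N h * N h)"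
        using hs C N_nonneg[of h] by (intro mult_left_mono add_mono mult_mono order_refl) auto
      also have "\<dots> = (2 * C * N h) * norm (lift h s) + (C * N h * N h) * norm (lift h s) + (C * N h * N h) * norm (lift x s)"
        by (simp add: algebra_simps)
      also have "\<dots> \<le> (2 * C * N h) * norm (lift h s) + (C * N h * 1) * norm (lift h s) + (C * N h * N h) * norm (lift x s)"
        using Nh d(2) C(1) N_nonneg[of h] by (intro mult_left_mono mult_right_mono add_mono order_refl) auto
      finally show ?case by (simp add: algebra_simps)
    qed
    have nn: "0 \<le> 3 * C * N h" "0 \<le> C * N h * N h" "0 \<le> C * N h" using C N_nonneg[of h] by auto
    have "L2_seminorm ?f \<le> (3 * C * N h) * L2_seminorm (lift h) + (C * N h * N h) * L2_seminorm (lift x)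
        + 0 * L2_seminorm (lift h) + 0 * L2_seminorm (lift h)"
      by (rule L2_dominated4(2)[OF m hh(5) xx(5) hh(5) hh(5) nn(1,2) order_refl order_refl le])
    also have "\<dots> \<le> (3 * C * N h) * N h + (C * N h * N h) * L2_seminorm (lift x) + 0 + 0"
      using nn N_bounds(2)[OF h] by (intro add_mono mult_left_mono order_refl) auto
    also have "\<dots> = N h * (C * (3 + L2_seminorm (lift x))) * N h" by (simp add: algebra_simps)
    also have "\<dots> \<le> d * (C * (3 + L2_seminorm (lift x))) * N h"
      using Nh C by (intro mult_right_mono N_nonneg mult_nonneg_nonneg) (auto simp: add_nonneg_nonneg)
    also have "\<dots> \<le> e * N h" by (intro mult_right_mono C(2) N_nonneg)
    finally show "L2_seminorm ?f \<le> e * N h" .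
  qed
qed

text \<open>The increments take turns: \<open>h\<close> is bounded in H1 while \<open>lift g\<close>
  is in L2, and conversely. Of the 3, one comes from the former pairing and two from the latter, one
  of these after a factor \<open>N h\<close> is bounded by 1.\<close>

lemma lift_continuous:
  assumes x: "x \<in> U" and e: "e > 0"
  obtains d where "d > 0" "\<And>h g. h \<in> E \<Longrightarrow> (\<lambda>s. x s + h s) \<in> U \<Longrightarrow> N h < d \<Longrightarrow> g \<in> E \<Longrightarrow>
    L2_seminorm (\<lambda>s. D2 (s, lift (\<lambda>s. x s + h s) s) (0, lift g s) - D2 (s, lift x s) (0, lift g s)) \<le> e * N g"
proof -
  have A: "0 \<le> 3 + L2_seminorm (lift x)" by (simp add: add_nonneg_nonneg)
  obtain d C where d: "d > 0" "d \<le> 1" and C: "C \<ge> 0" "d * (C * (3 + L2_seminorm (lift x))) \<le> e"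
    and tube: "H2_tube_bounds x d C"
    using H2_tube[OF x e A] by blast
  show ?thesis
  proof (rule that[OF d(1)])
    fix h g assume h: "h \<in> E" and y: "(\<lambda>s. x s + h s) \<in> U" and Nh: "N h < d" and g: "g \<in> E"
    note hh = E_D[OF h] and xx = E_D[OF U_E[OF x]] and zz = E_D[OF g]
    let ?f = "\<lambda>s. D2 (s, lift (\<lambda>s. x s + h s) s) (0, lift g s) - D2 (s, lift x s) (0, lift g s)"
    have m: "?f \<in> borel_measurable lebesgue"
      by (intro borel_measurable_diff D2_path_measurable[OF y] D2_path_measurable[OF x] g)
    have le: "AE s in lebesgue. norm (?f s) \<le> (C * N h) * norm (lift g s) + (2 * C * N g) * norm (lift h s)
       + (C * N h * N g) * norm (lift x s) + 0 * norm (lift h s)"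
      using xx(6) hh(6) zz(6) lift_add_AE[OF U_E[OF x] h]
    proof eventually_elim
      case (elim s)
      have hs: "norm (\<iota> (lift h s)) \<le> N h" using N_bounds(4)[OF h, of s] unfolding elim(2)[symmetric] .
      have zs: "norm (\<iota> (lift g s)) \<le> N g" using N_bounds(4)[OF g, of s] unfolding elim(3)[symmetric] .
      from hs have sm: "norm (\<iota> (lift h s)) < d" using Nh by simp
      have "norm (?f s) \<le> C * (norm (\<iota> (lift h s)) * norm (lift g s) + norm (lift h s) * norm (\<iota> (lift g s))
          + (norm (lift x s) + norm (lift h s)) * norm (\<iota> (lift h s)) * norm (\<iota> (lift g s)))"
        using tube[unfolded H2_tube_bounds_def, rule_format, OF elim(1)[symmetric] sm] unfolding elim(4) by blast
      also have "\<dots> \<le> C * (N h * norm (lift g s) + norm (lift h s) * N g + (norm (lift x s) + norm (lift h s)) * N h * N g)"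
        using hs zs C N_nonneg[of h] N_nonneg[of g] by (intro mult_left_mono add_mono mult_mono order_refl) auto
      also have "\<dots> = (C * N h) * norm (lift g s) + (C * N g) * norm (lift h s)
          + (C * N h * N g) * norm (lift x s) + N h * ((C * N g) * norm (lift h s))"
        by (simp add: algebra_simps)
      also have "\<dots> \<le> (C * N h) * norm (lift g s) + (C * N g) * norm (lift h s)
          + (C * N h * N g) * norm (lift x s) + 1 * ((C * N g) * norm (lift h s))"
        using Nh d(2) C(1) N_nonneg[of g] by (intro mult_right_mono add_mono order_refl) auto
      finally show ?case by (simp add: algebra_simps)
    qed
    have nn: "0 \<le> C * N h" "0 \<le> 2 * C * N g" "0 \<le> C * N h * N g"
      using C N_nonneg[of h] N_nonneg[of g] by auto
    have "L2_seminorm ?f \<le> (C * N h) * L2_seminorm (lift g) + (2 * C * N g) * L2_seminorm (lift h)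
       + (C * N h * N g) * L2_seminorm (lift x) + 0 * L2_seminorm (lift h)"
      by (rule L2_dominated4(2)[OF m zz(5) hh(5) xx(5) hh(5) nn order_refl le])
    also have "\<dots> \<le> (C * N h) * N g + (2 * C * N g) * N h + (C * N h * N g) * L2_seminorm (lift x) + 0"
      using nn N_bounds(2)[OF h] N_bounds(2)[OF g] by (intro add_mono mult_left_mono order_refl) auto
    also have "\<dots> = N h * (C * (3 + L2_seminorm (lift x))) * N g" by (simp add: algebra_simps)
    also have "\<dots> \<le> d * (C * (3 + L2_seminorm (lift x))) * N g"
      using Nh C by (intro mult_right_mono N_nonneg mult_nonneg_nonneg) (auto simp: add_nonneg_nonneg)
    also have "\<dots> \<le> e * N g" by (intro mult_right_mono C(2) N_nonneg)
    finally show "L2_seminorm ?f \<le> e * N g" .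
  qed
qed

end

section \<open>The weak tangent map\<close>

lemma slice_add:
  fixes A :: "(real \<times> 'a::real_normed_vector) \<Rightarrow>\<^sub>L 'c::real_normed_vector"
  shows "A (0, a + b) = A (0, a) + A (0, b)"
  using blinfun.add_right[of A "(0, a)" "(0, b)"] by simp

lemma slice_scaleR:
  fixes A :: "(real \<times> 'a::real_normed_vector) \<Rightarrow>\<^sub>L 'c::real_normed_vector"
  shows "A (0, c *\<^sub>R a) = c *\<^sub>R A (0, a)"
  using blinfun.scaleR_right[of A c "(0, a)"] by simp

context tame_map
begin

lemma N_le:
  assumes "f \<in> L2" "primitive_of f g" "g \<in> L2" "AE s in lebesgue. f s = \<iota> (f2 s)" "f2 \<in> L2"
  shows "N f \<le> L2_seminorm g + L2_seminorm f2"
  unfolding E_I(2)[OF assms] by (rule sqrt_sum_squares_le_sum) simp_all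

lemma dPhi_E:
  assumes x: "x \<in> U" and h: "h \<in> E"
  shows "dPhi x h \<in> E"
    "N (dPhi x h) \<le> L2_seminorm (ddPhi 1 x (weak_deriv x) h (weak_deriv h))
       + L2_seminorm (\<lambda>s. D2 (s, lift x s) (0, lift h s))"
proof -
  note xx = E_D[OF U_E[OF x]] and hh = E_D[OF h]
  have d: "ddPhi 1 x (weak_deriv x) h (weak_deriv h) \<in> L2"
  proof -
    obtain C where C: "C \<ge> 0" "\<And>c \<eta> h k. \<bar>c\<bar> \<le> 1 \<Longrightarrow> \<eta> \<in> L2 \<Longrightarrow> h \<in> E \<Longrightarrow> k \<in> L2 \<Longrightarrow>
        ddPhi c x \<eta> h k \<in> L2 \<and>
        L2_seminorm (ddPhi c x \<eta> h k) \<le> C * ((1 + L2_seminorm \<eta>) * N h + L2_seminorm k)"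
      using ddPhi_L2[OF x] by blast
    then show ?thesis using xx hh h by auto
  qed
  have l: "(\<lambda>s. D2 (s, lift x s) (0, lift h s)) \<in> L2"
    using dPhi_lift[OF x] h by blast
  note * = dPhi_L2[OF x hh(3)] dPhi_primitive[OF x xx(1) hh(1)] d dPhi_lift_AE[OF x h] l
  show "dPhi x h \<in> E" by (rule E_I(1)[OF *])
  show "N (dPhi x h) \<le> L2_seminorm (ddPhi 1 x (weak_deriv x) h (weak_deriv h))
       + L2_seminorm (\<lambda>s. D2 (s, lift x s) (0, lift h s))" by (rule N_le[OF *])
qed

lemma ddPhi_mem:
  assumes "x \<in> U" "\<bar>c\<bar> \<le> 1" "\<eta> \<in> L2" "h \<in> E" "k \<in> L2"
  shows "ddPhi c x \<eta> h k \<in> L2"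
  using ddPhi_L2[OF assms(1)] assms(2-) by metis

lemma dPhi_lift_mem:
  assumes "x \<in> U" "h \<in> E"
  shows "(\<lambda>s. D2 (s, lift x s) (0, lift h s)) \<in> L2"
  using dPhi_lift[OF assms(1)] assms(2) by blast

text \<open>The remainder is itself a primitive, of the first order remainder of \<open>D1\<close>
  with \<open>c = 1\<close>, \<eta> the derivative of \<open>x\<close> and \<open>k\<close> that of
  \<open>h\<close>; its lift is the H2 remainder. As \<open>N h\<close> dominates \<open>k\<close>,
  one smallness condition controls both.\<close>

lemma superposition_remainder:
  assumes x: "x \<in> U" and e: "e > 0"
  obtains d where "d > 0" "\<And>h. h \<in> E \<Longrightarrow> (\<lambda>s. x s + h s) \<in> U \<Longrightarrow> N h < d \<Longrightarrow>
    N (\<lambda>s. superposition \<phi> (\<lambda>s. x s + h s) s - superposition \<phi> x s - dPhi x h s) \<le> e * N h"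
proof -
  note xx = E_D[OF U_E[OF x]]
  let ?x' = "weak_deriv x"
  have e2: "e / 2 > 0" using e by simp
  obtain d1 where d1: "d1 > 0" "\<And>h k. h \<in> E \<Longrightarrow> k \<in> L2 \<Longrightarrow> (\<lambda>s. x s + h s) \<in> U \<Longrightarrow> N h < d1 \<Longrightarrow> L2_seminorm k < d1 \<Longrightarrow>
    L2_seminorm (\<lambda>s. D1 (s, x s + h s) (1, ?x' s + k s) - D1 (s, x s) (1, ?x' s) - ddPhi 1 x ?x' h k s) \<le> e / 2 * N h"
    using D1_path_remainder[OF x xx(2) e2, of 1] by auto
  obtain d2 where d2: "d2 > 0" "\<And>h. h \<in> E \<Longrightarrow> (\<lambda>s. x s + h s) \<in> U \<Longrightarrow> N h < d2 \<Longrightarrow>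
    L2_seminorm (\<lambda>s. \<phi>2 (s, lift (\<lambda>s. x s + h s) s) - \<phi>2 (s, lift x s) - D2 (s, lift x s) (0, lift h s)) \<le> e / 2 * N h"
    using lift_remainder[OF x e2] by blast
  show ?thesis
  proof (rule that[of "min d1 d2"])
    show "0 < min d1 d2" using d1 d2 by simp
    fix h assume h: "h \<in> E" and y: "(\<lambda>s. x s + h s) \<in> U" (is "?y \<in> U") and Nh: "N h < min d1 d2"
    note hh = E_D[OF h]
    note yd = primitive_of_add[OF xx(1) hh(1)]
    note L = L2_add(1)[OF xx(2) hh(2)]
    let ?r = "\<lambda>s. superposition \<phi> ?y s - superposition \<phi> x s - dPhi x h s"
    have "N ?r \<le> L2_seminorm (\<lambda>s. D1 (s, x s + h s) (1, ?x' s + weak_deriv h s) - D1 (s, x s) (1, ?x' s)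
          - ddPhi 1 x ?x' h (weak_deriv h) s)
        + L2_seminorm (\<lambda>s. \<phi>2 (s, lift ?y s) - \<phi>2 (s, lift x s) - D2 (s, lift x s) (0, lift h s))"
    proof (rule N_le)
      show "?r \<in> L2"
        by (intro L2_diff(1) superposition_L2 dPhi_L2 x y hh)
      show "primitive_of ?r (\<lambda>s. D1 (s, x s + h s) (1, ?x' s + weak_deriv h s) - D1 (s, x s) (1, ?x' s)
          - ddPhi 1 x ?x' h (weak_deriv h) s)"
        by (intro primitive_of_diff superposition_deriv(1)[OF y yd L] superposition_deriv(1)[OF x] dPhi_primitive x xx hh)
      show "(\<lambda>s. D1 (s, x s + h s) (1, ?x' s + weak_deriv h s) - D1 (s, x s) (1, ?x' s)
          - ddPhi 1 x ?x' h (weak_deriv h) s) \<in> L2"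
        by (intro L2_diff(1) superposition_deriv(2)[OF y yd L] superposition_deriv(2)[OF x xx(1,2)] ddPhi_mem x xx hh h) simp
      show "AE s in lebesgue. ?r s = \<iota> (\<phi>2 (s, lift ?y s) - \<phi>2 (s, lift x s) - D2 (s, lift x s) (0, lift h s))"
        using superposition_lift(2)[OF y] superposition_lift(2)[OF x] dPhi_lift_AE[OF x h]
        by eventually_elim (simp only: \<iota>_simps)
      show "(\<lambda>s. \<phi>2 (s, lift ?y s) - \<phi>2 (s, lift x s) - D2 (s, lift x s) (0, lift h s)) \<in> L2"
        by (intro L2_diff(1) superposition_lift(1)[OF y] superposition_lift(1)[OF x] dPhi_lift_mem x h)
    qed
    also have "\<dots> \<le> e / 2 * N h + e / 2 * N h"
      using Nh N_bounds(1)[OF h] by (intro add_mono d1(2) d2(2) h hh y) auto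
    finally show "N ?r \<le> e * N h" by simp
  qed
qed

lemma dPhi_continuous:
  assumes x: "x \<in> U" and e: "e > 0"
  obtains d where "d > 0" "\<And>h g. h \<in> E \<Longrightarrow> (\<lambda>s. x s + h s) \<in> U \<Longrightarrow> N h < d \<Longrightarrow> g \<in> E \<Longrightarrow>
    N (\<lambda>s. dPhi (\<lambda>s. x s + h s) g s - dPhi x g s) \<le> e * N g"
proof -
  note xx = E_D[OF U_E[OF x]]
  let ?x' = "weak_deriv x"
  \<comment> \<open>One third is for the lift and two for the weak derivative, since
    \<open>N g + L2_seminorm (weak_deriv g)\<close> is at most \<open>2 * N g\<close>.\<close>
  have e3: "e / 3 > 0" using e by simp
  obtain d1 where d1: "d1 > 0" "\<And>h k g l. h \<in> E \<Longrightarrow> k \<in> L2 \<Longrightarrow> (\<lambda>s. x s + h s) \<in> U \<Longrightarrow> N h < d1 \<Longrightarrow> L2_seminorm k < d1 \<Longrightarrow>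
    g \<in> E \<Longrightarrow> l \<in> L2 \<Longrightarrow>
    L2_seminorm (\<lambda>s. ddPhi 1 (\<lambda>s. x s + h s) (\<lambda>s. ?x' s + k s) g l s - ddPhi 1 x ?x' g l s)
      \<le> e / 3 * (N g + L2_seminorm l)"
    using ddPhi_continuous[OF x xx(2) e3, of 1] by auto
  obtain d2 where d2: "d2 > 0" "\<And>h g. h \<in> E \<Longrightarrow> (\<lambda>s. x s + h s) \<in> U \<Longrightarrow> N h < d2 \<Longrightarrow> g \<in> E \<Longrightarrow>
    L2_seminorm (\<lambda>s. D2 (s, lift (\<lambda>s. x s + h s) s) (0, lift g s) - D2 (s, lift x s) (0, lift g s)) \<le> e / 3 * N g"
    using lift_continuous[OF x e3] by blast
  show ?thesis
  proof (rule that[of "min d1 d2"])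
    show "0 < min d1 d2" using d1 d2 by simp
    fix h g assume h: "h \<in> E" and y: "(\<lambda>s. x s + h s) \<in> U" (is "?y \<in> U") and Nh: "N h < min d1 d2" and g: "g \<in> E"
    note hh = E_D[OF h] and zz = E_D[OF g]
    note yd = primitive_of_add[OF xx(1) hh(1)]
    note L = L2_add(1)[OF xx(2) hh(2)]
    let ?y' = "\<lambda>s. ?x' s + weak_deriv h s"
    let ?r = "\<lambda>s. dPhi ?y g s - dPhi x g s"
    have "N ?r \<le> L2_seminorm (\<lambda>s. ddPhi 1 ?y ?y' g (weak_deriv g) s - ddPhi 1 x ?x' g (weak_deriv g) s)
        + L2_seminorm (\<lambda>s. D2 (s, lift ?y s) (0, lift g s) - D2 (s, lift x s) (0, lift g s))"
    proof (rule N_le)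
      show "?r \<in> L2" by (intro L2_diff(1) dPhi_L2 x y zz)
      show "primitive_of ?r (\<lambda>s. ddPhi 1 ?y ?y' g (weak_deriv g) s - ddPhi 1 x ?x' g (weak_deriv g) s)"
        by (intro primitive_of_diff dPhi_primitive[OF y yd] dPhi_primitive[OF x xx(1)] zz)
      show "(\<lambda>s. ddPhi 1 ?y ?y' g (weak_deriv g) s - ddPhi 1 x ?x' g (weak_deriv g) s) \<in> L2"
        by (intro L2_diff(1) ddPhi_mem x y L xx zz g) simp_all
      show "AE s in lebesgue. ?r s = \<iota> (D2 (s, lift ?y s) (0, lift g s) - D2 (s, lift x s) (0, lift g s))"
        using dPhi_lift_AE[OF y g] dPhi_lift_AE[OF x g] by eventually_elim (simp only: \<iota>_simps)
      show "(\<lambda>s. D2 (s, lift ?y s) (0, lift g s) - D2 (s, lift x s) (0, lift g s)) \<in> L2"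
        by (intro L2_diff(1) dPhi_lift_mem x y g)
    qed
    also have "\<dots> \<le> e / 3 * (N g + L2_seminorm (weak_deriv g)) + e / 3 * N g"
      using Nh N_bounds(1)[OF h] by (intro add_mono d1(2) d2(2) h hh y g zz) auto
    also have "\<dots> \<le> e / 3 * (N g + N g) + e / 3 * N g"
      using e N_bounds(1)[OF g] by (intro add_mono mult_left_mono order_refl) auto
    finally show "N ?r \<le> e * N g" by simp
  qed
qed

section \<open>The product norm and the derivative of the tangent map\<close>

abbreviation "P \<equiv> tangent_norm \<iota>"

lemma P_bounds: "N h \<le> P (h, k)" "L2_seminorm k \<le> P (h, k)" "P (h, k) \<le> N h + L2_seminorm k"
  unfolding tangent_norm_def
  by (simp_all add: real_le_rsqrt sqrt_sum_squares_le_sum N_nonneg)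

lemma weak_tangent_eq:
  "x \<in> U \<Longrightarrow> weak_tangent_map \<phi> (x, \<eta>) = (superposition \<phi> x, dPhi x \<eta>)"
  by (simp add: weak_tangent_map_def d_superposition_eq)

lemma weak_tangent_mem:
  assumes "p \<in> U \<times> L2"
  shows "weak_tangent_map \<phi> p \<in> E \<times> L2"
  using assms by (auto simp: weak_tangent_eq superposition_E dPhi_L2)

text \<open>\<open>N\<close> dominates the sup norm in H1, and a tube of uniform radius around the
  graph of \<open>x\<close> lies in \<open>O1\<close>; the uniformity in \<open>s\<close> comes from
  the compact hull.\<close>

lemma path_domain_open:
  assumes x: "x \<in> U"
  obtains d where "d > 0" "\<And>y. y \<in> E \<Longrightarrow> N (\<lambda>s. y s - x s) < d \<Longrightarrow> y \<in> U"
proof -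
  obtain d where d: "d > 0" and tube: "\<And>s z. norm (z - x s) < d \<Longrightarrow>
    (s, z) \<in> O1 \<and> norm (DD1 (s, z) - DD1 (s, x s)) < 1"
    using uniform_tube[OF U_admissible[OF x] zero_less_one] by blast
  show ?thesis
  proof (rule that[OF d])
    fix y assume y: "y \<in> E" and n: "N (\<lambda>s. y s - x s) < d"
    have "norm (y s - x s) < d" for s
      using N_bounds(4)[OF E_diff[OF y U_E[OF x]], of s] n by linarith
    then show "y \<in> U" using tube y by (auto simp: path_domain_def)
  qed
qed

text \<open>The candidate derivative is block triangular: \<open>k\<close> does not affect the first
  component.\<close>

definition "DT = (\<lambda>(x, \<eta>) (h, k). (dPhi x h, ddPhi 0 x \<eta> h k))"

lemma DT_bounded_linear:
  assumes x: "x \<in> U" and \<eta>: "\<eta> \<in> L2"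
  shows "bounded_linear_between (tangent_space \<iota>) P (tangent_space \<iota>) P (DT (x, \<eta>))"
  unfolding bounded_linear_between_def
proof (intro conjI ballI allI)
  fix p assume p: "p \<in> tangent_space \<iota>"
  then show "DT (x, \<eta>) p \<in> tangent_space \<iota>"
    using x \<eta> by (auto simp: tangent_space_def DT_def dPhi_E ddPhi_mem)
next
  fix p q
  show "DT (x, \<eta>) (p + q) = DT (x, \<eta>) p + DT (x, \<eta>) q"
    by (cases p; cases q) (simp add: DT_def dPhi_def ddPhi_def plus_fun_def fun_eq_iff
        slice_add blinfun.add_left)
next
  fix c p
  show "DT (x, \<eta>) (c *\<^sub>R p) = c *\<^sub>R DT (x, \<eta>) p"
    by (cases p) (simp add: DT_def dPhi_def ddPhi_def scaleR_fun_def fun_eq_iff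
        slice_scaleR blinfun.scaleR_left scaleR_add_right)
next
  let ?x' = "weak_deriv x"
  note xx = E_D[OF U_E[OF x]]
  obtain C1 where C1: "C1 \<ge> 0" "\<And>c \<eta> h k. \<bar>c\<bar> \<le> 1 \<Longrightarrow> \<eta> \<in> L2 \<Longrightarrow> h \<in> E \<Longrightarrow> k \<in> L2 \<Longrightarrow>
    ddPhi c x \<eta> h k \<in> L2 \<and>
    L2_seminorm (ddPhi c x \<eta> h k) \<le> C1 * ((1 + L2_seminorm \<eta>) * N h + L2_seminorm k)"
    using ddPhi_L2[OF x] by blast
  obtain C2 where C2: "C2 \<ge> 0" "\<And>h. h \<in> E \<Longrightarrow> (\<lambda>s. D2 (s, lift x s) (0, lift h s)) \<in> L2 \<and>
    L2_seminorm (\<lambda>s. D2 (s, lift x s) (0, lift h s)) \<le> C2 * (1 + L2_seminorm (lift x)) * N h"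
    using dPhi_lift[OF x] by blast
  \<comment> \<open>One summand each for the weak derivative of \<open>dPhi x h\<close>, for its
    lift and for the second component; the inner \<open>+ 1\<close> account for
    \<open>weak_deriv h\<close> and \<open>k\<close>.\<close>
  let ?C = "C1 * ((1 + L2_seminorm ?x') + 1) + C2 * (1 + L2_seminorm (lift x)) + C1 * ((1 + L2_seminorm \<eta>) + 1)"
  show "\<exists>C. \<forall>p\<in>tangent_space \<iota>. P (DT (x, \<eta>) p) \<le> C * P p"
  proof (intro exI[of _ ?C] ballI)
    fix p assume "p \<in> tangent_space \<iota>"
    then obtain h k where p: "p = (h, k)" and h: "h \<in> E" and k: "k \<in> L2" by (auto simp: tangent_space_def)
    note hh = E_D[OF h]
    note b = P_bounds(1,2)[of h k] P_bounds(2)[where k=k and h=h]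
    have "P (DT (x, \<eta>) p) \<le> N (dPhi x h) + L2_seminorm (ddPhi 0 x \<eta> h k)"
      unfolding p DT_def using P_bounds(3) by simp
    also have "\<dots> \<le> (C1 * ((1 + L2_seminorm ?x') * N h + L2_seminorm (weak_deriv h))
        + C2 * (1 + L2_seminorm (lift x)) * N h) + C1 * ((1 + L2_seminorm \<eta>) * N h + L2_seminorm k)"
      using C1(2)[OF _ xx(2) h hh(2), of 1] C2(2)[OF h] C1(2)[OF _ \<eta> h k, of 0]
      by (intro add_mono order_trans[OF dPhi_E(2)[OF x h]]) auto
    also have "\<dots> \<le> (C1 * ((1 + L2_seminorm ?x') * P p + P p)
        + C2 * (1 + L2_seminorm (lift x)) * P p) + C1 * ((1 + L2_seminorm \<eta>) * P p + P p)"
      unfolding p using C1(1) C2(1) b order_trans[OF N_bounds(1)[OF h] b(1)]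
      by (intro add_mono mult_left_mono mult_nonneg_nonneg) auto
    also have "\<dots> = ?C * P p" by (simp add: algebra_simps)
    finally show "P (DT (x, \<eta>) p) \<le> ?C * P p" .
  qed
qed

lemma C1_map_weak_tangent:
  "C1_map (tangent_space \<iota>) P (tangent_space \<iota>) P (U \<times> L2) (weak_tangent_map \<phi>)"
  unfolding C1_map_def
proof (intro conjI exI[of _ DT] ballI allI impI)
  show "open_in_seminormed (tangent_space \<iota>) P (U \<times> L2)"
    unfolding open_in_seminormed_def
  proof (intro conjI ballI)
    show "U \<times> L2 \<subseteq> tangent_space \<iota>" by (auto simp: tangent_space_def U_E)
    fix p :: "(real \<Rightarrow> 'a) \<times> (real \<Rightarrow> 'a)" assume "p \<in> U \<times> L2"
    then obtain x \<eta> where p: "p = (x, \<eta>)" "x \<in> U" by auto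
    obtain d where d: "d > 0" "\<And>y. y \<in> E \<Longrightarrow> N (\<lambda>s. y s - x s) < d \<Longrightarrow> y \<in> U"
      using path_domain_open[OF p(2)] by blast
    have "q \<in> U \<times> L2" if "q \<in> tangent_space \<iota>" "P (q - p) < d" for q
    proof -
      obtain y \<eta>' where q: "q = (y, \<eta>')" by fastforce
      have "N (\<lambda>s. y s - x s) < d"
        using that(2) P_bounds(1)[of "\<lambda>s. y s - x s" "\<lambda>s. \<eta>' s - \<eta> s"]
        by (simp add: q p fun_diff_def)
      then show ?thesis using d(2)[of y] that(1) by (auto simp: q tangent_space_def)
    qed
    then show "\<exists>d>0. \<forall>q\<in>tangent_space \<iota>. P (q - p) < d \<longrightarrow> q \<in> U \<times> L2" using d(1) by blast
  qed
next
  fix p :: "(real \<Rightarrow> 'a) \<times> (real \<Rightarrow> 'a)" assume "p \<in> U \<times> L2"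
  then show "weak_tangent_map \<phi> p \<in> tangent_space \<iota>"
    using weak_tangent_mem by (simp add: tangent_space_def)
next
  fix p :: "(real \<Rightarrow> 'a) \<times> (real \<Rightarrow> 'a)" assume "p \<in> U \<times> L2"
  then show "bounded_linear_between (tangent_space \<iota>) P (tangent_space \<iota>) P (DT p)"
    using DT_bounded_linear by (cases p) auto
next
  fix p :: "(real \<Rightarrow> 'a) \<times> (real \<Rightarrow> 'a)" and e :: real assume "p \<in> U \<times> L2" and e: "e > 0"
  then obtain x \<eta> where p: "p = (x, \<eta>)" and x: "x \<in> U" and \<eta>: "\<eta> \<in> L2" by auto
  have e2: "e / 2 > 0" using e by simp
  obtain d1 where d1: "d1 > 0" "\<And>h. h \<in> E \<Longrightarrow> (\<lambda>s. x s + h s) \<in> U \<Longrightarrow> N h < d1 \<Longrightarrow>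
    N (\<lambda>s. superposition \<phi> (\<lambda>s. x s + h s) s - superposition \<phi> x s - dPhi x h s) \<le> e / 2 * N h"
    using superposition_remainder[OF x e2] by blast
  obtain d2 where d2: "d2 > 0" "\<And>h k. h \<in> E \<Longrightarrow> k \<in> L2 \<Longrightarrow> (\<lambda>s. x s + h s) \<in> U \<Longrightarrow> N h < d2 \<Longrightarrow> L2_seminorm k < d2 \<Longrightarrow>
    L2_seminorm (\<lambda>s. D1 (s, x s + h s) (0, \<eta> s + k s) - D1 (s, x s) (0, \<eta> s) - ddPhi 0 x \<eta> h k s) \<le> e / 2 * N h"
    using D1_path_remainder[OF x \<eta> e2, of 0] by auto
  have "P (weak_tangent_map \<phi> q - weak_tangent_map \<phi> p - DT p (q - p)) \<le> e * P (q - p)"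
    if q: "q \<in> U \<times> L2" and small: "P (q - p) < min d1 d2" for q
  proof -
    obtain y \<eta>' where q': "q = (y, \<eta>')" and y: "y \<in> U" and \<eta>': "\<eta>' \<in> L2" using q by auto
    define h k where "h = (\<lambda>s. y s - x s)" and "k = (\<lambda>s. \<eta>' s - \<eta> s)"
    have qp: "q - p = (h, k)" by (simp add: q' p h_def k_def fun_diff_def)
    have yh: "y = (\<lambda>s. x s + h s)" and ek: "\<eta>' = (\<lambda>s. \<eta> s + k s)" by (simp_all add: h_def k_def)
    have h: "h \<in> E" unfolding h_def by (intro E_diff U_E x y)
    have k: "k \<in> L2" unfolding k_def by (intro L2_diff(1) \<eta> \<eta>')
    have sm: "N h < d1" "N h < d2" "L2_seminorm k < d2"
      using small P_bounds(1,2)[of h k] P_bounds(2)[where h=h and k=k] unfolding qp by linarith+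
    have "weak_tangent_map \<phi> q - weak_tangent_map \<phi> p - DT p (q - p)
      = ((\<lambda>s. superposition \<phi> (\<lambda>s. x s + h s) s - superposition \<phi> x s - dPhi x h s),
         (\<lambda>s. D1 (s, x s + h s) (0, \<eta> s + k s) - D1 (s, x s) (0, \<eta> s) - ddPhi 0 x \<eta> h k s))"
      unfolding qp unfolding q' p weak_tangent_eq[OF x] weak_tangent_eq[OF y] DT_def
      by (simp add: fun_diff_def dPhi_def yh[symmetric] ek[symmetric] fun_cong[OF yh, symmetric] fun_cong[OF ek, symmetric])
    then have "P (weak_tangent_map \<phi> q - weak_tangent_map \<phi> p - DT p (q - p)) \<le> e / 2 * N h + e / 2 * N h"
      using d1(2)[OF h _ sm(1)] d2(2)[OF h k _ sm(2,3)] y unfolding yh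
      by (auto intro!: order_trans[OF P_bounds(3)] add_mono)
    also have "\<dots> = e * N h" by simp
    also have "\<dots> \<le> e * P (q - p)" unfolding qp using e P_bounds(1) by (intro mult_left_mono) auto
    finally show ?thesis .
  qed
  then show "\<exists>d>0. \<forall>q\<in>U \<times> L2. P (q - p) < d \<longrightarrow>
      P (weak_tangent_map \<phi> q - weak_tangent_map \<phi> p - DT p (q - p)) \<le> e * P (q - p)"
    using d1(1) d2(1) by (intro exI[of _ "min d1 d2"]) auto
next
  fix p :: "(real \<Rightarrow> 'a) \<times> (real \<Rightarrow> 'a)" and e :: real assume "p \<in> U \<times> L2" and e: "e > 0"
  then obtain x \<eta> where p: "p = (x, \<eta>)" and x: "x \<in> U" and \<eta>: "\<eta> \<in> L2" by auto
  \<comment> \<open>The second component is controlled by \<open>N g + L2_seminorm l\<close>, at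
    most twice the product norm; the remaining third goes to the first component.\<close>
  have e3: "e / 3 > 0" using e by simp
  obtain d1 where d1: "d1 > 0" "\<And>h g. h \<in> E \<Longrightarrow> (\<lambda>s. x s + h s) \<in> U \<Longrightarrow> N h < d1 \<Longrightarrow> g \<in> E \<Longrightarrow>
    N (\<lambda>s. dPhi (\<lambda>s. x s + h s) g s - dPhi x g s) \<le> e / 3 * N g"
    using dPhi_continuous[OF x e3] by blast
  obtain d2 where d2: "d2 > 0" "\<And>h k g l. h \<in> E \<Longrightarrow> k \<in> L2 \<Longrightarrow> (\<lambda>s. x s + h s) \<in> U \<Longrightarrow> N h < d2 \<Longrightarrow> L2_seminorm k < d2 \<Longrightarrow>
    g \<in> E \<Longrightarrow> l \<in> L2 \<Longrightarrow>
    L2_seminorm (\<lambda>s. ddPhi 0 (\<lambda>s. x s + h s) (\<lambda>s. \<eta> s + k s) g l s - ddPhi 0 x \<eta> g l s)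
      \<le> e / 3 * (N g + L2_seminorm l)"
    using ddPhi_continuous[OF x \<eta> e3, of 0] by auto
  have "P (DT q r - DT p r) \<le> e * P r"
    if q: "q \<in> U \<times> L2" and small: "P (q - p) < min d1 d2" and r: "r \<in> tangent_space \<iota>" for q r
  proof -
    obtain y \<eta>' where q': "q = (y, \<eta>')" and y: "y \<in> U" and \<eta>': "\<eta>' \<in> L2" using q by auto
    obtain g l where r': "r = (g, l)" and g: "g \<in> E" and l: "l \<in> L2" using r by (auto simp: tangent_space_def)
    define h k where "h = (\<lambda>s. y s - x s)" and "k = (\<lambda>s. \<eta>' s - \<eta> s)"
    have qp: "q - p = (h, k)" by (simp add: q' p h_def k_def fun_diff_def)
    have yh: "y = (\<lambda>s. x s + h s)" and ek: "\<eta>' = (\<lambda>s. \<eta> s + k s)" by (simp_all add: h_def k_def)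
    have h: "h \<in> E" unfolding h_def by (intro E_diff U_E x y)
    have k: "k \<in> L2" unfolding k_def by (intro L2_diff(1) \<eta> \<eta>')
    have sm: "N h < d1" "N h < d2" "L2_seminorm k < d2"
      using small P_bounds(1,2)[of h k] P_bounds(2)[where h=h and k=k] unfolding qp by linarith+
    have "P (DT q r - DT p r) \<le> N (\<lambda>s. dPhi y g s - dPhi x g s)
        + L2_seminorm (\<lambda>s. ddPhi 0 y \<eta>' g l s - ddPhi 0 x \<eta> g l s)"
      unfolding q' p r' DT_def using P_bounds(3) by (simp add: fun_diff_def)
    also have "\<dots> \<le> e / 3 * N g + e / 3 * (N g + L2_seminorm l)"
      using d1(2)[OF h _ sm(1) g] d2(2)[OF h k _ sm(2,3) g l] y unfolding yh ek
      by (intro add_mono) auto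
    also have "\<dots> \<le> e / 3 * P r + e / 3 * (P r + P r)"
      unfolding r' using e P_bounds(1,2)[of g l] P_bounds(2)[where h=g and k=l]
      by (intro add_mono mult_left_mono) auto
    finally show ?thesis by simp
  qed
  then show "\<exists>d>0. \<forall>q\<in>U \<times> L2. P (q - p) < d \<longrightarrow> (\<forall>r\<in>tangent_space \<iota>. P (DT q r - DT p r) \<le> e * P r)"
    using d1(1) d2(1) by (intro exI[of _ "min d1 d2"]) auto
qed

end

theorem theorem3p4:
  fixes \<iota> :: "'b::{real_inner, banach, second_countable_topology} \<Rightarrow>
              'a::{real_inner, banach, second_countable_topology}"
    and O1 :: "(real \<times> 'a) set"
    and \<phi> :: "real \<times> 'a \<Rightarrow> 'a"
  assumes "dense_inclusion \<iota>"
    and "open O1"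
    and "parametrized_tame \<iota> O1 \<phi>"
    and "asymptotically_constant O1 \<phi>"
  shows "weak_tangent_map \<phi> ` (path_domain \<iota> O1 \<times> L2) \<subseteq> W12_L2 \<iota> \<times> L2 \<and>
         C1_map (tangent_space \<iota>) (tangent_norm \<iota>) (tangent_space \<iota>) (tangent_norm \<iota>)
           (path_domain \<iota> O1 \<times> L2) (weak_tangent_map \<phi>)"
proof -
  obtain T where T: "T > 0" and same: "\<And>s t. T \<le> s \<and> T \<le> t \<or> s \<le> -T \<and> t \<le> -T \<Longrightarrow> same_slice_map O1 \<phi> s t"
    and zero: "\<And>s. \<bar>s\<bar> \<ge> T \<Longrightarrow> 0 \<in> slice O1 s \<and> \<phi> (s, 0) = 0"
    using assms(4) unfolding asymptotically_constant_def by blast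
  have "const_at_ends T O1 \<phi>"
    unfolding const_at_ends_def
  proof (intro allI impI)
    fix s t x assume c: "T \<le> s \<and> T \<le> t \<or> s \<le> -T \<and> t \<le> -T" and sx: "(s, x) \<in> O1"
    show "(t, x) \<in> O1 \<and> \<phi> (s, x) = \<phi> (t, x)"
      using same[OF c] sx unfolding same_slice_map_def slice_def by blast
  qed
  then interpret tame_map \<iota> O1 \<phi> T
    using assms T zero by unfold_locales (auto simp: slice_def)
  show ?thesis using weak_tangent_mem C1_map_weak_tangent by blast
qed

end
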